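(* Let $d\ge2$, $k\in\{0,\ldots,d-2\}$ and let $F$ be a self-similar set in $\mathbb{R}^d$ satisfying the open set condition OSC and the regularity condition RC. Then the curvature bound condition CBC (for the index $k$) is independent of the choice of the constant $R$; i.e., if $R_1$ and $R_2$ are two constants with $R_i>\sqrt2\,\mathrm{diam}F$ for $i=1,2$, then CBC with $R=R_1$ is satisfied if and only if CBC with $R=R_2$ is satisfied.
   Context: Parallel sets and curvature measures. For $K\subset\mathbb{R}^d$ and $\varepsilon\ge0$ put $K_\varepsilon:=\{x\in\mathbb{R}^d:\mathrm{dist}(x,K)\le\varepsilon\}$. For compact $K$, let $\widetilde{K}$ be the closure of the complement of $K$. A distance $\varepsilon\ge 0$ is called regular for the compact set $K$ if $\widetilde{K_\varepsilon}$ has positive reach in the sense of Federer and the boundary $\partial K_\varepsilon$ is a Lipschitz manifold. For regular $\varepsilon$ and $k\in\{0,\ldots,d-1\}$ define the signed measure $C_k(K_\varepsilon,\cdot):=(-1)^{d-1-k}C_k(\widetilde{K_\varepsilon},\cdot)$, where on the right $C_k$ denotes Federer's $k$-th (Lipschitz-Killing) curvature measure of a set of positive reach. $C_k^{\mathrm{var}}(K_\varepsilon,\cdot)$ is the total variation measure of $C_k(K_\varepsilon,\cdot)$. Self-similar sets. $F$ is the unique nonempty compact set with $F=\bigcup_{i=1}^N S_iF$, where $S_1,\ldots,S_N:\mathbb{R}^d\to\mathbb{R}^d$ are contracting similarities with ratios $r_i\in(0,1)$; write $\mathbf{S}(A):=\bigcup_{i=1}^N S_i(A)$. OSC: there is a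 nonempty bounded open set $O$ with $\bigcup_iS_iO\subseteq O$ and $S_iO\cap S_jO=\emptyset$ for $i\ne j$. SOSC: there is such an $O$ with additionally $O\cap F\neq\emptyset$ (in $\mathbb{R}^d$, OSC and SOSC are equivalent). RC: almost all $\varepsilon\in(0,\sqrt2\,\mathrm{diam}F)$ are regular for $F$. (There are no irregular values $\varepsilon\ge\sqrt2\,\mathrm{diam}F$.) Words. $\Sigma^*:=\bigcup_{j\ge0}\{1,\ldots,N\}^j$; for $\omega=\omega_1\cdots\omega_n\in\Sigma^*$, $|\omega|=n$, $\omega|m=\omega_1\cdots\omega_m$ for $m\le n$, $r_\omega=r_{\omega_1}\cdots r_{\omega_n}$, $S_\omega=S_{\omega_1}\circ\cdots\circ S_{\omega_n}$ (with $r_\emptyset=1$). Fix an open set $O$ as in SOSC. Given a constant $R>\sqrt2\,\mathrm{diam}F$, for $0<\varepsilon\le R$ let $\Sigma(\varepsilon)$ be the set of all words $\omega\in\Sigma^*$ (of length at least $1$) with $Rr_\omega<\varepsilon\le Rr_{\omega|(|\omega|-1)}$, and $\Sigma_b(\varepsilon):=\{\omega\in\Sigma(\varepsilon):(S_\omega F)_\varepsilon\cap((\mathbf{S}O)^c)_\varepsilon\ne\emptyset\}$, where $(\mathbf{S}O)^c$ is the complement of $\mathbf{S}O$. Both families depend on $R$. CBC (for the index $k$, with constant $R$): there is a constant $c_k$ such that for almost all $\varepsilon\in(0,R)$ and all $\sigma\in\Sigma_b(\varepsilon)$ $$C_k^{\mathrm{var}}\Big(F_\varepsilon,\ \partial(S_\sigma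 F)_\varepsilon\cap\partial\bigcup_{\sigma'\in\Sigma(\varepsilon)\setminus\{\sigma\}}(S_{\sigma'}F)_\varepsilon\Big)\le c_k\varepsilon^k.$$ *)

theory Defs
  imports "HOL-Analysis.Analysis"
begin

section \<open>Parallel sets, reach and Lipschitz manifolds\<close>

text \<open>The library convention \<open>infdist x {} = 0\<close> is immaterial here: parallel sets are
  only ever taken of nonempty sets.\<close>

definition parallel_set :: "real \<Rightarrow> 'a::euclidean_space set \<Rightarrow> 'a set" where
  "parallel_set \<epsilon> K = {x. infdist x K \<le> \<epsilon>}"

definition closed_complement :: "'a::euclidean_space set \<Rightarrow> 'a set" where
  "closed_complement K = closure (- K)"

definition Unp :: "'a::euclidean_space set \<Rightarrow> 'a set" where
  "Unp A = {x. \<exists>!a. a \<in> A \<and> dist x a = infdist x A}"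

definition reach_at :: "'a::euclidean_space set \<Rightarrow> 'a \<Rightarrow> ereal" where
  "reach_at A a = (SUP r \<in> {r. ball a r \<subseteq> Unp A}. ereal r)"

definition reach :: "'a::euclidean_space set \<Rightarrow> ereal" where
  "reach A = (INF a \<in> A. reach_at A a)"

text \<open>A hypersurface every point of which has a relatively open neighbourhood that is
  bi-Lipschitz homeomorphic to an open subset of \<open>\<real>\<^sup>d\<^sup>-\<^sup>1\<close>; the coordinate hyperplane
  orthogonal to a basis vector \<open>b\<close> serves as the isometric copy of \<open>\<real>\<^sup>d\<^sup>-\<^sup>1\<close>.\<close>

definition lipschitz_hypersurface :: "'a::euclidean_space set \<Rightarrow> bool" where
  "lipschitz_hypersurface M \<longleftrightarrow>
     (\<forall>x\<in>M. \<exists>V W b f g L.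
        x \<in> V \<and> openin (top_of_set M) V \<and>
        b \<in> (Basis::'a set) \<and> openin (top_of_set {y. y \<bullet> b = 0}) W \<and>
        homeomorphism V W f g \<and> L-lipschitz_on V f \<and> L-lipschitz_on W g)"

definition regular_distance :: "'a::euclidean_space set \<Rightarrow> real \<Rightarrow> bool" where
  "regular_distance K \<epsilon> \<longleftrightarrow>
     0 \<le> \<epsilon> \<and> reach (closed_complement (parallel_set \<epsilon> K)) > 0 \<and>
     lipschitz_hypersurface (frontier (parallel_set \<epsilon> K))"


section \<open>Curvature measures\<close>

text \<open>Federer's definition: the curvature measures of a set \<open>A\<close> of positive reach are the
  unique signed Radon measures \<open>\<Phi> 0, \<dots>, \<Phi> d\<close> for which the local Steiner formula holds.
  Since \<open>A\<close> may be unbounded, signed Radon measures are represented by their values on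
  bounded Borel sets.\<close>

definition signed_radon_measure :: "('a::euclidean_space set \<Rightarrow> real) \<Rightarrow> bool" where
  "signed_radon_measure \<mu> \<longleftrightarrow>
     (\<forall>E::nat \<Rightarrow> 'a set. range E \<subseteq> sets borel \<longrightarrow> disjoint_family E \<longrightarrow> bounded (\<Union>i. E i) \<longrightarrow>
        (\<lambda>i. \<mu> (E i)) sums \<mu> (\<Union>i. E i))"

definition steiner_system :: "'a::euclidean_space set \<Rightarrow> (nat \<Rightarrow> 'a set \<Rightarrow> real) \<Rightarrow> bool" where
  "steiner_system A \<Phi> \<longleftrightarrow>
     (\<forall>m \<le> DIM('a). signed_radon_measure (\<Phi> m)) \<and>
     (\<forall>B r. B \<in> sets borel \<longrightarrow> bounded B \<longrightarrow> 0 \<le> r \<longrightarrow> ereal r < reach A \<longrightarrow>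
        measure lebesgue {x. infdist x A \<le> r \<and> closest_point A x \<in> B} =
        (\<Sum>m\<le>DIM('a). r ^ (DIM('a) - m) * unit_ball_vol (real (DIM('a) - m)) * \<Phi> m B))"

text \<open>The value is determined for \<open>reach A > 0\<close>, \<open>m \<le> d\<close> and bounded Borel sets \<open>B\<close>,
  and only used in that case.\<close>

definition curvature_measure :: "nat \<Rightarrow> 'a::euclidean_space set \<Rightarrow> 'a set \<Rightarrow> real" where
  "curvature_measure m A B = (THE c. \<exists>\<Phi>. steiner_system A \<Phi> \<and> c = \<Phi> m B)"

lemma steiner_system_unique:
  fixes A :: "'a::euclidean_space set"
  assumes "reach A > 0" "steiner_system A \<Phi>" "steiner_system A \<Psi>"
    and "m \<le> DIM('a)" "B \<in> sets borel" "bounded B"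
  shows "\<Phi> m B = \<Psi> m B"
proof -
  define d where "d = DIM('a)"
  define a where "a j = unit_ball_vol (real j) * (\<Phi> (d - j) B - \<Psi> (d - j) B)" for j
  obtain \<rho> where \<rho>: "0 < \<rho>" "ereal \<rho> < reach A"
    using assms(1) ereal_dense2[of 0 "reach A"] by (auto simp: zero_ereal_def)
  have zero: "(\<Sum>j\<le>d. a j * r ^ j) = 0" if r: "r \<in> {0..\<rho>}" for r
  proof -
    have r': "0 \<le> r" "ereal r < reach A"
      using r \<rho> by (auto intro: le_less_trans[of _ "ereal \<rho>"])
    have eq: "measure lebesgue {x. infdist x A \<le> r \<and> closest_point A x \<in> B} =
        (\<Sum>m\<le>d. r ^ (d - m) * unit_ball_vol (real (d - m)) * \<Theta> m B)"
      if "steiner_system A \<Theta>" for \<Theta>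
      using that r' assms(5,6) unfolding steiner_system_def d_def by blast
    have "(\<Sum>m\<le>d. r ^ (d - m) * unit_ball_vol (real (d - m)) * \<Phi> m B) =
          (\<Sum>m\<le>d. r ^ (d - m) * unit_ball_vol (real (d - m)) * \<Psi> m B)"
      using eq[OF assms(2)] eq[OF assms(3)] by (rule trans[OF sym])
    then have "(\<Sum>m\<le>d. r ^ (d - m) * unit_ball_vol (real (d - m)) * (\<Phi> m B - \<Psi> m B)) = 0"
      by (simp add: right_diff_distrib sum_subtractf)
    also have "(\<Sum>m\<le>d. r ^ (d - m) * unit_ball_vol (real (d - m)) * (\<Phi> m B - \<Psi> m B)) =
               (\<Sum>j\<le>d. a j * r ^ j)"
      by (rule sum.reindex_bij_witness[of _ "\<lambda>j. d - j" "\<lambda>j. d - j"]) (auto simp: a_def)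
    finally show ?thesis .
  qed
  have "a j = 0" if "j \<le> d" for j
  proof (rule ccontr)
    assume "a j \<noteq> 0"
    then have "finite {r. (\<Sum>j\<le>d. a j * r ^ j) = 0}"
      using polyfun_roots_finite[of a j d] that by simp
    moreover have "{0..\<rho>} \<subseteq> {r. (\<Sum>j\<le>d. a j * r ^ j) = 0}" using zero by auto
    ultimately have "finite {0..\<rho>}" by (rule rev_finite_subset)
    then show False using \<rho>(1) infinite_Icc by blast
  qed
  then have "a (d - m) = 0" by simp
  moreover have "unit_ball_vol (real (d - m)) \<noteq> 0"
    using unit_ball_vol_pos[of "real (d - m)"] by linarith
  moreover have "d - (d - m) = m" using assms(4) by (simp add: d_def)
  ultimately show ?thesis unfolding a_def by (metis eq_iff_diff_eq_0 mult_eq_0_iff)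
qed

text \<open>The curvature measure of the parallel set \<open>K\<^sub>\<epsilon>\<close>, for regular \<open>\<epsilon>\<close> and \<open>k < d\<close>, defined
  through the closure of the complement.\<close>

definition parallel_curvature :: "nat \<Rightarrow> 'a::euclidean_space set \<Rightarrow> real \<Rightarrow> 'a set \<Rightarrow> real" where
  "parallel_curvature k K \<epsilon> B =
     (-1) ^ (DIM('a) - 1 - k) * curvature_measure k (closed_complement (parallel_set \<epsilon> K)) B"

definition total_variation :: "('a::topological_space set \<Rightarrow> real) \<Rightarrow> 'a set \<Rightarrow> ennreal" where
  "total_variation \<mu> B =
     (SUP P \<in> {P. finite P \<and> partition_on B P \<and> P \<subseteq> sets borel}. \<Sum>E\<in>P. ennreal \<bar>\<mu> E\<bar>)"


section \<open>Self-similar sets\<close>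

definition contracting_similarities ::
    "nat \<Rightarrow> (nat \<Rightarrow> 'a::euclidean_space \<Rightarrow> 'a) \<Rightarrow> (nat \<Rightarrow> real) \<Rightarrow> bool" where
  "contracting_similarities N S r \<longleftrightarrow>
     (\<forall>i\<in>{1..N}. 0 < r i \<and> r i < 1 \<and> (\<forall>x y. dist (S i x) (S i y) = r i * dist x y))"

definition hutchinson ::
    "nat \<Rightarrow> (nat \<Rightarrow> 'a::euclidean_space \<Rightarrow> 'a) \<Rightarrow> 'a set \<Rightarrow> 'a set" where
  "hutchinson N S A = (\<Union>i\<in>{1..N}. S i ` A)"

definition self_similar_set ::
    "nat \<Rightarrow> (nat \<Rightarrow> 'a::euclidean_space \<Rightarrow> 'a) \<Rightarrow> 'a set \<Rightarrow> bool" where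
  "self_similar_set N S F \<longleftrightarrow> F \<noteq> {} \<and> compact F \<and> F = hutchinson N S F"

definition osc_set ::
    "nat \<Rightarrow> (nat \<Rightarrow> 'a::euclidean_space \<Rightarrow> 'a) \<Rightarrow> 'a set \<Rightarrow> bool" where
  "osc_set N S U \<longleftrightarrow>
     U \<noteq> {} \<and> bounded U \<and> open U \<and> hutchinson N S U \<subseteq> U \<and>
     (\<forall>i\<in>{1..N}. \<forall>j\<in>{1..N}. i \<noteq> j \<longrightarrow> S i ` U \<inter> S j ` U = {})"

definition OSC :: "nat \<Rightarrow> (nat \<Rightarrow> 'a::euclidean_space \<Rightarrow> 'a) \<Rightarrow> bool" where
  "OSC N S \<longleftrightarrow> (\<exists>U. osc_set N S U)"

definition sosc_set ::
    "nat \<Rightarrow> (nat \<Rightarrow> 'a::euclidean_space \<Rightarrow> 'a) \<Rightarrow> 'a set \<Rightarrow> 'a set \<Rightarrow> bool" where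
  "sosc_set N S F U \<longleftrightarrow> osc_set N S U \<and> U \<inter> F \<noteq> {}"

definition RC :: "'a::euclidean_space set \<Rightarrow> bool" where
  "RC F \<longleftrightarrow>
     (AE \<epsilon> in lebesgue. 0 < \<epsilon> \<and> \<epsilon> < sqrt 2 * diameter F \<longrightarrow> regular_distance F \<epsilon>)"


section \<open>Words and the curvature bound condition\<close>

definition word_ratio :: "(nat \<Rightarrow> real) \<Rightarrow> nat list \<Rightarrow> real" where
  "word_ratio r \<omega> = prod_list (map r \<omega>)"

definition word_map :: "(nat \<Rightarrow> 'a \<Rightarrow> 'a) \<Rightarrow> nat list \<Rightarrow> 'a \<Rightarrow> 'a" where
  "word_map S \<omega> = foldr (\<lambda>i f. S i \<circ> f) \<omega> id"

definition cut_words :: "nat \<Rightarrow> (nat \<Rightarrow> real) \<Rightarrow> real \<Rightarrow> real \<Rightarrow> nat list set" where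
  "cut_words N r R \<epsilon> =
     {\<omega> \<in> lists {1..N}. \<omega> \<noteq> [] \<and> R * word_ratio r \<omega> < \<epsilon> \<and> \<epsilon> \<le> R * word_ratio r (butlast \<omega>)}"

definition boundary_words ::
    "nat \<Rightarrow> (nat \<Rightarrow> 'a::euclidean_space \<Rightarrow> 'a) \<Rightarrow> (nat \<Rightarrow> real) \<Rightarrow> 'a set \<Rightarrow> 'a set
       \<Rightarrow> real \<Rightarrow> real \<Rightarrow> nat list set" where
  "boundary_words N S r F U R \<epsilon> =
     {\<omega> \<in> cut_words N r R \<epsilon>.
        parallel_set \<epsilon> (word_map S \<omega> ` F) \<inter> parallel_set \<epsilon> (- hutchinson N S U) \<noteq> {}}"

definition CBC ::
    "nat \<Rightarrow> nat \<Rightarrow> (nat \<Rightarrow> 'a::euclidean_space \<Rightarrow> 'a) \<Rightarrow> (nat \<Rightarrow> real) \<Rightarrow> 'a set \<Rightarrow> 'a set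
       \<Rightarrow> real \<Rightarrow> bool" where
  "CBC k N S r F U R \<longleftrightarrow>
     (\<exists>c::real. AE \<epsilon> in lebesgue. 0 < \<epsilon> \<and> \<epsilon> < R \<longrightarrow>
        (\<forall>\<sigma> \<in> boundary_words N S r F U R \<epsilon>.
           total_variation (parallel_curvature k F \<epsilon>)
             (frontier (parallel_set \<epsilon> (word_map S \<sigma> ` F)) \<inter>
              frontier (\<Union>\<sigma>' \<in> cut_words N r R \<epsilon> - {\<sigma>}. parallel_set \<epsilon> (word_map S \<sigma>' ` F)))
           \<le> ennreal (c * \<epsilon> ^ k)))"

end

theory Submission
  imports Defs
begin

text \<open>
  The curvature bound over \<open>R\<close> is shown to be equivalent to a bound for the curvature of
  \<open>F\<^sub>\<epsilon>\<close> on the whole boundary part \<open>\<partial>F\<^sub>\<epsilon> \<inter> (S\<^sub>\<sigma>F)\<^sub>\<epsilon>\<close>, for all words \<open>\<sigma> \<in> \<Sigma>(\<epsilon>)\<close>. Off the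
  intersection with the other pieces, \<open>F\<^sub>\<epsilon>\<close> coincides with \<open>(S\<^sub>\<sigma>F)\<^sub>\<epsilon>\<close>, a parallel set at a
  distance larger than \<open>\<surd>2\<close> times the diameter; and near a piece that is not a boundary piece,
  \<open>F\<^sub>\<epsilon>\<close> is a scaled copy of a parallel set of \<open>F\<close> at a larger distance, so that one can induct on
  the length of the word. The stronger bound transfers between two constants because a word
  cut for one of them is covered by boundedly many words cut for the other.

  This needs the local Steiner formula for sets of positive reach. Moving all points of a tube
  towards their feet by the factor \<open>1 - t\<close> is the map \<open>x \<mapsto> (1 - t) x + t foot(x)\<close>, where the foot map
  is monotone. If a smooth monotone map replaces the foot map, the volume of the image is a
  polynomial in \<open>t\<close>, being the integral of a Jacobian determinant; a softmax over finitely many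
  points of the set provides such approximations, and polynomials of bounded degree are
  closed under limits. No differentiability of the foot map is used.
\<close>

section \<open>Polynomials on an interval\<close>

text \<open>The set measured in CBC involves \<sigma> together with all other words of
  \<Sigma>(\<epsilon>). Another R changes both the pieces and their overlaps, and cutting a piece
  further creates overlaps inside it about which the bound for the coarser cut says nothing. The
  boundary part involves no other word and grows with the piece, so it can be compared. The number
  sqrt 2 makes a piece small in view of \<epsilon>: if sqrt 2 * diam K \<le> \<epsilon>, then from
  the relevant points at distance about \<epsilon> all of K is seen in nearly the same direction,
  and this forces reach at least \<epsilon>/2 for the closed complement of K_\<epsilon>. As R > sqrt
  2 * diam F, this covers every cut piece. The induction on words loses nothing, since k-th
  curvature scales like \<epsilon>^k. It visits only the countably many distances \<epsilon> / r_w,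
  so null sets of exceptional \<epsilon> do no harm. The Steiner formula has to be proved because
  \<open>curvature_measure\<close> is a definite description: additivity, locality and scaling of
  its values all rest on the existence of a Steiner system.\<close>

definition lagrange_basis :: "(nat \<Rightarrow> real) \<Rightarrow> nat \<Rightarrow> nat \<Rightarrow> real poly" where
  "lagrange_basis t d i = (\<Prod>j\<in>{..d} - {i}. smult (inverse (t i - t j)) [:- t j, 1:])"

lemma degree_lagrange_basis: "i \<le> d \<Longrightarrow> degree (lagrange_basis t d i) \<le> d"
proof -
  assume "i \<le> d"
  have "degree (lagrange_basis t d i)
      \<le> (\<Sum>j\<in>{..d} - {i}. degree (smult (inverse (t i - t j)) [:- t j, 1:]))"
    unfolding lagrange_basis_def by (rule degree_prod_sum_le[unfolded comp_def]) auto
  also have "\<dots> \<le> (\<Sum>j\<in>{..d} - {i}. 1)"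
    by (rule sum_mono) (use degree_smult_le[of _ "[:_, 1:]"] in simp)
  also have "\<dots> = d" using \<open>i \<le> d\<close> by simp
  finally show ?thesis .
qed

lemma poly_lagrange_basis:
  assumes "inj_on t {..d}" "i \<le> d" "j \<le> d"
  shows "poly (lagrange_basis t d i) (t j) = (if i = j then 1 else 0)"
proof -
  have *: "poly (lagrange_basis t d i) (t j)
      = (\<Prod>l\<in>{..d} - {i}. (t j - t l) / (t i - t l))"
    unfolding lagrange_basis_def poly_prod by (simp add: divide_inverse left_diff_distrib mult.commute)
  show ?thesis
  proof (cases "i = j")
    case True
    have "(\<Prod>l\<in>{..d} - {i}. (t j - t l) / (t i - t l)) = 1"
    proof (rule prod.neutral, rule ballI)
      fix l assume "l \<in> {..d} - {i}"
      then have "t i \<noteq> t l" using assms(1,2) by (auto simp: inj_on_def)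
      then show "(t j - t l) / (t i - t l) = 1" unfolding True[symmetric] by simp
    qed
    then show ?thesis unfolding * using True by (simp only: if_True refl)
  next
    case False
    then have "\<exists>l\<in>{..d} - {i}. (t j - t l) / (t i - t l) = 0"
      using assms by (intro bexI[of _ j]) simp_all
    then have "(\<Prod>l\<in>{..d} - {i}. (t j - t l) / (t i - t l)) = 0"
      by (rule prod_zero[rotated]) (rule finite_Diff[OF finite_atMost])
    then show ?thesis unfolding * by (simp only: False if_False refl)
  qed
qed

lemma poly_eqI_infinite:
  fixes p q :: "real poly"
  assumes "infinite X" "\<And>x. x \<in> X \<Longrightarrow> poly p x = poly q x"
  shows "p = q"
proof (rule ccontr)
  assume "p \<noteq> q"
  then have "finite {x. poly (p - q) x = 0}" by (intro poly_roots_finite) auto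
  moreover have "X \<subseteq> {x. poly (p - q) x = 0}" using assms(2) by auto
  ultimately show False using assms(1) finite_subset by blast
qed

text \<open>Both sides have degree at most d and agree at d + 1 nodes. The weights depend on the
  nodes only, not on \<open>p\<close>, so what holds linearly at finitely many values (limits, sums,
  integrals, additivity in a set) passes to all values and to the coefficients.\<close>

lemma lagrange_interpolation:
  assumes "inj_on t {..d}" "degree p \<le> d"
  shows "p = (\<Sum>i\<le>d. smult (poly p (t i)) (lagrange_basis t d i))"
proof (rule ccontr)
  let ?q = "\<Sum>i\<le>d. smult (poly p (t i)) (lagrange_basis t d i)"
  assume "p \<noteq> ?q"
  then have nz: "p - ?q \<noteq> 0" by simp
  have "degree ?q \<le> d"
    by (intro degree_sum_le order_trans[OF degree_smult_le] degree_lagrange_basis) auto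
  then have deg: "degree (p - ?q) \<le> d" using assms(2) degree_diff_le by blast
  have "t ` {..d} \<subseteq> {x. poly (p - ?q) x = 0}"
  proof (rule image_subsetI)
    fix j assume j: "j \<in> {..d}"
    have "poly ?q (t j) = (\<Sum>i\<le>d. poly p (t i) * (if i = j then 1 else 0))"
      unfolding poly_sum poly_smult
      by (rule sum.cong) (use assms j in \<open>auto simp: poly_lagrange_basis\<close>)
    also have "\<dots> = poly p (t j)" using j by (simp add: if_distrib[of "(*) _"] cong: if_cong)
    finally show "t j \<in> {x. poly (p - ?q) x = 0}" by simp
  qed
  then have "card (t ` {..d}) \<le> card {x. poly (p - ?q) x = 0}"
    by (rule card_mono[OF poly_roots_finite[OF nz]])
  also have "\<dots> \<le> d" using card_poly_roots_bound[OF nz] deg by simp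
  finally show False using assms(1) by (simp add: card_image)
qed

section \<open>Closure properties of polynomial functions of bounded degree\<close>

definition polynomial_on :: "nat \<Rightarrow> real set \<Rightarrow> (real \<Rightarrow> real) \<Rightarrow> bool" where
  "polynomial_on d I f \<longleftrightarrow> (\<exists>p. degree p \<le> d \<and> (\<forall>x\<in>I. f x = poly p x))"

lemma polynomial_on_cong:
  "polynomial_on d I f \<Longrightarrow> (\<And>x. x \<in> I \<Longrightarrow> g x = f x) \<Longrightarrow> polynomial_on d I g"
  unfolding polynomial_on_def by auto

lemma polynomial_on_0: "polynomial_on d I (\<lambda>x. 0)"
  unfolding polynomial_on_def by (rule exI[of _ 0]) auto

lemma polynomial_on_diff:
  assumes "polynomial_on d I f" "polynomial_on d I g"
  shows "polynomial_on d I (\<lambda>x. f x - g x)"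
proof -
  obtain p q where "degree p \<le> d" "degree q \<le> d" "\<forall>x\<in>I. f x = poly p x" "\<forall>x\<in>I. g x = poly q x"
    using assms unfolding polynomial_on_def by blast
  then show ?thesis
    unfolding polynomial_on_def by (intro exI[of _ "p - q"]) (auto intro: degree_diff_le)
qed

lemma polynomial_on_add:
  assumes "polynomial_on d I f" "polynomial_on d I g"
  shows "polynomial_on d I (\<lambda>x. f x + g x)"
proof -
  obtain p q where "degree p \<le> d" "degree q \<le> d" "\<forall>x\<in>I. f x = poly p x" "\<forall>x\<in>I. g x = poly q x"
    using assms unfolding polynomial_on_def by blast
  then show ?thesis
    unfolding polynomial_on_def by (intro exI[of _ "p + q"]) (auto intro: degree_add_le)
qed

lemma polynomial_on_sum:
  "(\<And>i. i \<in> A \<Longrightarrow> polynomial_on d I (f i)) \<Longrightarrow> polynomial_on d I (\<lambda>x. \<Sum>i\<in>A. f i x)"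
  by (induction A rule: infinite_finite_induct) (auto intro: polynomial_on_0 polynomial_on_add)

text \<open>Pointwise convergence is enough: d + 1 fixed nodes in \<open>I\<close> determine every
  \<open>f n\<close> through the same weights, and this identity passes to the limit.\<close>

lemma polynomial_on_limit:
  assumes lim: "\<And>x. x \<in> I \<Longrightarrow> (\<lambda>n. f n x) \<longlonglongrightarrow> g x"
    and poly: "\<And>n. polynomial_on d I (f n)" and "infinite I"
  shows "polynomial_on d I g"
proof -
  obtain T where T: "T \<subseteq> I" "card T = Suc d" "finite T"
    using infinite_arbitrarily_large[OF \<open>infinite I\<close>] by metis
  obtain t where "bij_betw t {0..<Suc d} T" using T ex_bij_betw_nat_finite by metis
  then have t: "inj_on t {..d}" "\<And>i. i \<le> d \<Longrightarrow> t i \<in> I"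
    using T(1) by (auto simp: bij_betw_def lessThan_Suc_atMost atLeast0LessThan)
  define p where "p = (\<Sum>i\<le>d. smult (g (t i)) (lagrange_basis t d i))"
  have "g x = poly p x" if x: "x \<in> I" for x
  proof (rule LIMSEQ_unique[OF lim[OF x]])
    have "f n x = (\<Sum>i\<le>d. f n (t i) * poly (lagrange_basis t d i) x)" for n
    proof -
      obtain q where q: "degree q \<le> d" "\<forall>x\<in>I. f n x = poly q x"
        using poly unfolding polynomial_on_def by blast
      have "poly q x = (\<Sum>i\<le>d. poly q (t i) * poly (lagrange_basis t d i) x)"
        by (subst lagrange_interpolation[OF t(1) q(1)]) (simp add: poly_sum)
      then show ?thesis using q(2) x t(2) by simp
    qed
    moreover have "(\<lambda>n. \<Sum>i\<le>d. f n (t i) * poly (lagrange_basis t d i) x) \<longlonglongrightarrow> poly p x"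
      unfolding p_def poly_sum poly_smult by (intro tendsto_intros lim t(2)) auto
    ultimately show "(\<lambda>n. f n x) \<longlonglongrightarrow> poly p x" by simp
  qed
  moreover have "degree p \<le> d" unfolding p_def
    by (intro degree_sum_le order_trans[OF degree_smult_le] degree_lagrange_basis) auto
  ultimately show ?thesis unfolding polynomial_on_def by blast
qed

lemma polynomial_on_suminf:
  assumes "\<And>i::nat. polynomial_on d I (f i)" "\<And>x. x \<in> I \<Longrightarrow> (\<lambda>i. f i x) sums g x" "infinite I"
  shows "polynomial_on d I g"
proof (rule polynomial_on_limit[OF _ _ assms(3)])
  show "(\<lambda>n. \<Sum>i<n. f i x) \<longlonglongrightarrow> g x" if "x \<in> I" for x
    using assms(2)[OF that] unfolding sums_def .
  show "polynomial_on d I (\<lambda>x. \<Sum>i<n. f i x)" for n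
    by (rule polynomial_on_sum) (rule assms(1))
qed

lemma degree_prod_linear_le:
  fixes a b :: "'i \<Rightarrow> real"
  shows "finite A \<Longrightarrow> degree (\<Prod>i\<in>A. [:a i, b i:]) \<le> card A"
proof -
  assume "finite A"
  then have "degree (\<Prod>i\<in>A. [:a i, b i:]) \<le> (\<Sum>i\<in>A. degree [:a i, b i:])"
    by (rule degree_prod_sum_le[unfolded comp_def])
  also have "\<dots> \<le> (\<Sum>i\<in>A. 1)" by (rule sum_mono) simp
  finally show ?thesis by simp
qed

text \<open>By the Leibniz formula: each summand is a product of \<open>CARD('n)\<close> entries,
  each affine in t.\<close>

lemma polynomial_on_det:
  fixes M :: "real^'n^'n"
  shows "polynomial_on CARD('n) I (\<lambda>t. det ((1 - t) *\<^sub>R mat 1 + t *\<^sub>R M))"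
proof -
  define q where "q = (\<lambda>\<sigma>. \<Prod>i\<in>UNIV. [:(mat 1 :: real^'n^'n) $ i $ \<sigma> i,
      M $ i $ \<sigma> i - (mat 1 :: real^'n^'n) $ i $ \<sigma> i:])"
  define p where "p = (\<Sum>\<sigma> | \<sigma> permutes (UNIV::'n set). smult (of_int (sign \<sigma>)) (q \<sigma>))"
  have "degree (q \<sigma>) \<le> CARD('n)" for \<sigma>
    unfolding q_def by (rule degree_prod_linear_le) simp
  then have "degree p \<le> CARD('n)"
    unfolding p_def by (intro degree_sum_le order_trans[OF degree_smult_le]) auto
  moreover have "det ((1 - t) *\<^sub>R mat 1 + t *\<^sub>R M) = poly p t" for t
    unfolding det_def p_def q_def poly_sum poly_smult poly_prod
    by (intro sum.cong refl arg_cong2[where f="(*)"] prod.cong) (auto simp: algebra_simps)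
  ultimately show ?thesis unfolding polynomial_on_def by blast
qed

section \<open>Monotone maps interpolated with the identity\<close>

lemma monotone_interpolation_inner:
  fixes h :: "'a::real_inner \<Rightarrow> 'a"
  assumes "0 \<le> (h x - h y) \<bullet> (x - y)" "0 \<le> t" "t \<le> 1"
  shows "(1 - t) * norm (x - y) \<le> norm (((1 - t) *\<^sub>R x + t *\<^sub>R h x) - ((1 - t) *\<^sub>R y + t *\<^sub>R h y))"
    (is "_ \<le> norm ?D")
proof (cases "x = y")
  case False
  \<comment> \<open>The difference of the images is paired with x - y: monotonicity makes the
    contribution of h nonnegative, and Cauchy-Schwarz turns the pairing into a norm.\<close>
  have "(1 - t) * norm (x - y) * norm (x - y) = (1 - t) * ((x - y) \<bullet> (x - y))"
    by (simp add: dot_square_norm power2_eq_square)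
  also have "\<dots> \<le> (1 - t) * ((x - y) \<bullet> (x - y)) + t * ((h x - h y) \<bullet> (x - y))"
    using assms by simp
  also have "\<dots> = ?D \<bullet> (x - y)" by (simp add: algebra_simps inner_diff_left inner_diff_right)
  also have "\<dots> \<le> norm ?D * norm (x - y)" by (rule norm_cauchy_schwarz)
  finally show ?thesis using False by simp
qed auto

lemma inj_monotone_interpolation:
  fixes h :: "'a::real_inner \<Rightarrow> 'a"
  assumes "\<And>x y. x \<in> S \<Longrightarrow> y \<in> S \<Longrightarrow> 0 \<le> (h x - h y) \<bullet> (x - y)" "0 \<le> t" "t < 1"
  shows "inj_on (\<lambda>x. (1 - t) *\<^sub>R x + t *\<^sub>R h x) S"
proof (rule inj_onI)
  fix x y assume xy: "x \<in> S" "y \<in> S" and eq: "(1 - t) *\<^sub>R x + t *\<^sub>R h x = (1 - t) *\<^sub>R y + t *\<^sub>R h y"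
  have "(1 - t) * norm (x - y) \<le> 0"
    using monotone_interpolation_inner[of h x y t] assms xy eq by auto
  then show "x = y" using assms(3) by (simp add: mult_le_0_iff)
qed

text \<open>Along a line in direction v, monotonicity of h says that s \<mapsto> h (x + s v)
  \<bullet> v is nondecreasing, and h' v \<bullet> v is its derivative at 0.\<close>

lemma monotone_derivative_nonneg:
  fixes h :: "'a::real_inner \<Rightarrow> 'a"
  assumes h: "(h has_derivative h') (at x)" and mono: "\<And>x y. 0 \<le> (h x - h y) \<bullet> (x - y)"
  shows "0 \<le> h' v \<bullet> v"
proof -
  interpret bounded_linear h' using h by (rule has_derivative_bounded_linear)
  have "((\<lambda>s. x + s *\<^sub>R v) has_derivative (\<lambda>s. s *\<^sub>R v)) (at (0::real))"
    by (auto intro!: derivative_eq_intros)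
  then have "((\<lambda>s. h (x + s *\<^sub>R v)) has_derivative (\<lambda>s. h' (s *\<^sub>R v))) (at 0)"
    by (rule has_derivative_compose) (use h in simp)
  then have "((\<lambda>s. h (x + s *\<^sub>R v) \<bullet> v) has_derivative (\<lambda>s. h' (s *\<^sub>R v) \<bullet> v)) (at 0)"
    by (rule has_derivative_inner_left)
  then have D: "((\<lambda>s. h (x + s *\<^sub>R v) \<bullet> v) has_real_derivative h' v \<bullet> v) (at 0)"
    by (simp add: has_field_derivative_def scaleR mult.commute[of _ "_ \<bullet> _"] mult_commute_abs)
  have "mono_on UNIV (\<lambda>s::real. h (x + s *\<^sub>R v) \<bullet> v)"
  proof (rule mono_onI)
    fix s s' :: real assume "s \<le> s'"
    show "h (x + s *\<^sub>R v) \<bullet> v \<le> h (x + s' *\<^sub>R v) \<bullet> v"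
    proof (cases "s = s'")
      case False
      have "0 \<le> (h (x + s' *\<^sub>R v) - h (x + s *\<^sub>R v)) \<bullet> ((s' - s) *\<^sub>R v)"
        using mono[of "x + s' *\<^sub>R v" "x + s *\<^sub>R v"] by (simp add: algebra_simps)
      then show ?thesis using False \<open>s \<le> s'\<close>
        by (simp add: zero_le_mult_iff inner_diff_left)
    qed simp
  qed
  then show ?thesis by (rule mono_on_imp_deriv_nonneg[OF _ D]) simp
qed

section \<open>Volumes of monotone images\<close>

lemma matrix_interpolation:
  fixes f :: "real^'n \<Rightarrow> real^'n"
  assumes "linear f"
  shows "matrix (\<lambda>v. (1 - t) *\<^sub>R v + t *\<^sub>R f v) = (1 - t) *\<^sub>R mat 1 + t *\<^sub>R matrix f"
  by (simp add: matrix_def vec_eq_iff mat_def axis_def)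

text \<open>The determinant is 1 at t = 0 and cannot vanish before t = 1, because the interpolated
  map is injective; so it keeps its sign. This removes the absolute value from the Jacobian, leaving
  a polynomial in t.\<close>

lemma det_interpolation_pos:
  fixes f :: "real^'n \<Rightarrow> real^'n"
  assumes "linear f" and nonneg: "\<And>v. 0 \<le> f v \<bullet> v" and "0 \<le> t" "t < 1"
  shows "0 < det ((1 - t) *\<^sub>R mat 1 + t *\<^sub>R matrix f)" (is "0 < ?D t")
proof (rule ccontr)
  have "?D s \<noteq> 0" if s: "0 \<le> s" "s < 1" for s
  proof -
    let ?g = "\<lambda>v. (1 - s) *\<^sub>R v + s *\<^sub>R f v"
    have lin: "linear ?g"
      using assms(1) by (intro linear_compose_add linear_compose_scale_right linear_ident)
    have "inj ?g"
      by (rule inj_monotone_interpolation) (use s nonneg linear_diff[OF assms(1)] in \<open>auto simp flip: linear_diff[OF assms(1)]\<close>)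
    then have "det (matrix ?g) \<noteq> 0" using det_nz_iff_inj[OF lin] by simp
    then show ?thesis by (simp only: matrix_interpolation[OF assms(1)] not_False_eq_True)
  qed
  note nz = this
  assume "\<not> 0 < ?D t"
  moreover have "?D 0 = 1" by (simp add: det_I)
  moreover have "continuous_on {0..t} ?D"
  proof -
    obtain p where "\<forall>x\<in>UNIV. ?D x = poly p x"
      using polynomial_on_det[of UNIV "matrix f"] unfolding polynomial_on_def by blast
    then have eq: "?D = poly p" by auto
    have "continuous_on {0..t} (poly p)" by (intro continuous_intros)
    then show ?thesis by (simp only: eq)
  qed
  ultimately obtain s where "0 \<le> s" "s \<le> t" "?D s = 0"
    using IVT2'[of ?D t 0 0] assms(3) by auto
  then show False using nz[of s] assms(4) by auto
qed

lemma measure_monotone_interpolation_vec: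
  fixes h :: "real^'n::{finite,wellorder} \<Rightarrow> real^'n::_"
  assumes h: "\<And>x. (h has_derivative h' x) (at x)"
    and mono: "\<And>x y. 0 \<le> (h x - h y) \<bullet> (x - y)"
    and S: "compact S"
  shows "polynomial_on CARD('n) {0..<1}
    (\<lambda>t. measure lebesgue ((\<lambda>x. (1 - t) *\<^sub>R x + t *\<^sub>R h x) ` S))"
proof -
  define D where "D t x = det ((1 - t) *\<^sub>R mat 1 + t *\<^sub>R matrix (h' x))" for t x
  let ?g = "\<lambda>t x. (1 - t) *\<^sub>R x + t *\<^sub>R h x"
  have lin: "linear (h' x)" for x using h has_derivative_linear by blast
  have int: "(D t has_integral measure lebesgue (?g t ` S)) S" if t: "t \<in> {0..<1}" for t
  proof -
    have der: "(?g t has_derivative (\<lambda>v. (1 - t) *\<^sub>R v + t *\<^sub>R h' x v)) (at x within S)" for x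
      by (auto intro!: derivative_eq_intros has_derivative_at_withinI[OF h])
    have "continuous_on S (?g t)"
      using der by (meson has_derivative_continuous_on)
    then have "compact (?g t ` S)" using S compact_continuous_image by blast
    then have "?g t ` S \<in> lmeasurable" by (rule lmeasurable_compact)
    moreover have "inj_on (?g t) S"
      using t by (intro inj_monotone_interpolation mono) auto
    ultimately have "((\<lambda>x. \<bar>det (matrix (\<lambda>v. (1 - t) *\<^sub>R v + t *\<^sub>R h' x v))\<bar>)
        has_integral measure lebesgue (?g t ` S)) S"
    proof -
      assume *: "?g t ` S \<in> lmeasurable" "inj_on (?g t) S"
      have "S \<in> sets lebesgue" using S by (simp add: lmeasurable_compact fmeasurableD)
      then show ?thesis
        using has_measure_differentiable_image[OF _ der *(2)] *(1) by blast
    qed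
    moreover have "\<bar>det (matrix (\<lambda>v. (1 - t) *\<^sub>R v + t *\<^sub>R h' x v))\<bar> = D t x" for x
      unfolding matrix_interpolation[OF lin] D_def
      using det_interpolation_pos[OF lin monotone_derivative_nonneg[OF h mono], of t x] t by simp
    ultimately show ?thesis by simp
  qed
  \<comment> \<open>These are d + 1 nodes in [0,1), where the integral of \<open>D\<close> is
    already known to be a volume. Interpolating under the integral writes \<open>D t\<close> as a
    combination of the \<open>D (s i)\<close>, so no integrability of single coefficients has to be
    shown.\<close>
  define s where "s i = real i / (CARD('n) + 1)" for i
  have s: "s i \<in> {0..<1}" if "i \<le> CARD('n)" for i using that by (auto simp: s_def)
  have inj: "inj_on s {..CARD('n)}" by (auto simp: inj_on_def s_def)
  define p where "p = (\<Sum>i\<le>CARD('n). smult (measure lebesgue (?g (s i) ` S)) (lagrange_basis s CARD('n) i))"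
  have "measure lebesgue (?g t ` S) = poly p t" if t: "t \<in> {0..<1}" for t
  proof -
    have "D t x = (\<Sum>i\<le>CARD('n). D (s i) x * poly (lagrange_basis s CARD('n) i) t)" for x
    proof -
      obtain q where q: "degree q \<le> CARD('n)" "\<forall>t\<in>UNIV. D t x = poly q t"
        using polynomial_on_det[of UNIV "matrix (h' x)"] unfolding polynomial_on_def D_def by blast
      have "poly q t = (\<Sum>i\<le>CARD('n). poly q (s i) * poly (lagrange_basis s CARD('n) i) t)"
        by (subst lagrange_interpolation[OF inj q(1)]) (simp add: poly_sum)
      then show ?thesis using q(2) by simp
    qed
    then have "(D t has_integral poly p t) S"
      unfolding p_def poly_sum poly_smult
      by (subst ext[of "D t"], assumption) (intro has_integral_sum has_integral_mult_left int s; simp)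
    then show ?thesis using int[OF t] has_integral_unique by blast
  qed
  moreover have "degree p \<le> CARD('n)" unfolding p_def
    by (intro degree_sum_le order_trans[OF degree_smult_le] degree_lagrange_basis) auto
  ultimately show ?thesis unfolding polynomial_on_def by blast
qed

section \<open>Coordinates on a Euclidean space\<close>

typedef (overloaded) ('a::euclidean_space) basis_index = "Basis :: 'a set"
  using nonempty_Basis by blast

lemma bij_Rep_basis_index: "bij_betw Rep_basis_index UNIV (Basis :: 'a::euclidean_space set)"
  unfolding bij_betw_def
  by (meson Rep_basis_index_inject inj_onI type_definition.Rep_range type_definition_basis_index)

instance basis_index :: (euclidean_space) finite
  by standard (metis bij_Rep_basis_index bij_betw_finite finite_Basis)

lemma CARD_basis_index: "CARD('a::euclidean_space basis_index) = DIM('a)"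
  using bij_betw_same_card[OF bij_Rep_basis_index] by simp

definition basis_index_nat :: "'a::euclidean_space basis_index \<Rightarrow> nat" where
  "basis_index_nat = (SOME f. inj f)"

lemma inj_basis_index_nat: "inj (basis_index_nat :: 'a::euclidean_space basis_index \<Rightarrow> nat)"
proof -
  have "\<exists>f :: 'a basis_index \<Rightarrow> nat. inj f"
    using finite_imp_inj_to_nat_seg[of "UNIV :: 'a basis_index set"] by auto
  then show ?thesis unfolding basis_index_nat_def by (rule someI_ex)
qed

text \<open>The order is arbitrary; it is there because the library states the change of variables
  formula for well-ordered index types.\<close>

instantiation basis_index :: (euclidean_space) wellorder
begin

definition "(i :: 'a basis_index) \<le> j \<longleftrightarrow> basis_index_nat i \<le> basis_index_nat j"
definition "(i :: 'a basis_index) < j \<longleftrightarrow> basis_index_nat i < basis_index_nat j"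

instance
proof
  fix P :: "'a basis_index \<Rightarrow> bool" and a :: "'a basis_index"
  assume step: "\<And>x. (\<And>y. y < x \<Longrightarrow> P y) \<Longrightarrow> P x"
  show "P a"
    by (rule measure_induct_rule[of basis_index_nat]) (use step less_basis_index_def in blast)
qed (auto simp: less_eq_basis_index_def less_basis_index_def dest: injD[OF inj_basis_index_nat])

end

text \<open>A linear isometry onto a coordinate space, along which the change of variables formula
  for \<open>real^'n\<close> is carried over to an arbitrary Euclidean space.\<close>

definition to_vec :: "'a::euclidean_space \<Rightarrow> real^'a basis_index" where
  "to_vec x = (\<chi> i. x \<bullet> Rep_basis_index i)"

definition of_vec :: "real^'a basis_index \<Rightarrow> 'a::euclidean_space" where
  "of_vec v = (\<Sum>i\<in>UNIV. v $ i *\<^sub>R Rep_basis_index i)"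

lemma sum_basis_index: "(\<Sum>i\<in>UNIV. f (Rep_basis_index i)) = (\<Sum>b\<in>Basis. f (b::'a::euclidean_space))"
  by (rule sum.reindex_bij_betw[OF bij_Rep_basis_index])

lemma of_vec_to_vec [simp]: "of_vec (to_vec x) = x"
  unfolding of_vec_def to_vec_def
  by (simp add: sum_basis_index[of "\<lambda>b. (x \<bullet> b) *\<^sub>R b"] euclidean_representation)

lemma linear_to_vec: "linear to_vec"
  by standard (auto simp: to_vec_def vec_eq_iff inner_add_left)

lemma linear_of_vec: "linear of_vec"
  by standard (auto simp: of_vec_def algebra_simps sum.distrib scaleR_sum_right)

lemma to_vec_of_vec [simp]:
  fixes v :: "real^'a::euclidean_space basis_index"
  shows "to_vec (of_vec v) = v"
proof -
  have "surj (to_vec :: 'a \<Rightarrow> _)"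
  proof (rule surjI)
    fix v :: "real^'a basis_index"
    have "of_vec v \<bullet> Rep_basis_index j = v $ j" for j :: "'a basis_index"
    proof -
      have "of_vec v \<bullet> Rep_basis_index j = (\<Sum>i\<in>UNIV. v $ i * (Rep_basis_index i \<bullet> Rep_basis_index j))"
        by (simp add: of_vec_def inner_sum_left)
      also have "\<dots> = (\<Sum>i\<in>UNIV. v $ i * (if i = j then 1 else 0))"
        by (simp add: inner_Basis[OF Rep_basis_index Rep_basis_index] Rep_basis_index_inject)
      finally show ?thesis by (simp add: if_distrib[of "(*) _"] cong: if_cong)
    qed
    then show "to_vec (of_vec v) = v" by (simp add: to_vec_def vec_eq_iff)
  qed
  then obtain x where "v = to_vec x" by (metis surjD)
  then show ?thesis by simp
qed

lemma inner_to_vec [simp]: "to_vec x \<bullet> to_vec y = x \<bullet> y"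
  unfolding to_vec_def inner_vec_def
  by (simp add: sum_basis_index[of "\<lambda>b. (x \<bullet> b) * (y \<bullet> b)"] euclidean_inner[of x y])

lemma norm_to_vec [simp]: "norm (to_vec x) = norm x"
  by (simp add: norm_eq_sqrt_inner)

lemma norm_of_vec [simp]: "norm (of_vec v) = norm v"
  by (metis norm_to_vec to_vec_of_vec)

lemma continuous_on_to_vec: "continuous_on S to_vec"
  by (rule linear_continuous_on) (rule linear_conv_bounded_linear[THEN iffD1, OF linear_to_vec])

lemma continuous_on_of_vec: "continuous_on S of_vec"
  by (rule linear_continuous_on) (rule linear_conv_bounded_linear[THEN iffD1, OF linear_of_vec])

text \<open>A Borel measure that gives every box the product of its edge lengths is
  \<open>lborel\<close>, and \<open>of_vec\<close> pulls boxes back to boxes with the same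
  edges.\<close>

lemma distr_of_vec: "distr lborel borel of_vec = (lborel :: 'a::euclidean_space measure)"
proof (rule lborel_eqI[symmetric])
  have meas: "of_vec \<in> borel_measurable borel"
    by (rule borel_measurable_continuous_onI) (rule continuous_on_of_vec)
  fix l u :: 'a assume lu: "\<And>b. b \<in> Basis \<Longrightarrow> l \<bullet> b \<le> u \<bullet> b"
  have "of_vec -` box l u = box (to_vec l) (to_vec u)"
  proof (rule set_eqI)
    fix v :: "real^'a basis_index"
    obtain x where x: "v = to_vec x" by (metis to_vec_of_vec)
    have "x \<in> box l u \<longleftrightarrow> (\<forall>i. l \<bullet> Rep_basis_index i < x \<bullet> Rep_basis_index i \<and> x \<bullet> Rep_basis_index i < u \<bullet> Rep_basis_index i)"
      unfolding mem_box bij_betw_imp_surj_on[OF bij_Rep_basis_index, symmetric] by blast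
    moreover have "v \<in> box (to_vec l) (to_vec u)
        \<longleftrightarrow> (\<forall>i. l \<bullet> Rep_basis_index i < x \<bullet> Rep_basis_index i \<and> x \<bullet> Rep_basis_index i < u \<bullet> Rep_basis_index i)"
      unfolding x mem_box_cart to_vec_def by simp
    ultimately show "v \<in> of_vec -` box l u \<longleftrightarrow> v \<in> box (to_vec l) (to_vec u)"
      by (simp add: x)
  qed
  then have "emeasure (distr lborel borel of_vec) (box l u) = emeasure lborel (box (to_vec l) (to_vec u))"
    by (subst emeasure_distr) (use meas in auto)
  also have "\<dots> = ennreal (\<Prod>b\<in>Basis. (to_vec u - to_vec l) \<bullet> b)"
    by (rule emeasure_lborel_box) (use lu[OF Rep_basis_index] in \<open>auto simp: Basis_vec_def inner_axis to_vec_def\<close>)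
  also have "(\<Prod>b\<in>Basis. (to_vec u - to_vec l) \<bullet> b) = (\<Prod>i\<in>UNIV. (u - l) \<bullet> Rep_basis_index i)"
    by (subst prod.reindex_bij_betw[of "\<lambda>i. axis i 1" UNIV Basis, symmetric])
      (auto simp: bij_betw_def inj_on_def axis_eq_axis Basis_vec_def inner_axis to_vec_def inner_diff_left)
  also have "\<dots> = (\<Prod>b\<in>Basis. (u - l) \<bullet> b)"
    by (rule prod.reindex_bij_betw[OF bij_Rep_basis_index])
  finally show "emeasure (distr lborel borel of_vec) (box l u) = ennreal (\<Prod>b\<in>Basis. (u - l) \<bullet> b)" .
qed simp

lemma measure_to_vec:
  fixes S :: "'a::euclidean_space set"
  assumes "S \<in> sets borel"
  shows "to_vec ` S \<in> sets borel" "measure lebesgue (to_vec ` S) = measure lebesgue S"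
proof -
  have meas: "of_vec \<in> borel_measurable borel"
    by (rule borel_measurable_continuous_onI) (rule continuous_on_of_vec)
  have eq: "to_vec ` S = of_vec -` S" by (auto intro: rev_image_eqI)
  show 1: "to_vec ` S \<in> sets borel"
    using measurable_sets[OF meas assms] by (simp add: eq)
  have "emeasure lborel S = emeasure lborel (to_vec ` S)"
    by (subst distr_of_vec[symmetric], subst emeasure_distr) (use meas assms eq in auto)
  then show "measure lebesgue (to_vec ` S) = measure lebesgue S"
    using assms 1 by (simp add: measure_def)
qed

lemma measure_monotone_interpolation:
  fixes h :: "'a::euclidean_space \<Rightarrow> 'a"
  assumes h: "\<And>x. (h has_derivative h' x) (at x)"
    and mono: "\<And>x y. 0 \<le> (h x - h y) \<bullet> (x - y)"
    and S: "compact S"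
  shows "polynomial_on DIM('a) {0..<1}
    (\<lambda>t. measure lebesgue ((\<lambda>x. (1 - t) *\<^sub>R x + t *\<^sub>R h x) ` S))"
proof -
  define k where "k = to_vec \<circ> h \<circ> of_vec"
  have "(k has_derivative (to_vec \<circ> h' (of_vec v) \<circ> of_vec)) (at v)" for v
    unfolding k_def o_assoc
    by (intro diff_chain_at linear_imp_has_derivative linear_of_vec linear_to_vec h)
  moreover have "0 \<le> (k v - k w) \<bullet> (v - w)" for v w
  proof -
    obtain x y where "v = to_vec x" "w = to_vec y" by (metis to_vec_of_vec)
    then show ?thesis using mono[of x y] by (simp add: k_def flip: linear_diff[OF linear_to_vec])
  qed
  moreover have "compact (to_vec ` S)"
    by (rule compact_continuous_image[OF continuous_on_to_vec S])
  ultimately have "polynomial_on CARD('a basis_index) {0..<1}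
      (\<lambda>t. measure lebesgue ((\<lambda>x. (1 - t) *\<^sub>R x + t *\<^sub>R k x) ` to_vec ` S))"
    by (rule measure_monotone_interpolation_vec)
  moreover have "(\<lambda>x. (1 - t) *\<^sub>R x + t *\<^sub>R k x) ` to_vec ` S
      = to_vec ` (\<lambda>x. (1 - t) *\<^sub>R x + t *\<^sub>R h x) ` S" for t
    by (simp add: image_image k_def linear_add[OF linear_to_vec] linear_scale[OF linear_to_vec])
  moreover have "(\<lambda>x. (1 - t) *\<^sub>R x + t *\<^sub>R h x) ` S \<in> sets borel" for t
  proof -
    have "continuous_on S h" using h has_derivative_continuous by (meson continuous_at_imp_continuous_on)
    then show ?thesis using S
      by (intro borel_compact compact_continuous_image continuous_intros)
  qed
  ultimately show ?thesis by (simp only: measure_to_vec CARD_basis_index)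
qed

lemma measure_orthogonal_image_borel:
  fixes f :: "'a::euclidean_space \<Rightarrow> 'a"
  assumes "orthogonal_transformation f" and "S \<in> sets borel" "bounded S"
  shows "measure lebesgue (f ` S) = measure lebesgue S"
proof -
  have "linear f" using assms(1) orthogonal_transformation_linear by blast
  define k where "k = to_vec \<circ> f \<circ> of_vec"
  have k: "orthogonal_transformation k"
    unfolding orthogonal_transformation k_def
    using \<open>linear f\<close> assms(1) by (auto simp: linear_to_vec linear_of_vec orthogonal_transformation_norm intro!: linear_compose)
  have "to_vec ` S \<in> lmeasurable"
    using measure_to_vec(1)[OF assms(2)] assms(3) bounded_linear_image[of S to_vec] linear_conv_bounded_linear linear_to_vec
    by (intro bounded_set_imp_lmeasurable) auto
  then have "measure lebesgue (k ` to_vec ` S) = measure lebesgue (to_vec ` S)"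
    by (rule measure_orthogonal_image[OF k])
  moreover have "k ` to_vec ` S = to_vec ` f ` S" by (simp add: k_def image_image)
  moreover have "f ` S \<in> sets borel"
  proof -
    obtain g where g: "linear g" "\<And>x. g (f x) = x" "\<And>x. f (g x) = x"
      using linear_injective_isomorphism[OF \<open>linear f\<close> orthogonal_transformation_inj[OF assms(1)]] by blast
    then have "f ` S = g -` S" by (auto intro: rev_image_eqI)
    moreover have "g \<in> borel_measurable borel"
      by (rule borel_measurable_continuous_onI) (simp add: linear_continuous_on linear_linear g)
    ultimately show ?thesis using measurable_sets[of g borel borel S] assms(2) by simp
  qed
  ultimately show ?thesis using assms(2) by (simp only: measure_to_vec)
qed

section \<open>Nearest points of sets of positive reach\<close>

lemma closest_point_infdist:
  fixes A :: "'a::euclidean_space set"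
  assumes "closed A" "A \<noteq> {}"
  shows "closest_point A x \<in> A" "dist x (closest_point A x) = infdist x A"
proof -
  note * = closest_point_exists[OF assms, of x]
  then show "closest_point A x \<in> A" by blast
  have "dist x (closest_point A x) \<le> infdist x A"
    unfolding infdist_notempty[OF assms(2)] using * assms(2) by (intro cINF_greatest) auto
  then show "dist x (closest_point A x) = infdist x A"
    using * infdist_le by (intro antisym) blast+
qed

lemma le_infdist:
  "A \<noteq> {} \<Longrightarrow> (\<And>a. a \<in> A \<Longrightarrow> r \<le> dist x a) \<Longrightarrow> r \<le> infdist x A"
  by (simp add: infdist_notempty cINF_greatest)

text \<open>A point of \<open>A\<close> nearer to an intermediate point than \<open>a\<close> would,
  by the triangle inequality, be nearer to \<open>y\<close> than \<open>a\<close> as well.\<close>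

lemma infdist_segment:
  fixes a :: "'a::euclidean_space"
  assumes "a \<in> A" "dist y a = infdist y A" "0 \<le> s" "s \<le> 1"
  shows "infdist (a + s *\<^sub>R (y - a)) A = s * infdist y A"
    and "dist (a + s *\<^sub>R (y - a)) a = s * infdist y A"
proof -
  show d: "dist (a + s *\<^sub>R (y - a)) a = s * infdist y A"
    using assms by (simp add: dist_norm)
  have "y - (a + s *\<^sub>R (y - a)) = (1 - s) *\<^sub>R (y - a)" by (simp add: algebra_simps)
  then have "dist y (a + s *\<^sub>R (y - a)) = (1 - s) * infdist y A"
    using assms by (simp add: dist_norm)
  then have "infdist y A \<le> infdist (a + s *\<^sub>R (y - a)) A + (1 - s) * infdist y A"
    using infdist_triangle[of y A "a + s *\<^sub>R (y - a)"] by simp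
  then show "infdist (a + s *\<^sub>R (y - a)) A = s * infdist y A"
    using infdist_le[OF assms(1), of "a + s *\<^sub>R (y - a)"] d by (simp add: algebra_simps)
qed

text \<open>The set whose volume the local Steiner formula expands in powers of
  \<open>r\<close>.\<close>

abbreviation tube :: "'a::euclidean_space set \<Rightarrow> 'a set \<Rightarrow> real \<Rightarrow> 'a set" where
  "tube A B r \<equiv> {x. infdist x A \<le> r \<and> closest_point A x \<in> B}"

text \<open>\<open>R\<close> stands for a real number below the reach, which itself may be infinite;
  see \<open>unique_foot_reach\<close>.\<close>

locale unique_foot =
  fixes A :: "'a::euclidean_space set" and R :: real
  assumes closed_A: "closed A" and nonempty_A: "A \<noteq> {}"
    and Unp: "\<And>x. infdist x A < R \<Longrightarrow> x \<in> Unp A"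
begin

abbreviation foot :: "'a \<Rightarrow> 'a" where "foot \<equiv> closest_point A"

lemmas foot_in = closest_point_infdist(1)[OF closed_A nonempty_A]
  and dist_foot = closest_point_infdist(2)[OF closed_A nonempty_A]

lemma norm_foot: "norm (x - foot x) = infdist x A"
  using dist_foot[of x] by (simp add: dist_norm)

lemma foot_unique:
  assumes "infdist x A < R" "a \<in> A" "dist x a \<le> infdist x A"
  shows "foot x = a"
proof -
  have "\<exists>!a. a \<in> A \<and> dist x a = infdist x A" using Unp[OF assms(1)] unfolding Unp_def by simp
  moreover have "dist x a = infdist x A" using assms(3) infdist_le[OF assms(2), of x] by simp
  ultimately show ?thesis using foot_in[of x] dist_foot[of x] assms(2) by blast
qed

text \<open>Closed graph argument: on a ball the feet stay in a compact part of \<open>A\<close>,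
  and uniqueness makes the graph the solution set of the closed condition dist \<le> infdist.
  Brouwer's theorem in \<open>normal_step\<close> needs this continuity before any Lipschitz bound
  is available.\<close>

lemma continuous_on_foot_cball:
  assumes "\<And>y. y \<in> cball z \<delta> \<Longrightarrow> infdist y A < R"
  shows "continuous_on (cball z \<delta>) foot"
proof (cases "cball z \<delta> = {}")
  case False
  then have "0 \<le> \<delta>" by auto
  define T where "T = A \<inter> cball z (\<delta> + R)"
  have T: "compact T" unfolding T_def using closed_A by (simp add: closed_Int_compact)
  have im: "foot \<in> cball z \<delta> \<rightarrow> T"
  proof
    fix y assume y: "y \<in> cball z \<delta>"
    have "dist z (foot y) \<le> dist z y + dist y (foot y)" by (rule dist_triangle)
    also have "\<dots> \<le> \<delta> + R" using y assms[OF y] dist_foot[of y] by (intro add_mono) auto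
    finally show "foot y \<in> T" using foot_in by (simp add: T_def)
  qed
  have "(\<lambda>x. (x, foot x)) ` cball z \<delta>
      = (cball z \<delta> \<times> T) \<inter> {p. dist (fst p) (snd p) \<le> infdist (fst p) A}"
  proof (intro set_eqI iffI)
    fix p assume "p \<in> (\<lambda>x. (x, foot x)) ` cball z \<delta>"
    then show "p \<in> (cball z \<delta> \<times> T) \<inter> {p. dist (fst p) (snd p) \<le> infdist (fst p) A}"
      using im dist_foot by auto
  next
    fix p assume p: "p \<in> (cball z \<delta> \<times> T) \<inter> {p. dist (fst p) (snd p) \<le> infdist (fst p) A}"
    then have "foot (fst p) = snd p"
      by (intro foot_unique) (use assms in \<open>auto simp: T_def\<close>)
    then show "p \<in> (\<lambda>x. (x, foot x)) ` cball z \<delta>"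
      using p by (intro image_eqI[of _ _ "fst p"]) (auto simp: prod_eq_iff)
  qed
  moreover have "closed {p::'a \<times> 'a. dist (fst p) (snd p) \<le> infdist (fst p) A}"
    by (intro closed_Collect_le continuous_intros)
  ultimately have "closed ((\<lambda>x. (x, foot x)) ` cball z \<delta>)"
    using T by (simp add: closed_Int closed_Times compact_imp_closed)
  then show ?thesis by (rule continuous_from_closed_graph[OF T im])
qed auto

text \<open>Brouwer's theorem applied to the map that sends \<open>y\<close> to the point at distance \<open>\<delta>\<close> from
  \<open>z\<close> opposite to the foot of \<open>y\<close>: its fixed point lies on the prolonged normal through \<open>z\<close>.\<close>

lemma normal_step:
  assumes z: "0 < infdist z A" and "0 < \<delta>" and zR: "infdist z A + \<delta> < R"
  shows "infdist (z + (\<delta> / infdist z A) *\<^sub>R (z - foot z)) A = infdist z A + \<delta>"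
proof -
  have near: "infdist y A < R" if "y \<in> cball z \<delta>" for y
    using that infdist_triangle[of y A z] zR by (auto simp: dist_commute)
  have ne: "z \<noteq> foot y" for y using z foot_in[of y] by (metis infdist_zero less_irrefl)
  define F where "F = (\<lambda>y. z + (\<delta> / norm (z - foot y)) *\<^sub>R (z - foot y))"
  have "continuous_on (cball z \<delta>) F"
    unfolding F_def using ne by (intro continuous_intros continuous_on_foot_cball near) auto
  moreover have F: "dist z (F y) = \<delta>" for y
    using ne[of y] \<open>0 < \<delta>\<close> by (simp add: F_def dist_norm)
  ultimately obtain y where y: "y \<in> cball z \<delta>" "F y = y"
    using brouwer_ball[OF \<open>0 < \<delta>\<close>, of z F] F by auto
  define b where "b = foot y"
  define n where "n = norm (z - b)"
  have n: "0 < n" using ne[of y] by (simp add: n_def b_def)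
  have yz: "y = z + (\<delta> / n) *\<^sub>R (z - b)" using y(2) by (simp add: F_def n_def b_def)
  have zb: "z = b + (n / (n + \<delta>)) *\<^sub>R (y - b)"
  proof -
    have "y - b = (1 + \<delta> / n) *\<^sub>R (z - b)" unfolding yz by (simp add: algebra_simps)
    also have "1 + \<delta> / n = (n + \<delta>) / n" using n by (simp add: field_simps)
    finally have "y - b = ((n + \<delta>) / n) *\<^sub>R (z - b)" .
    then show ?thesis using n \<open>0 < \<delta>\<close> by simp
  qed
  have yb: "dist y b = infdist y A" "b \<in> A" by (simp_all add: b_def dist_foot foot_in)
  have s: "0 \<le> n / (n + \<delta>)" "n / (n + \<delta>) \<le> 1" using n \<open>0 < \<delta>\<close> by auto
  \<comment> \<open>z lies on the segment from the fixed point y to its foot b, so b is also the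
    foot of z, and y is the prolonged point of the claim.\<close>
  have "dist z b = infdist z A" using infdist_segment[OF yb(2,1) s] zb by simp
  then have fz: "foot z = b" using foot_unique yb(2) zR \<open>0 < \<delta>\<close> by simp
  then have nz: "n = infdist z A" using norm_foot[of z] by (simp add: n_def)
  have "y - b = (1 + \<delta> / n) *\<^sub>R (z - b)" by (simp add: yz algebra_simps)
  then have "dist y b = (1 + \<delta> / n) * n" using n \<open>0 < \<delta>\<close> by (simp add: dist_norm flip: n_def)
  also have "\<dots> = n + \<delta>" using n by (simp add: distrib_right)
  finally have "infdist y A = n + \<delta>" using yb by simp
  then show ?thesis using yz nz fz by simp
qed

text \<open>Points short of x lie on the segment to its foot, where \<open>infdist_segment\<close>
  applies. For longer rays, \<open>normal_step\<close> is applied at a point of the ray already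
  known to have the right distance and the right foot.\<close>

lemma normal_ray:
  assumes x: "0 < infdist x A" "infdist x A < R" and \<tau>: "0 \<le> \<tau>" "\<tau> < R"
  shows "infdist (foot x + (\<tau> / infdist x A) *\<^sub>R (x - foot x)) A = \<tau>"
proof (rule ccontr)
  define a where "a = foot x"
  define u where "u = (x - a) /\<^sub>R infdist x A"
  define p where "p = (\<lambda>\<tau>. a + \<tau> *\<^sub>R u)"
  have u: "norm u = 1" using x norm_foot[of x] by (simp add: u_def a_def)
  have p_eq: "foot x + (\<tau> / infdist x A) *\<^sub>R (x - foot x) = p \<tau>" for \<tau>
    by (simp add: p_def u_def a_def divide_inverse)
  have px: "p (infdist x A) = x" using x by (simp add: p_def u_def)
  assume "infdist (foot x + (\<tau> / infdist x A) *\<^sub>R (x - foot x)) A \<noteq> \<tau>"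
  then have not: "infdist (p \<tau>) A \<noteq> \<tau>" by (simp add: p_eq)
  have x\<tau>: "infdist x A \<le> \<tau>"
  proof (rule ccontr)
    assume "\<not> ?thesis"
    then have "infdist (a + (\<tau> / infdist x A) *\<^sub>R (x - a)) A = \<tau> / infdist x A * infdist x A"
      using x \<tau> dist_foot[of x] foot_in[of x] by (intro infdist_segment) (auto simp: a_def)
    then show False using not x p_eq[of \<tau>] by (simp add: a_def)
  qed
  define G where "G = {s \<in> {0..\<tau>}. infdist (p s) A = s}"
  have "closed G" unfolding G_def p_def
    by (simp add: Collect_conj_eq closed_Int closed_Collect_eq continuous_on_infdist continuous_intros
        flip: atLeastAtMost_iff)
  then have "compact G" unfolding G_def by (metis (no_types, lifting) G_def bounded_closed_interval bounded_subset compact_eq_bounded_closed mem_Collect_eq subsetI)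
  moreover have "infdist x A \<in> G" using x x\<tau> px by (simp add: G_def)
  ultimately obtain s where s: "s \<in> G" "\<And>s'. s' \<in> G \<Longrightarrow> s' \<le> s"
    using compact_attains_sup[of G] by blast
  have s0: "0 < s" "s < \<tau>" "infdist (p s) A = s"
    using s not \<open>infdist x A \<in> G\<close> x(1) by (force simp: G_def less_le)+
  have "dist (p s) a = s" using s0 u by (simp add: p_def dist_norm)
  then have fs: "foot (p s) = a"
    using s0 \<tau> foot_in[of x] by (intro foot_unique) (auto simp: a_def)
  have "infdist (p s + ((\<tau> - s) / s) *\<^sub>R (p s - a)) A = s + (\<tau> - s)"
    using normal_step[of "p s" "\<tau> - s"] s0 \<tau> fs by simp
  moreover have "p s + ((\<tau> - s) / s) *\<^sub>R (p s - a) = p \<tau>"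
  proof -
    have "p s + ((\<tau> - s) / s) *\<^sub>R (p s - a) = a + (s + (\<tau> - s) / s * s) *\<^sub>R u"
      by (simp add: p_def scaleR_add_left)
    then show ?thesis using s0 by (simp add: p_def)
  qed
  ultimately show False using not by simp
qed

text \<open>The ray through x can be followed up to a distance \<tau> > s from \<open>A\<close>, so
  \<open>A\<close> stays outside a ball of radius \<tau> touching it at \<open>foot x\<close>.
  Expanding the square bounds the inner product of x - foot x and foot x - b from below, and the
  fraction 1 - s / \<tau> of |foot x - b|^2 is left over.\<close>

lemma foot_quadratic_growth:
  assumes "s < R" "0 < R"
  obtains c where "0 < c"
    "\<And>x b. infdist x A \<le> s \<Longrightarrow> b \<in> A \<Longrightarrow> (infdist x A)\<^sup>2 + c * (norm (foot x - b))\<^sup>2 \<le> (norm (x - b))\<^sup>2"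
proof
  \<comment> \<open>Strictly between max s 0 and R: the ray is available up to \<tau>, and c = 1 -
    max s 0 / \<tau> is positive. The maximum is there because s may be negative.\<close>
  define \<tau> where "\<tau> = (max s 0 + R) / 2"
  have \<tau>: "max s 0 < \<tau>" "\<tau> < R" using assms by (auto simp: \<tau>_def)
  then show "0 < 1 - max s 0 / \<tau>" by simp
  fix x b assume x: "infdist x A \<le> s" and b: "b \<in> A"
  define a where "a = foot x"
  define t where "t = infdist x A"
  have t: "0 \<le> t" "norm (x - a) = t" using norm_foot[of x] infdist_nonneg by (auto simp: t_def a_def)
  have "- (t / \<tau>) * (norm (a - b))\<^sup>2 \<le> 2 * ((x - a) \<bullet> (a - b))"
  proof (cases "t = 0")
    case False
    then have t0: "0 < t" using t by simp
    have "infdist (a + (\<tau> / t) *\<^sub>R (x - a)) A = \<tau>"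
      using normal_ray[of x \<tau>] t0 x \<tau> assms by (simp add: t_def a_def)
    then have "\<tau> \<le> norm ((a - b) + (\<tau> / t) *\<^sub>R (x - a))"
      using infdist_le[OF b, of "a + (\<tau> / t) *\<^sub>R (x - a)"] by (simp add: dist_norm algebra_simps)
    then have "\<tau>\<^sup>2 \<le> (norm ((a - b) + (\<tau> / t) *\<^sub>R (x - a)))\<^sup>2"
      using \<tau> by (intro power_mono) auto
    also have "\<dots> = (norm (a - b))\<^sup>2 + 2 * (\<tau> / t) * ((x - a) \<bullet> (a - b)) + (\<tau> / t)\<^sup>2 * (norm (x - a))\<^sup>2"
      unfolding power2_norm_eq_inner inner_add_left inner_add_right
      by (simp add: inner_commute power2_eq_square)
    also have "(\<tau> / t)\<^sup>2 * (norm (x - a))\<^sup>2 = \<tau>\<^sup>2" using t t0 by (simp add: power_divide)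
    finally have "0 \<le> (norm (a - b))\<^sup>2 + (\<tau> / t) * (2 * ((x - a) \<bullet> (a - b)))"
      by (simp add: mult_ac)
    then have "0 \<le> (t / \<tau>) * ((norm (a - b))\<^sup>2 + (\<tau> / t) * (2 * ((x - a) \<bullet> (a - b))))"
      using t0 \<tau> by simp
    then show ?thesis using t0 \<tau> by (simp add: distrib_left)
  qed (use t in auto)
  moreover have "(norm (x - b))\<^sup>2 = (norm (x - a))\<^sup>2 + 2 * ((x - a) \<bullet> (a - b)) + (norm (a - b))\<^sup>2"
  proof -
    have "(norm ((x - a) + (a - b)))\<^sup>2 = (norm (x - a))\<^sup>2 + 2 * ((x - a) \<bullet> (a - b)) + (norm (a - b))\<^sup>2"
      unfolding power2_norm_eq_inner inner_add_left inner_add_right by (simp add: inner_commute)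
    then show ?thesis by simp
  qed
  moreover have "(t / \<tau>) * (norm (a - b))\<^sup>2 \<le> (max s 0 / \<tau>) * (norm (a - b))\<^sup>2"
    using x \<tau> by (intro mult_right_mono divide_right_mono) (auto simp: t_def)
  ultimately show "(infdist x A)\<^sup>2 + (1 - max s 0 / \<tau>) * (norm (foot x - b))\<^sup>2 \<le> (norm (x - b))\<^sup>2"
    using t by (simp add: left_diff_distrib flip: a_def t_def)
qed

text \<open>Quadratic growth at x against \<open>foot y\<close>, added to growth at y against
  \<open>foot x\<close>, gives c |foot x - foot y|^2 \<le> (x - y) \<bullet> (foot x - foot
  y).\<close>

lemma foot_Lipschitz:
  assumes "s < R" "0 < R"
  obtains L where "0 < L"
    "\<And>x y. infdist x A \<le> s \<Longrightarrow> infdist y A \<le> s \<Longrightarrow> norm (foot x - foot y) \<le> L * norm (x - y)"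
proof -
  obtain c where c: "0 < c"
    "\<And>x b. infdist x A \<le> s \<Longrightarrow> b \<in> A \<Longrightarrow> (infdist x A)\<^sup>2 + c * (norm (foot x - b))\<^sup>2 \<le> (norm (x - b))\<^sup>2"
    using foot_quadratic_growth[OF assms] by blast
  show ?thesis
  proof
    show "0 < 1 / c" using c by simp
    fix x y assume xy: "infdist x A \<le> s" "infdist y A \<le> s"
    define a b where "a = foot x" and "b = foot y"
    have "(norm (x - a))\<^sup>2 + c * (norm (a - b))\<^sup>2 \<le> (norm (x - b))\<^sup>2"
      "(norm (y - b))\<^sup>2 + c * (norm (b - a))\<^sup>2 \<le> (norm (y - a))\<^sup>2"
      using c(2)[OF xy(1) foot_in[of y]] c(2)[OF xy(2) foot_in[of x]] by (simp_all add: a_def b_def norm_foot)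
    moreover have "(norm (x - b))\<^sup>2 - (norm (x - a))\<^sup>2 + (norm (y - a))\<^sup>2 - (norm (y - b))\<^sup>2
        = 2 * ((x - y) \<bullet> (a - b))"
      unfolding power2_norm_eq_inner by (simp add: inner_diff_left inner_diff_right inner_commute)
    ultimately have "c * (norm (a - b))\<^sup>2 \<le> (x - y) \<bullet> (a - b)"
      unfolding norm_minus_commute[of b a] by linarith
    also have "\<dots> \<le> norm (x - y) * norm (a - b)" by (rule norm_cauchy_schwarz)
    finally have "c * norm (a - b) * norm (a - b) \<le> norm (x - y) * norm (a - b)"
      by (simp add: power2_eq_square mult.assoc)
    then have "c * norm (a - b) \<le> norm (x - y)"
      by (cases "a = b") auto
    then show "norm (foot x - foot y) \<le> 1 / c * norm (x - y)"
      using c(1) by (simp add: a_def b_def field_simps)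
  qed
qed

text \<open>Each foot is at least as close to its own point as the other foot is; the two squared
  inequalities add up to the claim. It holds on the whole space, so \<open>inj_shrink\<close> is
  valid on any set.\<close>

lemma foot_monotone: "0 \<le> (foot x - foot y) \<bullet> (x - y)"
proof -
  have "(norm (x - foot x))\<^sup>2 \<le> (norm (x - foot y))\<^sup>2" "(norm (y - foot y))\<^sup>2 \<le> (norm (y - foot x))\<^sup>2"
    using infdist_le[OF foot_in[of y], of x] infdist_le[OF foot_in[of x], of y]
    by (auto simp: norm_foot dist_norm infdist_nonneg intro!: power_mono)
  then show ?thesis
    unfolding power2_norm_eq_inner by (simp add: inner_diff_left inner_diff_right inner_commute)
qed

lemma continuous_on_foot:
  assumes "s < R"
  shows "continuous_on {x. infdist x A \<le> s} foot"
proof (cases "0 < R")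
  case True
  obtain L where L: "0 < L"
    "\<And>x y. infdist x A \<le> s \<Longrightarrow> infdist y A \<le> s \<Longrightarrow> norm (foot x - foot y) \<le> L * norm (x - y)"
    using foot_Lipschitz[OF assms True] by blast
  have "L-lipschitz_on {x. infdist x A \<le> s} foot"
    using L by (intro lipschitz_onI) (auto simp: dist_norm)
  then show ?thesis by (rule lipschitz_on_continuous_on)
next
  case False
  then have "{x. infdist x A \<le> s} = {}" using assms by (auto simp: not_le intro: less_le_trans[OF _ infdist_nonneg])
  then show ?thesis by simp
qed

text \<open>One inclusion is \<open>infdist_segment\<close>. The other stretches y away from its
  foot by 1 / (1 - t); \<open>normal_ray\<close> ensures that the foot survives, as the new distance
  is at most s < R.\<close>

lemma shrink_image:
  assumes "0 < s" "s < R" "0 \<le> t" "t < 1"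
  shows "(\<lambda>x. (1 - t) *\<^sub>R x + t *\<^sub>R foot x) ` {x. infdist x A \<le> s \<and> foot x \<in> B}
    = {x. infdist x A \<le> (1 - t) * s \<and> foot x \<in> B}" (is "?g ` ?E = ?E'")
proof (intro set_eqI iffI)
  fix y assume "y \<in> ?g ` ?E"
  then obtain x where x: "infdist x A \<le> s" "foot x \<in> B" "y = ?g x" by blast
  have y: "y = foot x + (1 - t) *\<^sub>R (x - foot x)" by (simp add: x algebra_simps)
  have y': "infdist y A = (1 - t) * infdist x A" "dist y (foot x) = (1 - t) * infdist x A"
    using infdist_segment[OF foot_in dist_foot, of "1 - t" x] assms by (simp_all add: y)
  have "(1 - t) * infdist x A \<le> (1 - t) * s" using assms x by (intro mult_left_mono) auto
  moreover have "(1 - t) * s \<le> s" using assms by (simp add: mult_le_cancel_right1)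
  ultimately have "foot y = foot x"
    by (intro foot_unique foot_in) (use y' assms(2) in linarith)+
  then show "y \<in> ?E'" using y' x assms by simp
next
  fix y assume "y \<in> ?E'"
  then have y: "infdist y A \<le> (1 - t) * s" "foot y \<in> B" by auto
  have ts: "(1 - t) * s \<le> s" using assms by (simp add: mult_le_cancel_right1)
  define x where "x = foot y + (1 / (1 - t)) *\<^sub>R (y - foot y)"
  have "infdist x A \<le> s \<and> foot x = foot y"
  proof (cases "infdist y A = 0")
    case True
    then have "x = foot y" using norm_foot[of y] by (simp add: x_def)
    then show ?thesis using assms foot_in[of y] closest_point_self by simp
  next
    case False
    then have pos: "0 < infdist y A" using infdist_nonneg[of y A] by simp
    define \<tau> where "\<tau> = infdist y A / (1 - t)"
    have \<tau>: "0 \<le> \<tau>" "\<tau> \<le> s" using y assms pos by (auto simp: \<tau>_def field_simps)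
    have x: "x = foot y + (\<tau> / infdist y A) *\<^sub>R (y - foot y)" using pos by (simp add: x_def \<tau>_def)
    then have "infdist x A = \<tau>" using normal_ray[of y \<tau>] pos y ts \<tau> assms by simp
    moreover have "dist x (foot y) = \<tau>" using pos \<tau> by (simp add: x dist_norm norm_foot)
    ultimately show ?thesis using \<tau> assms foot_in by (auto intro!: foot_unique)
  qed
  moreover have "y = (1 - t) *\<^sub>R x + t *\<^sub>R foot y"
    using assms by (simp add: x_def algebra_simps)
  ultimately show "y \<in> ?g ` ?E" using y by (intro image_eqI[of _ _ x]) auto
qed

end

section \<open>Smooth monotone approximation of the nearest point map\<close>

text \<open>As 2 (x \<bullet> a) - a \<bullet> a = |x|^2 - |x - a|^2, this is a Gaussian weight in
  |x - a| up to a factor independent of a, which cancels in \<open>softmax_point\<close>.\<close>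

definition softmax_weight :: "real \<Rightarrow> 'a::real_inner \<Rightarrow> 'a \<Rightarrow> real" where
  "softmax_weight \<eta> a x = exp ((2 * (x \<bullet> a) - a \<bullet> a) / (2 * \<eta>))"

text \<open>The gradient in x of \<eta> times the logarithm of the denominator, a convex function;
  for small \<eta> the weight concentrates on the points of \<open>T\<close> nearest to x.\<close>

definition softmax_point :: "real \<Rightarrow> 'a::real_inner set \<Rightarrow> 'a \<Rightarrow> 'a" where
  "softmax_point \<eta> T x = (\<Sum>a\<in>T. softmax_weight \<eta> a x *\<^sub>R a) /\<^sub>R (\<Sum>a\<in>T. softmax_weight \<eta> a x)"

lemma softmax_sum_pos:
  "finite T \<Longrightarrow> T \<noteq> {} \<Longrightarrow> 0 < (\<Sum>a\<in>T. softmax_weight \<eta> a x)"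
  by (rule sum_pos) (auto simp: softmax_weight_def)

lemma softmax_differentiable:
  assumes "finite T" "T \<noteq> {}"
  shows "softmax_point \<eta> T differentiable (at x)"
proof -
  have w: "softmax_weight \<eta> a differentiable (at x)" for a
    unfolding softmax_weight_def differentiable_def divide_inverse
    by (rule exI, (rule derivative_eq_intros refl | simp)+)
  have "(\<lambda>x. \<Sum>a\<in>T. softmax_weight \<eta> a x *\<^sub>R a) differentiable (at x)"
    using assms(1) by (intro differentiable_sum ballI differentiable_scaleR w) auto
  moreover have "(\<lambda>x. inverse (\<Sum>a\<in>T. softmax_weight \<eta> a x)) differentiable (at x)"
    using assms softmax_sum_pos[OF assms, of \<eta> x]
    by (intro differentiable_inverse differentiable_sum ballI w) auto
  ultimately show ?thesis
    unfolding softmax_point_def[abs_def] by (intro differentiable_scaleR)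
qed

text \<open>Symmetrization: pairing (a, b) with (b, a) makes each pair of terms a product of two
  factors of equal sign. This is a direct form of the monotonicity of the gradient of a convex
  function.\<close>

lemma softmax_monotone:
  fixes x y :: "'a::real_inner"
  assumes T: "finite T" "T \<noteq> {}" and "0 < \<eta>"
  shows "0 \<le> (softmax_point \<eta> T x - softmax_point \<eta> T y) \<bullet> (x - y)"
proof -
  define w :: "'a \<Rightarrow> 'a \<Rightarrow> real" where "w = softmax_weight \<eta>"
  define f where "f a b = w a x * w b y * ((a - b) \<bullet> (x - y))" for a b
  have "0 \<le> f a b + f b a" for a b
  proof -
    have ww: "w a x * w b y = exp ((2 * (x \<bullet> a) + 2 * (y \<bullet> b) - a \<bullet> a - b \<bullet> b) / (2 * \<eta>))" for a b
      unfolding w_def softmax_weight_def exp_add[symmetric] add_divide_distrib[symmetric]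
      by (simp add: algebra_simps)
    have le: "w b x * w a y \<le> w a x * w b y" if "0 \<le> (a - b) \<bullet> (x - y)" for a b
    proof -
      have "(a - b) \<bullet> (x - y) = x \<bullet> a + y \<bullet> b - (x \<bullet> b + y \<bullet> a)"
        by (simp add: inner_diff_left inner_diff_right inner_commute)
      then show ?thesis
        unfolding ww exp_le_cancel_iff using \<open>0 < \<eta>\<close> that by (intro divide_right_mono) linarith+
    qed
    have "0 \<le> (w a x * w b y - w b x * w a y) * ((a - b) \<bullet> (x - y))"
    proof (cases "0 \<le> (a - b) \<bullet> (x - y)")
      case False
      moreover have "(b - a) \<bullet> (x - y) = - ((a - b) \<bullet> (x - y))" by (simp add: inner_diff_left)
      ultimately show ?thesis using le[of b a] by (intro mult_nonpos_nonpos) auto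
    qed (use le[of a b] in simp)
    moreover have "(b - a) \<bullet> (x - y) = - ((a - b) \<bullet> (x - y))"
      by (simp add: inner_diff_left)
    ultimately show ?thesis unfolding f_def by (simp only:) (simp add: algebra_simps)
  qed
  then have "0 \<le> (\<Sum>a\<in>T. \<Sum>b\<in>T. f a b + f b a)" by (intro sum_nonneg)
  also have "\<dots> = 2 * (\<Sum>a\<in>T. \<Sum>b\<in>T. f a b)"
    by (simp add: sum.distrib) (rule sum.swap)
  finally have 1: "0 \<le> (\<Sum>a\<in>T. \<Sum>b\<in>T. f a b)" by simp
  define W where "W x = (\<Sum>a\<in>T. w a x)" for x
  have W: "0 < W x" for x using softmax_sum_pos[OF T] by (simp add: W_def w_def)
  have h: "softmax_point \<eta> T x = (\<Sum>a\<in>T. w a x *\<^sub>R a) /\<^sub>R W x" for x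
    by (simp add: softmax_point_def W_def w_def)
  have "(\<Sum>a\<in>T. \<Sum>b\<in>T. f a b)
      = (\<Sum>a\<in>T. \<Sum>b\<in>T. w b y * (w a x *\<^sub>R a \<bullet> (x - y)) - w a x * (w b y *\<^sub>R b \<bullet> (x - y)))"
    unfolding f_def by (intro sum.cong refl) (simp add: inner_diff_left algebra_simps)
  also have "\<dots> = W y * ((\<Sum>a\<in>T. w a x *\<^sub>R a) \<bullet> (x - y)) - W x * ((\<Sum>b\<in>T. w b y *\<^sub>R b) \<bullet> (x - y))"
    unfolding W_def sum_subtractf inner_sum_left sum_product
    by (simp add: sum.swap[of "\<lambda>a b. w b y * _ a"])
  also have "\<dots> = W x * W y * ((softmax_point \<eta> T x - softmax_point \<eta> T y) \<bullet> (x - y))"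
    unfolding h using W[of x] W[of y] by (simp add: inner_diff_left field_simps)
  finally have "0 \<le> W x * W y * ((softmax_point \<eta> T x - softmax_point \<eta> T y) \<bullet> (x - y))"
    using 1 by simp
  moreover have "0 < W x * W y" using W by simp
  ultimately show ?thesis by (metis mult_pos_neg not_le)
qed

lemma softmax_weight_le:
  assumes "0 < \<eta>" "(norm (x - b))\<^sup>2 + 2 * \<eta> * z \<le> (norm (x - a))\<^sup>2"
  shows "softmax_weight \<eta> a x \<le> exp (- z) * softmax_weight \<eta> b x"
proof -
  have "(2 * (x \<bullet> a) - a \<bullet> a) \<le> - (2 * \<eta> * z) + (2 * (x \<bullet> b) - b \<bullet> b)"
    using assms(2) unfolding power2_norm_eq_inner
    by (simp add: inner_diff_left inner_diff_right inner_commute)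
  then have "(2 * (x \<bullet> a) - a \<bullet> a) / (2 * \<eta>) \<le> (- (2 * \<eta> * z) + (2 * (x \<bullet> b) - b \<bullet> b)) / (2 * \<eta>)"
    using assms(1) by (intro divide_right_mono) auto
  also have "\<dots> = - z + (2 * (x \<bullet> b) - b \<bullet> b) / (2 * \<eta>)"
    using assms(1) by (simp add: field_simps)
  finally show ?thesis
    unfolding softmax_weight_def exp_add[symmetric] by simp
qed

lemma (in unique_foot) smooth_monotone_approximation:
  assumes Q: "compact Q" "\<And>x. x \<in> Q \<Longrightarrow> infdist x A \<le> s" and "s < R" and "0 < \<rho>"
  obtains h where "\<And>x. h differentiable (at x)" "\<And>x y. 0 \<le> (h x - h y) \<bullet> (x - y)"
    "\<And>x. x \<in> Q \<Longrightarrow> norm (h x - foot x) \<le> \<rho>"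
proof (cases "Q = {}")
  case True
  show ?thesis by (rule that[of "\<lambda>x. x"]) (use True in auto)
next
  case False
  then have "0 \<le> s" using Q(2) infdist_nonneg order_trans by (metis ex_in_conv)
  then have "0 < R" using \<open>s < R\<close> by simp
  obtain c where c: "0 < c"
    "\<And>x b. infdist x A \<le> s \<Longrightarrow> b \<in> A \<Longrightarrow> (infdist x A)\<^sup>2 + c * (norm (foot x - b))\<^sup>2 \<le> (norm (x - b))\<^sup>2"
    using foot_quadratic_growth[OF \<open>s < R\<close> \<open>0 < R\<close>] by blast
  define K where "K = foot ` Q"
  have "compact K" unfolding K_def
    using Q by (intro compact_continuous_image continuous_on_subset[OF continuous_on_foot[OF \<open>s < R\<close>]]) auto
  \<comment> \<open>Points of \<open>T\<close> farther than \<rho>/2 from the foot exceed the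
    squared distance to \<open>A\<close> by at least c (\<rho>/2)^2 = 2 q, a net point within
    \<delta> of the foot by at most q. The remaining gap q is what the exponential weights
    exploit.\<close>
  define q where "q = c * \<rho>\<^sup>2 / 8"
  have q: "0 < q" using c \<open>0 < \<rho>\<close> by (simp add: q_def)
  define \<delta> where "\<delta> = min 1 (q / (2 * s + 1))"
  have \<delta>: "0 < \<delta>" "\<delta> \<le> 1" using q \<open>0 \<le> s\<close> by (auto simp: \<delta>_def)
  have "\<delta> * (2 * s + 1) \<le> q / (2 * s + 1) * (2 * s + 1)"
    using \<open>0 \<le> s\<close> by (intro mult_right_mono) (auto simp: \<delta>_def)
  then have "\<delta> * (2 * s + 1) \<le> q" using \<open>0 \<le> s\<close> by simp
  moreover have "\<delta>\<^sup>2 \<le> \<delta>" using \<delta> by (simp add: power2_eq_square mult_left_le)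
  ultimately have \<delta>q: "2 * s * \<delta> + \<delta>\<^sup>2 \<le> q" by (simp add: algebra_simps)
  obtain T where T: "finite T" "T \<subseteq> K" "K \<subseteq> (\<Union>a\<in>T. ball a \<delta>)"
    by (rule compactE_image[OF \<open>compact K\<close>, of K "\<lambda>a. ball a \<delta>"]) (use \<delta>(1) in auto)
  have "T \<noteq> {}" using T(3) False by (auto simp: K_def)
  define D where "D = diameter K"
  have D: "norm (a - b) \<le> D" if "a \<in> K" "b \<in> K" for a b
    unfolding D_def using diameter_bounded_bound[OF compact_imp_bounded[OF \<open>compact K\<close>] that]
    by (simp add: dist_norm)
  have "0 \<le> D" unfolding D_def by (rule diameter_ge_0) (rule compact_imp_bounded[OF \<open>compact K\<close>])
  \<comment> \<open>The far points contribute at most card T * D * exp (- z) to the error, so z is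
    chosen after the net \<open>T\<close>, large enough to push this below \<rho>/2. Then \<eta> is
    fixed by 2 \<eta> z = q.\<close>
  define z where "z = 2 * (card T * D) / \<rho> + 1"
  have z: "0 < z" using \<open>0 \<le> D\<close> \<open>0 < \<rho>\<close> by (auto simp: z_def intro!: add_nonneg_pos)
  have zD: "card T * D * exp (- z) \<le> \<rho> / 2"
  proof -
    have "card T * D \<le> \<rho> / 2 * z" using \<open>0 < \<rho>\<close> by (simp add: z_def field_simps)
    also have "\<dots> \<le> \<rho> / 2 * exp z"
      using \<open>0 < \<rho>\<close> exp_ge_add_one_self[of z] by (intro mult_left_mono) linarith+
    finally show ?thesis by (simp add: exp_minus field_simps)
  qed
  define \<eta> where "\<eta> = q / (2 * z)"
  have \<eta>: "0 < \<eta>" "2 * \<eta> * z = q" using q z by (auto simp: \<eta>_def)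
  define h where "h = softmax_point \<eta> T"
  show ?thesis
  proof (rule that[of h])
    show "h differentiable (at x)" for x unfolding h_def
      by (rule softmax_differentiable[OF T(1) \<open>T \<noteq> {}\<close>])
    show "0 \<le> (h x - h y) \<bullet> (x - y)" for x y unfolding h_def
      by (rule softmax_monotone[OF T(1) \<open>T \<noteq> {}\<close> \<eta>(1)])
    fix x assume x: "x \<in> Q"
    define a where "a = foot x"
    have aK: "a \<in> K" using x by (simp add: a_def K_def)
    then obtain b where b: "b \<in> T" "dist b a < \<delta>" using T(3) by auto
    define w where "w = (\<lambda>e. softmax_weight \<eta> e x)"
    have wpos: "0 < w e" for e by (simp add: w_def softmax_weight_def)
    define W where "W = (\<Sum>e\<in>T. w e)"
    have W: "0 < W" using softmax_sum_pos[OF T(1) \<open>T \<noteq> {}\<close>] by (simp add: W_def w_def)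
    have "norm (x - b) \<le> norm (x - a) + norm (a - b)"
      using norm_triangle_ineq[of "x - a" "a - b"] by simp
    also have "\<dots> \<le> infdist x A + \<delta>"
      using b by (simp add: a_def norm_foot dist_norm norm_minus_commute)
    finally have "(norm (x - b))\<^sup>2 \<le> (infdist x A + \<delta>)\<^sup>2" by (intro power_mono) auto
    also have "\<dots> \<le> (infdist x A)\<^sup>2 + (2 * s * \<delta> + \<delta>\<^sup>2)"
      using mult_right_mono[OF Q(2)[OF x], of \<delta>] \<delta> by (simp add: power2_sum)
    finally have xb: "(norm (x - b))\<^sup>2 \<le> (infdist x A)\<^sup>2 + q" using \<delta>q by simp
    have summand: "w e * norm (e - a) \<le> w e * (\<rho> / 2) + W * (D * exp (- z))" if e: "e \<in> T" for e
    proof (cases "norm (e - a) \<le> \<rho> / 2")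
      case True
      then have "w e * norm (e - a) \<le> w e * (\<rho> / 2)" using wpos[of e] by simp
      moreover have "0 \<le> W * (D * exp (- z))" using W \<open>0 \<le> D\<close> by simp
      ultimately show ?thesis by simp
    next
      case False
      have eA: "e \<in> A" using e T(2) foot_in by (auto simp: K_def)
      have "(\<rho> / 2)\<^sup>2 \<le> (norm (a - e))\<^sup>2"
        using False \<open>0 < \<rho>\<close> by (intro power_mono) (auto simp: norm_minus_commute)
      then have "c * (\<rho> / 2)\<^sup>2 \<le> c * (norm (a - e))\<^sup>2" using c(1) by simp
      then have "(infdist x A)\<^sup>2 + 2 * q \<le> (norm (x - e))\<^sup>2"
        using c(2)[OF Q(2)[OF x] eA] by (simp add: q_def a_def power_divide)
      then have "w e \<le> exp (- z) * w b"
        unfolding w_def using \<eta> xb by (intro softmax_weight_le) auto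
      also have "\<dots> \<le> exp (- z) * W"
        unfolding W_def using T(1) b(1) wpos by (intro mult_left_mono member_le_sum) (auto simp: less_imp_le)
      finally have "w e * norm (e - a) \<le> exp (- z) * W * D"
        using D[OF subsetD[OF T(2) e] aK] wpos[of e] by (intro mult_mono) (auto simp: W less_imp_le)
      moreover have "0 \<le> w e * (\<rho> / 2)" using wpos[of e] \<open>0 < \<rho>\<close> by simp
      ultimately show ?thesis by (simp add: mult_ac)
    qed
    have "W *\<^sub>R (h x - a) = (\<Sum>e\<in>T. w e *\<^sub>R (e - a))"
      using W by (simp add: h_def softmax_point_def scaleR_diff_right sum_subtractf W_def w_def scaleR_sum_left)
    then have "W * norm (h x - a) = norm (\<Sum>e\<in>T. w e *\<^sub>R (e - a))"
      using W by (metis abs_of_pos norm_scaleR)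
    also have "\<dots> \<le> (\<Sum>e\<in>T. w e * norm (e - a))"
      using wpos by (intro order_trans[OF norm_sum] sum_mono) (simp add: abs_of_pos)
    also have "\<dots> \<le> (\<Sum>e\<in>T. w e * (\<rho> / 2) + W * (D * exp (- z)))" by (rule sum_mono[OF summand])
    also have "\<dots> = W * (\<rho> / 2 + card T * D * exp (- z))"
      by (simp add: sum.distrib W_def sum_distrib_left sum_distrib_right algebra_simps)
    finally have "norm (h x - a) \<le> \<rho> / 2 + card T * D * exp (- z)" using W by simp
    then show "norm (h x - foot x) \<le> \<rho>" using zD by (simp add: a_def)
  qed
qed

text \<open>If y were missed, the connected ball about g x would meet the frontier of the image of
  the open ball, an image that is open by invariance of domain. Such frontier points come from the
  sphere, and expansion keeps these at distance at least m \<rho> from g x.\<close>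

lemma expanding_covers_ball:
  fixes g :: "'a::euclidean_space \<Rightarrow> 'a"
  assumes cont: "continuous_on (cball x \<rho>) g" and "0 < \<rho>" "0 < m"
    and expand: "\<And>u v. u \<in> cball x \<rho> \<Longrightarrow> v \<in> cball x \<rho> \<Longrightarrow> m * norm (u - v) \<le> norm (g u - g v)"
    and y: "norm (y - g x) < m * \<rho>"
  shows "y \<in> g ` cball x \<rho>"
proof (rule ccontr)
  assume no: "y \<notin> g ` cball x \<rho>"
  let ?T = "g ` ball x \<rho>"
  let ?B = "ball (g x) (m * \<rho>)"
  have inj: "inj_on g (cball x \<rho>)"
  proof (rule inj_onI)
    fix u v assume "u \<in> cball x \<rho>" "v \<in> cball x \<rho>" "g u = g v"
    then show "u = v" using expand[of u v] \<open>0 < m\<close> by (simp add: mult_le_0_iff)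
  qed
  have "open ?T"
    by (rule invariance_of_domain[OF continuous_on_subset[OF cont] _ inj_on_subset[OF inj]]) auto
  have "?B \<inter> frontier ?T \<noteq> {}"
  proof (rule connected_Int_frontier[OF connected_ball])
    show "?B \<inter> ?T \<noteq> {}" using \<open>0 < \<rho>\<close> \<open>0 < m\<close> by (intro ex_in_conv[THEN iffD1] exI[of _ "g x"]) auto
    have "y \<in> ?B" using y by (simp add: dist_norm norm_minus_commute)
    moreover have "y \<notin> ?T" using no by auto
    ultimately show "?B - ?T \<noteq> {}" by blast
  qed
  then obtain z where z: "z \<in> ?B" "z \<in> frontier ?T" by blast
  have "compact (g ` cball x \<rho>)" by (intro compact_continuous_image cont) auto
  then have "closure ?T \<subseteq> g ` cball x \<rho>"
    by (intro closure_minimal compact_imp_closed image_mono) auto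
  then obtain w where w: "w \<in> cball x \<rho>" "z = g w" using z by (auto simp: frontier_def)
  have "z \<notin> ?T" using z(2) \<open>open ?T\<close> by (simp add: frontier_def interior_open)
  then have "norm (w - x) = \<rho>" using w by (auto simp: dist_norm norm_minus_commute)
  then have "m * \<rho> \<le> norm (z - g x)" using expand[of w x] w \<open>0 < \<rho>\<close> by auto
  then show False using z(1) by (simp add: dist_norm norm_minus_commute)
qed

lemma compact_cball_subset_open:
  fixes K :: "'a::euclidean_space set"
  assumes "compact K" "open S" "K \<subseteq> S"
  obtains \<rho> where "0 < \<rho>" "\<And>x. x \<in> K \<Longrightarrow> cball x \<rho> \<subseteq> S"
proof -
  obtain \<epsilon> where \<epsilon>: "0 < \<epsilon>" "(\<Union>x\<in>K. ball x \<epsilon>) \<subseteq> S"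
    using compact_subset_open_imp_ball_epsilon_subset[OF assms] .
  show ?thesis
  proof (rule that[of "\<epsilon> / 2"])
    fix x assume "x \<in> K"
    have "cball x (\<epsilon> / 2) \<subseteq> ball x \<epsilon>" using \<epsilon>(1) by (auto simp: cball_subset_ball_iff)
    then show "cball x (\<epsilon> / 2) \<subseteq> S" using \<epsilon>(2) \<open>x \<in> K\<close> by blast
  qed (use \<epsilon> in simp)
qed

lemma emeasure_lmeasurable_less:
  assumes "T \<in> lmeasurable" "emeasure lebesgue T < ennreal e"
  shows "measure lebesgue T < e"
proof -
  have "0 < e" using assms(2) by (metis ennreal_neg not_le not_less_zero)
  then show ?thesis using assms by (simp add: emeasure_eq_measure2 ennreal_less_iff)
qed

section \<open>Shrinking a tube towards its feet\<close>

context unique_foot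
begin

definition shrink :: "real \<Rightarrow> 'a \<Rightarrow> 'a" where
  "shrink t x = (1 - t) *\<^sub>R x + t *\<^sub>R foot x"

lemma shrink_expanding:
  "0 \<le> t \<Longrightarrow> t \<le> 1 \<Longrightarrow> (1 - t) * norm (x - y) \<le> norm (shrink t x - shrink t y)"
  unfolding shrink_def by (rule monotone_interpolation_inner[OF foot_monotone])

lemma inj_shrink: "0 \<le> t \<Longrightarrow> t < 1 \<Longrightarrow> inj_on (shrink t) S"
  unfolding shrink_def[abs_def] by (rule inj_monotone_interpolation[OF foot_monotone])

lemma continuous_on_shrink: "s < R \<Longrightarrow> continuous_on {x. infdist x A \<le> s} (shrink t)"
  unfolding shrink_def[abs_def] by (intro continuous_intros continuous_on_foot)

lemma bounded_shrink: "bounded E \<Longrightarrow> E \<subseteq> {x. infdist x A \<le> s} \<Longrightarrow> bounded (shrink t ` E)"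
proof -
  assume "bounded E" and E: "E \<subseteq> {x. infdist x A \<le> s}"
  then obtain b where b: "\<And>x. x \<in> E \<Longrightarrow> norm x \<le> b" unfolding bounded_iff by blast
  have "norm (shrink t x) \<le> b + \<bar>t\<bar> * s" if "x \<in> E" for x
  proof -
    have "shrink t x = x - t *\<^sub>R (x - foot x)" by (simp add: shrink_def algebra_simps)
    then have "norm (shrink t x) \<le> norm x + norm (t *\<^sub>R (x - foot x))"
      by (simp only:) (rule norm_triangle_ineq4)
    also have "\<dots> \<le> b + \<bar>t\<bar> * s"
      unfolding norm_scaleR norm_foot using b E that by (intro add_mono mult_left_mono) auto
    finally show ?thesis .
  qed
  then show "bounded (shrink t ` E)" unfolding bounded_iff by blast
qed

text \<open>\<open>shrink t\<close> reduces distances at most by the factor 1 - t, so its inverse is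
  Lipschitz on the shrunk closed tube, and images under \<open>shrink t\<close> are preimages under
  a continuous map.\<close>

lemma shrink_borel:
  assumes "0 < s" "s < R" "0 \<le> t" "t < 1" and E: "E \<in> sets borel" "E \<subseteq> {x. infdist x A \<le> s}"
  shows "shrink t ` E \<in> sets borel"
proof -
  define S S' where "S = {x. infdist x A \<le> s}" and "S' = {x. infdist x A \<le> (1 - t) * s}"
  have im: "shrink t ` S = S'"
    using shrink_image[OF assms(1-4), of UNIV] by (simp add: S_def S'_def shrink_def)
  define k where "k = inv_into S (shrink t)"
  have k: "k (shrink t x) = x" if "x \<in> S" for x
    unfolding k_def using inj_shrink[OF assms(3,4)] that by (rule inv_into_f_f)
  have "(1 / (1 - t))-lipschitz_on S' k"
  proof (rule lipschitz_onI)
    fix u v assume "u \<in> S'" "v \<in> S'"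
    then obtain x y where xy: "x \<in> S" "y \<in> S" "u = shrink t x" "v = shrink t y"
      unfolding im[symmetric] by blast
    then show "dist (k u) (k v) \<le> 1 / (1 - t) * dist u v"
      using shrink_expanding[of t x y] assms by (simp add: k dist_norm field_simps)
  qed (use assms in simp)
  then have "continuous_on S' k" by (rule lipschitz_on_continuous_on)
  moreover have "closed S'" unfolding S'_def by (intro closed_Collect_le continuous_intros)
  ultimately have meas: "k \<in> borel_measurable (restrict_space borel S')"
    by (intro borel_measurable_continuous_on_restrict)
  have "shrink t ` E = k -` E \<inter> S'"
    using E(2) k im by (force simp: S_def)
  then show ?thesis
    using measurable_sets[OF meas E(1)] \<open>closed S'\<close>
    by (simp add: space_restrict_space sets_restrict_space_iff)
qed

lemma negligible_shrink:
  assumes "s < R" "negligible N" "N \<subseteq> {x. infdist x A \<le> s}"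
  shows "negligible (shrink t ` N)"
proof (cases "0 < R")
  case True
  obtain L where L: "0 < L"
    "\<And>x y. infdist x A \<le> s \<Longrightarrow> infdist y A \<le> s \<Longrightarrow> norm (foot x - foot y) \<le> L * norm (x - y)"
    using foot_Lipschitz[OF assms(1) True] by blast
  show ?thesis
  proof (rule negligible_locally_Lipschitz_image[OF order_refl assms(2)])
    fix x assume x: "x \<in> N"
    have "norm (shrink t y - shrink t x) \<le> (\<bar>1 - t\<bar> + \<bar>t\<bar> * L) * norm (y - x)" if "y \<in> N" for y
    proof -
      have "shrink t y - shrink t x = (1 - t) *\<^sub>R (y - x) + t *\<^sub>R (foot y - foot x)"
        by (simp add: shrink_def algebra_simps)
      then have "norm (shrink t y - shrink t x) \<le> \<bar>1 - t\<bar> * norm (y - x) + \<bar>t\<bar> * norm (foot y - foot x)"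
        by (metis norm_scaleR norm_triangle_ineq)
      also have "\<dots> \<le> \<bar>1 - t\<bar> * norm (y - x) + \<bar>t\<bar> * (L * norm (y - x))"
        using L(2)[of y x] assms(3) x that by (intro add_left_mono mult_left_mono) auto
      finally show ?thesis by (simp add: distrib_right mult.assoc)
    qed
    then show "\<exists>T B. open T \<and> x \<in> T \<and> (\<forall>y\<in>N \<inter> T. norm (shrink t y - shrink t x) \<le> B * norm (y - x))"
      by (intro exI[of _ UNIV]) auto
  qed
next
  case False
  have "x \<notin> N" for x
  proof
    assume "x \<in> N"
    then show False using assms(1,3) False infdist_nonneg[of x A] by auto
  qed
  then have "N = {}" by blast
  then show ?thesis by simp
qed

text \<open>Uniform closeness to \<open>shrink t\<close> gives the upper bound through an open
  neighbourhood. The lower bound uses monotonicity once more: the approximating maps do not reduce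
  distances below the factor 1 - t, so every point of a large closed part of the image is still
  hit.\<close>

lemma measure_shrink_box_limit:
  assumes t: "0 \<le> t" "t < 1" and Q: "\<And>x. x \<in> cbox a b \<Longrightarrow> infdist x A \<le> s" and "0 < s" "s < R"
    and h: "\<And>n::nat. continuous_on UNIV (h n)" "\<And>n x y. 0 \<le> (h n x - h n y) \<bullet> (x - y)"
      "\<And>n x. x \<in> cbox a b \<Longrightarrow> norm (h n x - foot x) \<le> 1 / real (Suc n)"
  shows "(\<lambda>n. measure lebesgue ((\<lambda>x. (1 - t) *\<^sub>R x + t *\<^sub>R h n x) ` cbox a b))
    \<longlonglongrightarrow> measure lebesgue (shrink t ` box a b)"
proof (rule LIMSEQ_I)
  fix e :: real assume "0 < e"
  define g where "g n x = (1 - t) *\<^sub>R x + t *\<^sub>R h n x" for n x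
  have cg: "continuous_on UNIV (g n)" for n
    unfolding g_def by (intro continuous_intros h)
  have gs: "norm (g n x - shrink t x) \<le> 1 / real (Suc n)" if "x \<in> cbox a b" for n x
  proof -
    have "g n x - shrink t x = t *\<^sub>R (h n x - foot x)" by (simp add: g_def shrink_def algebra_simps)
    then have "norm (g n x - shrink t x) = t * norm (h n x - foot x)" using t by simp
    also have "\<dots> \<le> 1 * (1 / real (Suc n))" using h(3)[OF that] t by (intro mult_mono) auto
    finally show ?thesis by simp
  qed
  let ?Q = "cbox a b"
  have Qs: "?Q \<subseteq> {x. infdist x A \<le> s}" using Q by auto
  have compQ: "compact (shrink t ` ?Q)"
    by (intro compact_continuous_image continuous_on_subset[OF continuous_on_shrink Qs] assms) simp
  have boxQ: "shrink t ` box a b \<in> lmeasurable"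
  proof (rule bounded_set_imp_lmeasurable)
    show "bounded (shrink t ` box a b)" using Qs box_subset_cbox[of a b] by (intro bounded_shrink) auto
    have "shrink t ` box a b \<in> sets borel"
      using Qs box_subset_cbox[of a b] t assms by (intro shrink_borel[of s]) auto
    then show "shrink t ` box a b \<in> sets lebesgue" by simp
  qed
  define V where "V = measure lebesgue (shrink t ` box a b)"
  have Vc: "measure lebesgue (shrink t ` ?Q) = V"
    unfolding V_def
  proof (rule measure_negligible_symdiff[OF boxQ])
    have "negligible (shrink t ` (?Q - box a b))"
      using Qs by (intro negligible_shrink[OF \<open>s < R\<close>] negligible_frontier_interval) auto
    then show "negligible (shrink t ` box a b - shrink t ` ?Q \<union> (shrink t ` ?Q - shrink t ` box a b))"
      by (rule negligible_subset) (use box_subset_cbox[of a b] in auto)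
  qed
  have gQ: "g n ` ?Q \<in> lmeasurable" for n
    by (intro lmeasurable_compact compact_continuous_image continuous_on_subset[OF cg]) auto
  obtain U where U: "open U" "shrink t ` ?Q \<subseteq> U" "U - shrink t ` ?Q \<in> lmeasurable"
      "emeasure lebesgue (U - shrink t ` ?Q) < ennreal e"
    using sets_lebesgue_outer_open[of "shrink t ` ?Q" e] compQ \<open>0 < e\<close>
    by (metis borel_compact sets_completionI_sets sets_lborel)
  obtain \<rho> where \<rho>: "0 < \<rho>" "\<And>y. y \<in> shrink t ` ?Q \<Longrightarrow> cball y \<rho> \<subseteq> U"
    using compact_cball_subset_open[OF compQ U(1,2)] by blast
  \<comment> \<open>Inner approximation of the image. The preimage \<open>K\<close> of
    \<open>C\<close> is compact in the open box, so balls of one radius \<rho>' about its points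
    stay in the box, as \<open>expanding_covers_ball\<close> requires.\<close>
  obtain C where C: "closed C" "C \<subseteq> shrink t ` box a b" "shrink t ` box a b - C \<in> lmeasurable"
      "emeasure lebesgue (shrink t ` box a b - C) < ennreal e"
    using sets_lebesgue_inner_closed[OF fmeasurableD[OF boxQ] \<open>0 < e\<close>] .
  define K where "K = ?Q \<inter> shrink t -` C"
  have "closedin (top_of_set ?Q) K" unfolding K_def
    by (rule continuous_closedin_preimage[OF continuous_on_subset[OF continuous_on_shrink Qs] C(1)]) (rule assms)
  then have "compact K" by (rule closedin_compact[OF compact_cbox])
  moreover have "K \<subseteq> box a b"
  proof
    fix x assume x: "x \<in> K"
    then obtain x' where "x' \<in> box a b" "shrink t x = shrink t x'" using C(2) by (auto simp: K_def)
    then show "x \<in> box a b" using inj_shrink[OF t, of UNIV] by (auto dest: injD)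
  qed
  ultimately obtain \<rho>' where \<rho>': "0 < \<rho>'" "\<And>x. x \<in> K \<Longrightarrow> cball x \<rho>' \<subseteq> box a b"
    using compact_cball_subset_open[OF _ open_box] by metis
  \<comment> \<open>\<rho> keeps the approximate image inside \<open>U\<close>, and (1 - t) *
    \<rho>' is the error below which the image of a ball of radius \<rho>' still covers its target
    point.\<close>
  define m where "m = min \<rho> ((1 - t) * \<rho>')"
  have "0 < m" using \<rho> \<rho>' t by (simp add: m_def)
  then obtain n0 where n0: "1 / real (Suc n0) < m" using nat_approx_posE by metis
  show "\<exists>n0. \<forall>n\<ge>n0. norm (measure lebesgue ((\<lambda>x. (1 - t) *\<^sub>R x + t *\<^sub>R h n x) ` ?Q)
      - measure lebesgue (shrink t ` box a b)) < e"
  proof (intro exI[of _ n0] allI impI)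
    fix n assume n: "n0 \<le> n"
    have nm: "1 / real (Suc n) < m" using n0 n by (intro le_less_trans[OF _ n0]) (simp add: field_simps)
    have close: "norm (g n x - shrink t x) < \<rho>" "norm (g n x - shrink t x) < (1 - t) * \<rho>'"
      if "x \<in> ?Q" for x
      using gs[OF that, of n] nm by (auto simp: m_def)
    have "g n ` ?Q \<subseteq> U"
    proof
      fix y assume "y \<in> g n ` ?Q"
      then obtain x where "x \<in> ?Q" "y = g n x" by blast
      then show "y \<in> U" using close(1)[of x] \<rho>(2)[of "shrink t x"] by (auto simp: dist_norm norm_minus_commute)
    qed
    have U': "U = (U - shrink t ` ?Q) \<union> shrink t ` ?Q" using U(2) by auto
    have sQ: "shrink t ` ?Q \<in> lmeasurable" using compQ by (rule lmeasurable_compact)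
    have "U \<in> lmeasurable" by (subst U') (intro fmeasurable.Un U(3) sQ)
    then have "measure lebesgue (g n ` ?Q) \<le> measure lebesgue U"
      using \<open>g n ` ?Q \<subseteq> U\<close> gQ by (intro measure_mono_fmeasurable) (auto dest: fmeasurableD)
    also have "\<dots> \<le> measure lebesgue (U - shrink t ` ?Q) + V"
      using measure_Un_le[of "U - shrink t ` ?Q" lebesgue "shrink t ` ?Q"] U(3) sQ U' Vc by (simp add: fmeasurableD)
    also have "\<dots> < e + V" using emeasure_lmeasurable_less[OF U(3,4)] by simp
    finally have up: "measure lebesgue (g n ` ?Q) < V + e" by simp
    have "C \<subseteq> g n ` ?Q"
    proof
      fix y assume "y \<in> C"
      then obtain x where x: "x \<in> box a b" "y = shrink t x" using C(2) by blast
      then have xQ: "x \<in> ?Q" using box_subset_cbox by blast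
      then have "x \<in> K" using x \<open>y \<in> C\<close> by (simp add: K_def)
      have "y \<in> g n ` cball x \<rho>'"
      proof (rule expanding_covers_ball[of x \<rho>' "g n" "1 - t"])
        show "continuous_on (cball x \<rho>') (g n)" by (rule continuous_on_subset[OF cg]) simp
        show "(1 - t) * norm (u - v) \<le> norm (g n u - g n v)" for u v
          unfolding g_def by (rule monotone_interpolation_inner[OF h(2)]) (use t in auto)
        show "norm (y - g n x) < (1 - t) * \<rho>'"
          using close(2)[OF xQ] x by (simp add: norm_minus_commute)
      qed (use \<rho>' t in auto)
      then show "y \<in> g n ` ?Q" using \<rho>'(2)[OF \<open>x \<in> K\<close>] box_subset_cbox by blast
    qed
    have CK: "C \<in> lmeasurable"
    proof -
      have "C = shrink t ` box a b - (shrink t ` box a b - C)" using C(2) by auto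
      then show ?thesis using fmeasurable.Diff[OF boxQ C(3)] by simp
    qed
    have "V \<le> measure lebesgue (shrink t ` box a b - C) + measure lebesgue C"
      using measure_Un_le[of "shrink t ` box a b - C" lebesgue C] C CK
      by (simp add: V_def fmeasurableD Un_absorb2 Un_Diff_cancel2)
    also have "\<dots> < e + measure lebesgue C" using emeasure_lmeasurable_less[OF C(3,4)] by simp
    also have "measure lebesgue C \<le> measure lebesgue (g n ` ?Q)"
      using \<open>C \<subseteq> g n ` ?Q\<close> gQ CK by (intro measure_mono_fmeasurable) (auto dest: fmeasurableD)
    finally have "V < measure lebesgue (g n ` ?Q) + e" by simp
    then show "norm (measure lebesgue ((\<lambda>x. (1 - t) *\<^sub>R x + t *\<^sub>R h n x) ` ?Q)
        - measure lebesgue (shrink t ` box a b)) < e"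
      using up by (auto simp: abs_less_iff V_def g_def[abs_def])
  qed
qed

lemma polynomial_on_shrink_box:
  assumes Q: "\<And>x. x \<in> cbox a b \<Longrightarrow> infdist x A \<le> s" and "0 < s" "s < R"
  shows "polynomial_on DIM('a) {0..<1} (\<lambda>t. measure lebesgue (shrink t ` box a b))"
proof -
  have "\<exists>h. (\<forall>x. h differentiable (at x)) \<and> (\<forall>x y. 0 \<le> (h x - h y) \<bullet> (x - y)) \<and>
      (\<forall>x\<in>cbox a b. norm (h x - foot x) \<le> 1 / real (Suc n))" for n
    by (rule smooth_monotone_approximation[OF compact_cbox[of a b] Q \<open>s < R\<close>, where \<rho> = "1 / real (Suc n)"])
      (auto intro!: exI)
  then obtain h where h: "\<And>n x. h n differentiable (at x)" "\<And>n x y. 0 \<le> (h n x - h n y) \<bullet> (x - y)"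
      "\<And>n x. x \<in> cbox a b \<Longrightarrow> norm (h n x - foot x) \<le> 1 / real (Suc n)"
    by metis
  show ?thesis
  proof (rule polynomial_on_limit)
    fix n
    obtain h' where "\<And>x. (h n has_derivative h' x) (at x)"
      using h(1)[of n] unfolding differentiable_def by metis
    then show "polynomial_on DIM('a) {0..<1} (\<lambda>t. measure lebesgue ((\<lambda>x. (1 - t) *\<^sub>R x + t *\<^sub>R h n x) ` cbox a b))"
      by (rule measure_monotone_interpolation[OF _ h(2)]) simp
  next
    fix t :: real assume "t \<in> {0..<1}"
    then show "(\<lambda>n. measure lebesgue ((\<lambda>x. (1 - t) *\<^sub>R x + t *\<^sub>R h n x) ` cbox a b))
        \<longlonglongrightarrow> measure lebesgue (shrink t ` box a b)"
      using differentiable_imp_continuous_on h(1)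
      by (intro measure_shrink_box_limit[OF _ _ Q \<open>0 < s\<close> \<open>s < R\<close>] h(2,3))
        (auto simp: differentiable_on_def)
  qed (simp add: infinite_Ico)
qed

end

section \<open>Volumes of tubes\<close>

context unique_foot
begin

lemma measure_shrink_sums:
  assumes s: "0 < s" "s < R" and t: "0 \<le> t" "t < 1"
    and E: "\<And>i::nat. E i \<in> sets borel" "disjoint_family E" "bounded (\<Union>i. E i)"
      "(\<Union>i. E i) \<subseteq> {x. infdist x A \<le> s}"
  shows "(\<lambda>i. measure lebesgue (shrink t ` E i)) sums measure lebesgue (shrink t ` (\<Union>i. E i))"
proof -
  have b: "shrink t ` E i \<in> sets borel" for i
    using E(1,4) by (intro shrink_borel[OF s t]) auto
  have "bounded (\<Union>i. shrink t ` E i)"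
    using bounded_shrink[OF E(3,4), of t] by (simp add: image_UN)
  then have "(\<Union>i. shrink t ` E i) \<in> lmeasurable"
    using b by (intro bounded_set_imp_lmeasurable) auto
  moreover have "disjoint_family (\<lambda>i. shrink t ` E i)"
    using E(2) inj_shrink[OF t, of UNIV] unfolding disjoint_family_on_def
    by (metis image_Int image_empty)
  ultimately show ?thesis
    unfolding image_UN using b
    by (intro measure_UNION) (auto simp: fmeasurable_def)
qed

text \<open>Dynkin's argument: open boxes are stable under intersection, and having polynomial
  volume after shrinking passes to complements within the box by subtraction and to countable
  disjoint unions by \<open>polynomial_on_suminf\<close>.\<close>

lemma polynomial_on_shrink_cbox_Int:
  assumes Q: "\<And>x. x \<in> cbox a b \<Longrightarrow> infdist x A \<le> s" and s: "0 < s" "s < R"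
    and E: "E \<in> sets borel"
  shows "polynomial_on DIM('a) {0..<1} (\<lambda>t. measure lebesgue (shrink t ` (E \<inter> cbox a b)))"
proof -
  let ?B = "box a b"
  have Bs: "?B \<subseteq> {x. infdist x A \<le> s}" using Q box_subset_cbox by blast
  have sums: "(\<lambda>i. measure lebesgue (shrink t ` (X i \<inter> ?B))) sums measure lebesgue (shrink t ` ((\<Union>i. X i) \<inter> ?B))"
    if "\<And>i::nat. X i \<in> sets borel" "disjoint_family X" "t \<in> {0..<1}" for X t
    unfolding Int_UN_distrib2[symmetric] UN_extend_simps
    by (rule measure_shrink_sums[OF s])
      (use that Bs in \<open>auto simp: disjoint_family_on_def intro!: bounded_subset[OF bounded_box]\<close>)
  have "Int_stable (range (\<lambda>(a, b). box a b :: 'a set))"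
    by (auto simp: Int_stable_def box_Int_box)
  moreover have "range (\<lambda>(a, b). box a b :: 'a set) \<subseteq> Pow UNIV" by simp
  moreover have "E \<in> sigma_sets UNIV (range (\<lambda>(a, b). box a b))"
    using E unfolding borel_eq_box by simp
  ultimately have "polynomial_on DIM('a) {0..<1} (\<lambda>t. measure lebesgue (shrink t ` (E \<inter> ?B)))"
  proof (induction E rule: sigma_sets_induct_disjoint)
    case (basic E)
    then obtain c d where E: "E \<inter> ?B = box c d" by (auto simp: box_Int_box)
    show ?case
    proof (cases "box c d = {}")
      case False
      have "cbox c d = closure (box c d)" using False by simp
      also have "\<dots> \<subseteq> closure ?B" using E by (intro closure_mono) auto
      also have "\<dots> \<subseteq> cbox a b" by (intro closure_minimal box_subset_cbox closed_cbox)
      finally have "cbox c d \<subseteq> cbox a b" .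
      then show ?thesis
        unfolding E using Q by (intro polynomial_on_shrink_box[OF _ s]) auto
    qed (simp add: E polynomial_on_0)
  next
    case (compl E)
    have E: "E \<in> sets borel" using compl.hyps by (simp add: borel_eq_box)
    have "measure lebesgue (shrink t ` ((UNIV - E) \<inter> ?B))
        = measure lebesgue (shrink t ` (UNIV \<inter> ?B)) - measure lebesgue (shrink t ` (E \<inter> ?B))"
      if t: "t \<in> {0..<1}" for t
    proof -
      have m: "shrink t ` (X \<inter> ?B) \<in> lmeasurable" if "X \<in> sets borel" for X
      proof (rule bounded_set_imp_lmeasurable)
        have "shrink t ` (X \<inter> ?B) \<in> sets borel"
          using that t Bs by (intro shrink_borel[OF s]) auto
        then show "shrink t ` (X \<inter> ?B) \<in> sets lebesgue" by simp
        show "bounded (shrink t ` (X \<inter> ?B))"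
          using Bs by (intro bounded_shrink) (auto intro: bounded_subset[OF bounded_box])
      qed
      have "shrink t ` ((UNIV - E) \<inter> ?B) = shrink t ` (UNIV \<inter> ?B) - shrink t ` (E \<inter> ?B)"
        using inj_shrink[of t UNIV] t by (auto dest: injD)
      then show ?thesis
        using m[OF E] m[of UNIV] by (simp only:) (intro measurable_measure_Diff; auto simp: fmeasurableD)
    qed
    moreover have "polynomial_on DIM('a) {0..<1} (\<lambda>t. measure lebesgue (shrink t ` (UNIV \<inter> ?B)))"
      using polynomial_on_shrink_box[OF Q s] by simp
    ultimately show ?case
      by (rule polynomial_on_cong[OF polynomial_on_diff[OF _ compl.IH], rotated])
  next
    case (union X)
    have "X i \<in> sets borel" for i using union.hyps by (auto simp: borel_eq_box)
    then show ?case
      by (rule polynomial_on_suminf[OF union.IH sums[OF _ union.hyps(1)]]) (simp_all add: infinite_Ico)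
  qed (simp_all add: polynomial_on_0)
  moreover have "measure lebesgue (shrink t ` (E \<inter> cbox a b)) = measure lebesgue (shrink t ` (E \<inter> ?B))"
    if t: "t \<in> {0..<1}" for t
  proof (rule measure_negligible_symdiff)
    show "shrink t ` (E \<inter> ?B) \<in> lmeasurable"
    proof (rule bounded_set_imp_lmeasurable)
      have "shrink t ` (E \<inter> ?B) \<in> sets borel"
        using E t Bs by (intro shrink_borel[OF s]) auto
      then show "shrink t ` (E \<inter> ?B) \<in> sets lebesgue" by simp
      show "bounded (shrink t ` (E \<inter> ?B))"
        using Bs by (intro bounded_shrink) (auto intro: bounded_subset[OF bounded_box])
    qed
    have "negligible (shrink t ` (cbox a b - ?B))"
      using Q by (intro negligible_shrink[OF \<open>s < R\<close>] negligible_frontier_interval) auto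
    then show "negligible (shrink t ` (E \<inter> ?B) - shrink t ` (E \<inter> cbox a b)
        \<union> (shrink t ` (E \<inter> cbox a b) - shrink t ` (E \<inter> ?B)))"
      by (rule negligible_subset) (use box_subset_cbox[of a b] in auto)
  qed
  ultimately show ?thesis by (rule polynomial_on_cong)
qed

text \<open>A closed tube need not be a union of boxes, so \<open>E\<close> is cut along countably
  many closed boxes that fill the open tube of radius \<open>R\<close>.\<close>

lemma polynomial_on_shrink:
  assumes s: "0 < s" "s < R" and E: "E \<in> sets borel" "bounded E" "E \<subseteq> {x. infdist x A \<le> s}"
  shows "polynomial_on DIM('a) {0..<1} (\<lambda>t. measure lebesgue (shrink t ` E))"
proof -
  have "open {x. infdist x A < R}" by (intro open_Collect_less continuous_intros)
  then obtain \<D> where \<D>: "countable \<D>" "\<D> \<subseteq> Pow {x. infdist x A < R}"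
      "\<And>X. X \<in> \<D> \<Longrightarrow> \<exists>a b. X = cbox a b" "\<Union>\<D> = {x. infdist x A < R}"
    by (rule open_countable_Union_open_cbox) blast
  have "\<D> \<noteq> {}"
  proof -
    obtain a where "a \<in> A" using nonempty_A by blast
    then have "a \<in> {x. infdist x A < R}" using s by simp
    then show ?thesis using \<D>(4) by blast
  qed
  define X where "X = from_nat_into \<D>"
  have rX: "range X = \<D>" unfolding X_def by (rule range_from_nat_into[OF \<open>\<D> \<noteq> {}\<close> \<D>(1)])
  have Xb: "X i \<in> sets borel" for i using \<D>(3)[of "X i"] rX by fastforce
  define Y where "Y i = E \<inter> disjointed X i" for i
  have Yb: "Y i \<in> sets borel" for i
    unfolding Y_def using E(1) sets.range_disjointed_sets[of X borel] Xb by auto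
  have dis: "disjoint_family Y"
    using disjoint_family_disjointed[of X] unfolding Y_def disjoint_family_on_def by blast
  have UY: "(\<Union>i. Y i) = E"
  proof -
    have "(\<Union>i. disjointed X i) = {x. infdist x A < R}"
      unfolding UN_disjointed_eq rX[symmetric] using \<D>(4) rX by simp
    then show ?thesis using E(3) s unfolding Y_def by fastforce
  qed
  have "polynomial_on DIM('a) {0..<1} (\<lambda>t. measure lebesgue (shrink t ` Y i))" for i
  proof -
    obtain a b where ab: "X i = cbox a b" using \<D>(3) rX by blast
    have sub: "cbox a b \<subseteq> {x. infdist x A < R}" using \<D>(2) rX ab by blast
    \<comment> \<open>On a compact box inside the open tube the distance from \<open>A\<close> has a
      maximum below \<open>R\<close>. It may exceed s, so each box gets its own radius.\<close>
    obtain s' where s': "0 < s'" "s' < R" "\<And>x. x \<in> cbox a b \<Longrightarrow> infdist x A \<le> s'"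
    proof (cases "cbox a b = {}")
      case True
      then show ?thesis using that[of s] s by auto
    next
      case False
      moreover have "continuous_on (cbox a b) (\<lambda>x. infdist x A)" by (intro continuous_intros)
      ultimately obtain x where x: "x \<in> cbox a b" "\<And>y. y \<in> cbox a b \<Longrightarrow> infdist y A \<le> infdist x A"
        using continuous_attains_sup[OF compact_cbox, of a b "\<lambda>x. infdist x A"] by blast
      show ?thesis
        by (rule that[of "max s (infdist x A)"]) (use x sub s in fastforce)+
    qed
    have "Y i = Y i \<inter> cbox a b" using disjointed_subset[of X i] ab by (auto simp: Y_def)
    moreover have "polynomial_on DIM('a) {0..<1} (\<lambda>t. measure lebesgue (shrink t ` (Y i \<inter> cbox a b)))"
      by (rule polynomial_on_shrink_cbox_Int[OF s'(3,1,2) Yb[of i]])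
    ultimately show ?thesis by simp
  qed
  then show ?thesis
  proof (rule polynomial_on_suminf)
    fix t :: real assume "t \<in> {0..<1}"
    then show "(\<lambda>i. measure lebesgue (shrink t ` Y i)) sums measure lebesgue (shrink t ` E)"
      unfolding UY[symmetric] by (intro measure_shrink_sums[OF s] Yb dis) (use UY E in auto)
  qed (simp add: infinite_Ico)
qed

lemma tube_borel:
  assumes "r < R" "B \<in> sets borel"
  shows "tube A B r \<in> sets borel"
proof -
  have cl: "closed {x. infdist x A \<le> r}" by (intro closed_Collect_le continuous_intros)
  have "foot \<in> borel_measurable (restrict_space borel {x. infdist x A \<le> r})"
    by (rule borel_measurable_continuous_on_restrict[OF continuous_on_foot[OF assms(1)]])
  then have "foot -` B \<inter> space (restrict_space borel {x. infdist x A \<le> r})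
      \<in> sets (restrict_space borel {x. infdist x A \<le> r})"
    using assms(2) by (rule measurable_sets)
  moreover have "tube A B r = foot -` B \<inter> {x. infdist x A \<le> r}" by auto
  ultimately show ?thesis
    using cl by (simp add: space_restrict_space sets_restrict_space_iff)
qed

lemma bounded_tube:
  assumes "bounded B"
  shows "bounded (tube A B r)"
proof -
  obtain b where b: "\<And>x. x \<in> B \<Longrightarrow> norm x \<le> b" using assms unfolding bounded_iff by blast
  have "norm x \<le> b + r" if "x \<in> tube A B r" for x
  proof -
    have "norm x \<le> norm (foot x) + norm (x - foot x)"
      using norm_triangle_ineq[of "foot x" "x - foot x"] by simp
    also have "\<dots> \<le> b + r" unfolding norm_foot using that b by (intro add_mono) auto
    finally show ?thesis .
  qed
  then show ?thesis unfolding bounded_iff by blast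
qed

lemma tube_lmeasurable: "r < R \<Longrightarrow> B \<in> sets borel \<Longrightarrow> bounded B \<Longrightarrow> tube A B r \<in> lmeasurable"
  using tube_borel bounded_tube by (intro bounded_set_imp_lmeasurable) auto

text \<open>A tube of radius r \<le> s is the tube of radius s shrunk with t = 1 - r / s; the
  condition t < 1 is what excludes r = 0.\<close>

lemma polynomial_on_tube_pos:
  assumes s: "0 < s" "s < R" and B: "B \<in> sets borel" "bounded B"
  shows "polynomial_on DIM('a) {0<..s} (\<lambda>r. measure lebesgue (tube A B r))"
proof -
  have "polynomial_on DIM('a) {0..<1} (\<lambda>t. measure lebesgue (shrink t ` tube A B s))"
    by (rule polynomial_on_shrink[OF s tube_borel[OF s(2) B(1)] bounded_tube[OF B(2)]]) auto
  then obtain p where p: "degree p \<le> DIM('a)"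
    "\<And>t. 0 \<le> t \<Longrightarrow> t < 1 \<Longrightarrow> measure lebesgue (shrink t ` tube A B s) = poly p t"
    unfolding polynomial_on_def by auto
  define q where "q = p \<circ>\<^sub>p [:1, - (1 / s):]"
  have "degree q \<le> DIM('a)"
    unfolding q_def using p(1) s by (simp add: degree_pcompose)
  moreover have "measure lebesgue (tube A B r) = poly q r" if r: "r \<in> {0<..s}" for r
  proof -
    have t: "0 \<le> 1 - r / s" "1 - r / s < 1" using r s by auto
    have "shrink (1 - r / s) ` tube A B s = tube A B r"
      using shrink_image[OF s t, of B] s by (simp add: shrink_def[abs_def])
    then show ?thesis using p(2)[OF t] by (simp add: q_def poly_pcompose)
  qed
  ultimately show ?thesis unfolding polynomial_on_def by blast
qed

theorem polynomial_on_tube: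
  assumes B: "B \<in> sets borel" "bounded B" and "0 < R"
  shows "polynomial_on DIM('a) {0..<R} (\<lambda>r. measure lebesgue (tube A B r))"
proof -
  define s where "s = R / 2"
  have s: "0 < s" "s < R" using \<open>0 < R\<close> by (auto simp: s_def)
  obtain p where p: "degree p \<le> DIM('a)" "\<And>r. r \<in> {0<..s} \<Longrightarrow> measure lebesgue (tube A B r) = poly p r"
    using polynomial_on_tube_pos[OF s B] unfolding polynomial_on_def by auto
  have "measure lebesgue (tube A B r) = poly p r" if r: "r \<in> {0..<R}" for r
  proof (cases "r = 0")
    case False
    define s' where "s' = max r s"
    have s': "0 < s'" "s' < R" using r s by (auto simp: s'_def)
    obtain q where q: "degree q \<le> DIM('a)" "\<And>r. r \<in> {0<..s'} \<Longrightarrow> measure lebesgue (tube A B r) = poly q r"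
      using polynomial_on_tube_pos[OF s' B] unfolding polynomial_on_def by auto
    \<comment> \<open>One polynomial serves all positive radii: those found for s and for s' agree
      on the infinite set of radii up to s.\<close>
    have "p = q"
    proof (rule poly_eqI_infinite)
      show "infinite {0<..s}" using s by (simp add: infinite_Ioc)
      fix x assume "x \<in> {0<..s}"
      then show "poly p x = poly q x" using p(2)[of x] q(2)[of x] by (auto simp: s'_def le_max_iff_disj)
    qed
    then show ?thesis using q(2)[of r] r False by (auto simp: s'_def)
  next
    case True
    \<comment> \<open>Radius 0 is reached as a limit: that tube is the intersection of the tubes of
      radius \<open>f n\<close>, and measure is continuous along this decreasing sequence.\<close>
    define f where "f n = s / real (Suc n)" for n
    have f: "f n \<in> {0<..s}" for n using s by (auto simp: f_def field_simps)
    have "(\<lambda>n. measure lebesgue (tube A B (f n))) \<longlonglongrightarrow> measure lebesgue (\<Inter>n. tube A B (f n))"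
    proof (rule Lim_measure_decseq)
      have lm: "tube A B (f n) \<in> lmeasurable" for n
        using f[of n] s by (intro tube_lmeasurable B) auto
      then show "range (\<lambda>n. tube A B (f n)) \<subseteq> sets lebesgue" "emeasure lebesgue (tube A B (f n)) \<noteq> \<infinity>" for n
        using fmeasurableD2[OF lm] by (auto dest: fmeasurableD)
      have "f n \<le> f m" if "m \<le> n" for m n
        unfolding f_def using that s by (intro divide_left_mono) auto
      then show "decseq (\<lambda>n. tube A B (f n))"
        unfolding decseq_def by (auto intro: order_trans)
    qed
    moreover have "(\<Inter>n. tube A B (f n)) = tube A B 0"
    proof (intro set_eqI iffI)
      fix x assume x: "x \<in> (\<Inter>n. tube A B (f n))"
      have "f \<longlonglongrightarrow> 0" unfolding f_def by (rule LIMSEQ_Suc[OF lim_const_over_n])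
      then have "infdist x A \<le> 0"
        by (rule tendsto_lowerbound[of f 0 sequentially]) (use x in auto)
      then show "x \<in> tube A B 0" using x by auto
    next
      fix x assume "x \<in> tube A B 0"
      then show "x \<in> (\<Inter>n. tube A B (f n))" using f by (auto simp: less_imp_le intro: order_trans)
    qed
    moreover have "(\<lambda>n. poly p (f n)) \<longlonglongrightarrow> poly p 0"
      unfolding f_def by (intro tendsto_poly LIMSEQ_Suc[OF lim_const_over_n])
    ultimately show ?thesis
      using f p(2) True LIMSEQ_unique by force
  qed
  then show ?thesis using p(1) unfolding polynomial_on_def by blast
qed

end

section \<open>Curvature measures and their total variation\<close>

abbreviation steiner_poly :: "nat \<Rightarrow> (nat \<Rightarrow> real) \<Rightarrow> real \<Rightarrow> real" where
  "steiner_poly d c r \<equiv> \<Sum>m\<le>d. r ^ (d - m) * unit_ball_vol (real (d - m)) * c m"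

lemma coeff_lagrange_interpolation:
  assumes "inj_on t {..d}" "degree p \<le> d"
  shows "coeff p j = (\<Sum>i\<le>d. poly p (t i) * coeff (lagrange_basis t d i) j)"
  by (subst lagrange_interpolation[OF assms]) (simp add: coeff_sum)

lemma poly_sum_coeff: "degree p \<le> d \<Longrightarrow> poly p x = (\<Sum>m\<le>d. coeff p (d - m) * x ^ (d - m))"
  for x :: real
proof -
  assume "degree p \<le> d"
  then have "poly p x = (\<Sum>j\<le>d. coeff p j * x ^ j)"
    unfolding poly_altdef by (intro sum.mono_neutral_left) (auto simp: coeff_eq_0)
  also have "\<dots> = (\<Sum>m\<le>d. coeff p (d - m) * x ^ (d - m))"
    by (rule sum.reindex_bij_witness[of _ "\<lambda>m. d - m" "\<lambda>m. d - m"]) auto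
  finally show ?thesis .
qed

text \<open>A point closer than R to \<open>A\<close> lies in a ball about its own foot, of radius
  larger than R, on which nearest points are unique.\<close>

lemma unique_foot_reach:
  assumes "closed A" "A \<noteq> {}" "ereal R < reach A"
  shows "unique_foot A R"
proof
  fix x assume x: "infdist x A < R"
  define a where "a = closest_point A x"
  have a: "a \<in> A" "dist x a = infdist x A"
    using closest_point_infdist[OF assms(1,2)] by (auto simp: a_def)
  have "reach A \<le> reach_at A a" unfolding reach_def by (rule INF_lower[OF a(1)])
  then have "ereal R < reach_at A a" using assms(3) by simp
  then obtain r where "ball a r \<subseteq> Unp A" "R < r"
    unfolding reach_at_def less_SUP_iff by auto
  then show "x \<in> Unp A" using x a(2) by (auto simp: dist_commute)
qed (use assms in auto)

lemma (in unique_foot) measure_tube_sums: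
  assumes "r < R" and E: "range E \<subseteq> sets borel" "disjoint_family E" "bounded (\<Union>i. E i)"
  shows "(\<lambda>i::nat. measure lebesgue (tube A (E i) r)) sums measure lebesgue (tube A (\<Union>i. E i) r)"
proof -
  have eq: "tube A (\<Union>i. E i) r = (\<Union>i. tube A (E i) r)" by auto
  have "tube A (\<Union>i. E i) r \<in> lmeasurable"
    using assms by (intro tube_lmeasurable) auto
  moreover have "tube A (E i) r \<in> sets lebesgue" for i
    using tube_borel[OF assms(1), of "E i"] E(1) by auto
  moreover have "disjoint_family (\<lambda>i. tube A (E i) r)"
    using E(2) unfolding disjoint_family_on_def by blast
  ultimately show ?thesis
    unfolding eq by (intro measure_UNION) (auto dest: fmeasurableD2)
qed

lemma signed_radon_measure_sum:
  assumes "\<And>i. i \<in> I \<Longrightarrow> signed_radon_measure (\<mu> i)"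
  shows "signed_radon_measure (\<lambda>B. \<Sum>i\<in>I. \<mu> i B * c i)"
  using assms unfolding signed_radon_measure_def by (auto intro!: sums_sum sums_mult2)

lemma steiner_system_exists:
  fixes A :: "'a::euclidean_space set"
  assumes A: "closed A" "A \<noteq> {}" "0 < reach A"
  obtains \<Phi> where "steiner_system A \<Phi>"
proof -
  let ?d = "DIM('a)"
  let ?V = "\<lambda>r B. measure lebesgue (tube A B r)"
  obtain \<rho> where \<rho>: "0 < \<rho>" "ereal \<rho> < reach A"
    using assms(3) ereal_dense2[of 0 "reach A"] by (auto simp: zero_ereal_def)
  define t where "t i = \<rho> * real (Suc i) / real (?d + 2)" for i
  have t: "0 < t i" "t i < \<rho>" if "i \<le> ?d" for i
  proof -
    have "real (Suc i) / real (?d + 2) < 1" using that by simp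
    then have "\<rho> * (real (Suc i) / real (?d + 2)) < \<rho> * 1"
      using \<rho>(1) by (intro mult_strict_left_mono)
    then show "t i < \<rho>" by (simp add: t_def)
    show "0 < t i" using \<rho>(1) by (simp add: t_def)
  qed
  have inj: "inj_on t {..?d}" using \<rho>(1) by (auto simp: inj_on_def t_def)
  \<comment> \<open>By interpolation at the radii \<open>t i\<close>, the coefficient of r^(d - m)
    is this fixed combination of tube volumes. Countable additivity in B is thereby inherited from
    the volumes.\<close>
  define \<Phi> where "\<Phi> m B = (\<Sum>i\<le>?d. ?V (t i) B *
      (coeff (lagrange_basis t ?d i) (?d - m) / unit_ball_vol (real (?d - m))))" for m B
  have "steiner_system A \<Phi>"
    unfolding steiner_system_def
  proof (intro conjI allI impI)
    fix m assume "m \<le> ?d"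
    interpret unique_foot A \<rho> by (rule unique_foot_reach[OF A(1,2) \<rho>(2)])
    have "signed_radon_measure (?V (t i))" if "i \<le> ?d" for i
      unfolding signed_radon_measure_def
      using measure_tube_sums[OF t(2)[OF that]] by simp
    then show "signed_radon_measure (\<Phi> m)"
      unfolding \<Phi>_def by (intro signed_radon_measure_sum) auto
  next
    fix B :: "'a set" and r
    assume B: "B \<in> sets borel" "bounded B" and r: "0 \<le> r" "ereal r < reach A"
    \<comment> \<open>A bound R above both r and \<rho> lets a single polynomial describe the volume
      at r and at all nodes.\<close>
    have "ereal (max r \<rho>) < reach A" using r \<rho> by (simp add: max_def)
    then obtain R where "ereal (max r \<rho>) < ereal R" and R2: "ereal R < reach A"
      using ereal_dense2 by blast
    then have R: "max r \<rho> < R" "ereal R < reach A" by simp_all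
    interpret unique_foot A R by (rule unique_foot_reach[OF A(1,2) R(2)])
    obtain p where p: "degree p \<le> ?d" "\<And>r. 0 \<le> r \<Longrightarrow> r < R \<Longrightarrow> ?V r B = poly p r"
      using polynomial_on_tube[OF B] R(1) r(1) unfolding polynomial_on_def by auto
    have pt: "poly p (t i) = ?V (t i) B" if "i \<le> ?d" for i
      using p(2)[of "t i"] t[OF that] R(1) by simp
    have "?V r B = (\<Sum>m\<le>?d. coeff p (?d - m) * r ^ (?d - m))"
      using p(2)[of r] R(1) r(1) poly_sum_coeff[OF p(1), of r] by simp
    also have "\<dots> = steiner_poly ?d (\<lambda>m. \<Phi> m B) r"
    proof (intro sum.cong refl)
      fix m assume "m \<in> {..?d}"
      have "0 < unit_ball_vol (real (?d - m))" by (rule unit_ball_vol_pos) simp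
      then have "unit_ball_vol (real (?d - m)) \<noteq> 0" by linarith
      then have "unit_ball_vol (real (?d - m)) * \<Phi> m B = coeff p (?d - m)"
        unfolding coeff_lagrange_interpolation[OF inj p(1)] \<Phi>_def sum_distrib_left
        by (intro sum.cong refl) (simp add: pt)
      then show "coeff p (?d - m) * r ^ (?d - m) = r ^ (?d - m) * unit_ball_vol (real (?d - m)) * \<Phi> m B"
        by (simp add: mult.assoc mult.commute)
    qed
    finally show "?V r B = steiner_poly ?d (\<lambda>m. \<Phi> m B) r" .
  qed
  then show ?thesis by (rule that)
qed

lemma curvature_measure_eq:
  fixes A :: "'a::euclidean_space set"
  assumes "0 < reach A" "steiner_system A \<Phi>" "m \<le> DIM('a)" "B \<in> sets borel" "bounded B"
  shows "curvature_measure m A B = \<Phi> m B"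
  unfolding curvature_measure_def
  by (rule the_equality) (use assms steiner_system_unique[OF assms(1)] in blast)+

text \<open>The clauses of \<open>steiner_system\<close> only test bounded Borel sets, and there
  uniqueness identifies the description with any given system.\<close>

theorem steiner_system_curvature_measure:
  fixes A :: "'a::euclidean_space set"
  assumes A: "closed A" "A \<noteq> {}" "0 < reach A"
  shows "steiner_system A (\<lambda>m. curvature_measure m A)"
proof -
  obtain \<Phi> where \<Phi>: "steiner_system A \<Phi>" using steiner_system_exists[OF A] .
  note eq = curvature_measure_eq[OF A(3) \<Phi>]
  show ?thesis
    unfolding steiner_system_def
  proof (intro conjI allI impI)
    fix m assume m: "m \<le> DIM('a)"
    show "signed_radon_measure (curvature_measure m A)"
      unfolding signed_radon_measure_def
    proof (intro allI impI)
      fix E :: "nat \<Rightarrow> 'a set"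
      assume E: "range E \<subseteq> sets borel" "disjoint_family E" "bounded (\<Union>i. E i)"
      have "curvature_measure m A (E i) = \<Phi> m (E i)" for i
        using E by (intro eq[OF m]) (auto intro: bounded_subset)
      moreover have "curvature_measure m A (\<Union>i. E i) = \<Phi> m (\<Union>i. E i)"
        using E by (intro eq[OF m]) auto
      moreover have "(\<lambda>i. \<Phi> m (E i)) sums \<Phi> m (\<Union>i. E i)"
        using \<Phi> m E unfolding steiner_system_def signed_radon_measure_def by blast
      ultimately show "(\<lambda>i. curvature_measure m A (E i)) sums curvature_measure m A (\<Union>i. E i)"
        by simp
    qed
  next
    fix B :: "'a set" and r
    assume B: "B \<in> sets borel" "bounded B" "0 \<le> r" "ereal r < reach A"
    have "measure lebesgue (tube A B r)
        = steiner_poly DIM('a) (\<lambda>m. \<Phi> m B) r"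
      using \<Phi> B unfolding steiner_system_def by blast
    also have "\<dots> = steiner_poly DIM('a) (\<lambda>m. curvature_measure m A B) r"
      using B by (intro sum.cong) (simp_all add: eq)
    finally show "measure lebesgue (tube A B r) = \<dots>" .
  qed
qed

lemma signed_radon_curvature_measure:
  fixes A :: "'a::euclidean_space set"
  assumes "closed A" "A \<noteq> {}" "0 < reach A" "m \<le> DIM('a)"
  shows "signed_radon_measure (curvature_measure m A)"
  using steiner_system_curvature_measure[OF assms(1-3)] assms(4) unfolding steiner_system_def by blast

text \<open>Polynomials that agree on a short interval of radii are equal, so curvature measures can
  be compared through volumes of arbitrarily thin tubes.\<close>

lemma curvature_measure_eqI:
  fixes A :: "'a::euclidean_space set"
  assumes A: "closed A" "A \<noteq> {}" "0 < reach A" and B: "B \<in> sets borel" "bounded B"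
    and "0 < \<rho>" and eq: "\<And>r. 0 < r \<Longrightarrow> r < \<rho> \<Longrightarrow>
      measure lebesgue (tube A B r) =
      steiner_poly DIM('a) c r"
    and m: "m \<le> DIM('a)"
  shows "curvature_measure m A B = c m"
proof -
  let ?d = "DIM('a)"
  obtain R where R: "0 < R" "ereal R < reach A"
    using assms(3) ereal_dense2[of 0 "reach A"] by (auto simp: zero_ereal_def)
  define p where "p f = (\<Sum>m\<le>?d. monom (unit_ball_vol (real (?d - m)) * f m) (?d - m))" for f :: "nat \<Rightarrow> real"
  have coeff_p: "coeff (p f) (?d - m) = unit_ball_vol (real (?d - m)) * f m" for f
  proof -
    have "coeff (p f) (?d - m) = (\<Sum>l\<le>?d. if l = m then unit_ball_vol (real (?d - l)) * f l else 0)"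
      unfolding p_def coeff_sum using m by (intro sum.cong) (auto simp: coeff_monom)
    then show ?thesis using m by simp
  qed
  have "p (\<lambda>m. curvature_measure m A B) = p c"
  proof (rule poly_eqI_infinite)
    show "infinite {0<..<min \<rho> R}" using \<open>0 < \<rho>\<close> R by (simp add: infinite_Ioo)
    fix r assume r: "r \<in> {0<..<min \<rho> R}"
    then have "ereal r < reach A" using less_trans[OF _ R(2), of "ereal r"] by simp
    then have "measure lebesgue (tube A B r) =
        steiner_poly ?d (\<lambda>m. curvature_measure m A B) r"
      using steiner_system_curvature_measure[OF A] r B unfolding steiner_system_def by auto
    then show "poly (p (\<lambda>m. curvature_measure m A B)) r = poly (p c) r"
      using eq[of r] r by (simp add: p_def poly_sum poly_monom mult_ac)
  qed
  then have "unit_ball_vol (real (?d - m)) * curvature_measure m A B = unit_ball_vol (real (?d - m)) * c m"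
    by (metis coeff_p[of "\<lambda>m. curvature_measure m A B"] coeff_p[of c])
  moreover have "0 < unit_ball_vol (real (?d - m))" by (rule unit_ball_vol_pos) simp
  ultimately show ?thesis by simp
qed

text \<open>Feet lie in \<open>A\<close>, so every tube over \<open>B\<close> is empty.\<close>

lemma curvature_measure_outside:
  fixes A :: "'a::euclidean_space set"
  assumes A: "closed A" "A \<noteq> {}" "0 < reach A" and B: "B \<in> sets borel" "bounded B"
    and "B \<inter> A = {}" "m \<le> DIM('a)"
  shows "curvature_measure m A B = 0"
proof (rule curvature_measure_eqI[OF A B zero_less_one _ \<open>m \<le> DIM('a)\<close>, where c = "\<lambda>m. 0"])
  fix r :: real
  have empty: "tube A B r = {}"
    using closest_point_infdist(1)[OF A(1,2)] assms(6) by blast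
  show "measure lebesgue (tube A B r) =
      steiner_poly DIM('a) (\<lambda>m. 0) r"
    unfolding empty by simp
qed

section \<open>Signed Radon measures and total variation\<close>

lemma signed_radon_empty: "signed_radon_measure \<mu> \<Longrightarrow> \<mu> {} = 0"
proof -
  assume "signed_radon_measure \<mu>"
  then have "(\<lambda>i::nat. \<mu> {}) sums \<mu> (\<Union>i::nat. {})"
    unfolding signed_radon_measure_def by (auto simp: disjoint_family_on_def dest: spec[of _ "\<lambda>_. {}"])
  then have "summable (\<lambda>i::nat. \<mu> {})" by (simp add: sums_iff)
  then show ?thesis by (simp add: summable_const_iff)
qed

lemma signed_radon_Un:
  assumes \<mu>: "signed_radon_measure \<mu>" and B: "B \<in> sets borel" "C \<in> sets borel" "B \<inter> C = {}" "bounded B" "bounded C"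
  shows "\<mu> (B \<union> C) = \<mu> B + \<mu> C"
proof -
  let ?E = "binaryset B C"
  have "range ?E \<subseteq> sets borel" "disjoint_family ?E" "bounded (\<Union>i. ?E i)"
    using B by (auto simp: binaryset_def disjoint_family_on_def UN_binaryset_eq)
  then have "(\<lambda>i. \<mu> (?E i)) sums \<mu> (\<Union>i. ?E i)"
    using \<mu> unfolding signed_radon_measure_def by blast
  moreover have "(\<lambda>i. \<mu> (?E i)) sums (\<mu> B + \<mu> C)"
    by (rule binaryset_sums) (rule signed_radon_empty[OF \<mu>])
  ultimately show ?thesis by (simp add: UN_binaryset_eq sums_unique2)
qed

text \<open>In the locality proof the admissible tube radius depends on n, so agreement is known
  only inside each \<open>B n\<close>; the disjoint differences carry it over to the union.\<close>

lemma signed_radon_cong_exhaust: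
  assumes \<mu>: "signed_radon_measure \<mu>" and \<nu>: "signed_radon_measure \<nu>"
    and B: "\<And>n::nat. B n \<in> sets borel" "incseq B" "bounded (\<Union>n. B n)"
    and eq: "\<And>n E. E \<in> sets borel \<Longrightarrow> E \<subseteq> B n \<Longrightarrow> \<mu> E = \<nu> E"
  shows "\<mu> (\<Union>n. B n) = \<nu> (\<Union>n. B n)"
proof -
  have d: "disjoint_family (disjointed B)" "range (disjointed B) \<subseteq> sets borel" "bounded (\<Union>i. disjointed B i)"
    using B(1,3) sets.range_disjointed_sets[of B borel]
    by (auto simp: disjoint_family_disjointed UN_disjointed_eq)
  then have "(\<lambda>i. \<mu> (disjointed B i)) sums \<mu> (\<Union>i. disjointed B i)"
    "(\<lambda>i. \<nu> (disjointed B i)) sums \<nu> (\<Union>i. disjointed B i)"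
    using \<mu> \<nu> unfolding signed_radon_measure_def by blast+
  moreover have "\<mu> (disjointed B i) = \<nu> (disjointed B i)" for i
    using d(2) disjointed_subset[of B i] by (intro eq) auto
  ultimately show ?thesis by (simp add: UN_disjointed_eq sums_unique2)
qed

lemma total_variation_mono:
  assumes "B \<subseteq> C" "B \<in> sets borel" "C \<in> sets borel"
  shows "total_variation \<mu> B \<le> total_variation \<mu> C"
  unfolding total_variation_def
proof (rule SUP_least)
  fix P assume P: "P \<in> {P. finite P \<and> partition_on B P \<and> P \<subseteq> sets borel}"
  \<comment> \<open>A partition has no empty block, so C - B is added only when it is
    nonempty.\<close>
  define P' where "P' = (if C - B = {} then P else insert (C - B) P)"
  have "\<Union>P = B" using P by (auto simp: partition_on_def)
  then have "\<And>X. X \<in> P \<Longrightarrow> disjnt (C - B) X" by (auto simp: disjnt_def)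
  then have P': "finite P'" "partition_on C P'" "P' \<subseteq> sets borel" "P \<subseteq> P'"
    using P assms \<open>\<Union>P = B\<close>
    by (auto simp: P'_def partition_on_def disjoint_def disjnt_def)
  have "(\<Sum>E\<in>P. ennreal \<bar>\<mu> E\<bar>) \<le> (\<Sum>E\<in>P'. ennreal \<bar>\<mu> E\<bar>)"
    using P' by (intro sum_mono2) auto
  also have "\<dots> \<le> (SUP P \<in> {P. finite P \<and> partition_on C P \<and> P \<subseteq> sets borel}. \<Sum>E\<in>P. ennreal \<bar>\<mu> E\<bar>)"
    using P' by (intro SUP_upper) auto
  finally show "(\<Sum>E\<in>P. ennreal \<bar>\<mu> E\<bar>) \<le> \<dots>" .
qed

lemma total_variation_cong_le:
  assumes "\<And>E. E \<in> sets borel \<Longrightarrow> E \<subseteq> B \<Longrightarrow> \<bar>\<mu> E\<bar> \<le> \<bar>\<nu> E\<bar>"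
  shows "total_variation \<mu> B \<le> total_variation \<nu> B"
  unfolding total_variation_def
proof (rule SUP_mono)
  fix P assume P: "P \<in> {P. finite P \<and> partition_on B P \<and> P \<subseteq> sets borel}"
  have "(\<Sum>E\<in>P. ennreal \<bar>\<mu> E\<bar>) \<le> (\<Sum>E\<in>P. ennreal \<bar>\<nu> E\<bar>)"
    by (intro sum_mono ennreal_leI assms) (use P in \<open>auto simp: partition_on_def\<close>)
  then show "\<exists>Q\<in>{P. finite P \<and> partition_on B P \<and> P \<subseteq> sets borel}.
      (\<Sum>E\<in>P. ennreal \<bar>\<mu> E\<bar>) \<le> (\<Sum>E\<in>Q. ennreal \<bar>\<nu> E\<bar>)"
    using P by blast
qed

lemma total_variation_eq_0:
  assumes "\<And>E. E \<in> sets borel \<Longrightarrow> E \<subseteq> B \<Longrightarrow> \<mu> E = 0"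
  shows "total_variation \<mu> B = 0"
proof -
  have "(\<Sum>E\<in>P. ennreal \<bar>\<mu> E\<bar>) = 0" if "partition_on B P" "P \<subseteq> sets borel" for P
    using assms that by (intro sum.neutral) (auto simp: partition_on_def)
  then have "total_variation \<mu> B \<le> 0"
    unfolding total_variation_def by (intro SUP_least) auto
  then show ?thesis by simp
qed

lemma total_variation_disjoint_Un:
  assumes \<mu>: "signed_radon_measure \<mu>"
    and B: "B \<in> sets borel" "C \<in> sets borel" "B \<inter> C = {}" "bounded B" "bounded C"
  shows "total_variation \<mu> (B \<union> C) \<le> total_variation \<mu> B + total_variation \<mu> C"
  unfolding total_variation_def[of \<mu> "B \<union> C"]
proof (rule SUP_least)
  fix P assume P: "P \<in> {P. finite P \<and> partition_on (B \<union> C) P \<and> P \<subseteq> sets borel}"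
  then have fin: "finite P" and U: "\<Union>P = B \<union> C" and dis: "disjoint P" and bor: "P \<subseteq> sets borel"
    by (auto simp: partition_on_def)
  have part: "(\<Sum>E\<in>P. ennreal \<bar>\<mu> (E \<inter> D)\<bar>) \<le> total_variation \<mu> D"
    if D: "D \<in> sets borel" "D \<subseteq> B \<union> C" for D
  proof -
    \<comment> \<open>Only the blocks meeting D stay nonempty and distinct when cut with D; the
      dropped ones contribute \<mu> {} = 0.\<close>
    define Q where "Q = {E \<in> P. E \<inter> D \<noteq> {}}"
    have inj: "inj_on (\<lambda>E. E \<inter> D) Q"
      using dis unfolding Q_def inj_on_def disjoint_def by blast
    have "(\<Sum>E\<in>P. ennreal \<bar>\<mu> (E \<inter> D)\<bar>) = (\<Sum>E\<in>Q. ennreal \<bar>\<mu> (E \<inter> D)\<bar>)"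
      using fin signed_radon_empty[OF \<mu>] by (intro sum.mono_neutral_right) (auto simp: Q_def)
    also have "\<dots> = (\<Sum>E\<in>(\<lambda>E. E \<inter> D) ` Q. ennreal \<bar>\<mu> E\<bar>)"
      by (simp add: sum.reindex[OF inj])
    also have "\<dots> \<le> total_variation \<mu> D"
      unfolding total_variation_def
    proof (rule SUP_upper, intro CollectI conjI)
      show "partition_on D ((\<lambda>E. E \<inter> D) ` Q)"
      proof (rule partition_onI)
        show "\<Union> ((\<lambda>E. E \<inter> D) ` Q) = D"
        proof (intro set_eqI iffI)
          fix x assume x: "x \<in> D"
          then obtain E where "E \<in> P" "x \<in> E" using U D(2) by blast
          then show "x \<in> \<Union> ((\<lambda>E. E \<inter> D) ` Q)" using x by (auto simp: Q_def)
        qed auto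
        show "disjnt p p'" if "p \<in> (\<lambda>E. E \<inter> D) ` Q" "p' \<in> (\<lambda>E. E \<inter> D) ` Q" "p \<noteq> p'" for p p'
          using that dis unfolding Q_def disjnt_def disjoint_def by blast
        show "{} \<notin> (\<lambda>E. E \<inter> D) ` Q" by (auto simp: Q_def)
      qed
      show "finite ((\<lambda>E. E \<inter> D) ` Q)" using fin by (simp add: Q_def)
      show "(\<lambda>E. E \<inter> D) ` Q \<subseteq> sets borel" using bor D(1) by (auto simp: Q_def)
    qed
    finally show ?thesis .
  qed
  have "ennreal \<bar>\<mu> E\<bar> \<le> ennreal \<bar>\<mu> (E \<inter> B)\<bar> + ennreal \<bar>\<mu> (E \<inter> C)\<bar>" if "E \<in> P" for E
  proof -
    have "E = (E \<inter> B) \<union> (E \<inter> C)" using U that by auto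
    then have "\<mu> E = \<mu> (E \<inter> B) + \<mu> (E \<inter> C)"
      using signed_radon_Un[OF \<mu>, of "E \<inter> B" "E \<inter> C"] B bor that
      by (auto intro: bounded_subset)
    then have "\<bar>\<mu> E\<bar> \<le> \<bar>\<mu> (E \<inter> B)\<bar> + \<bar>\<mu> (E \<inter> C)\<bar>" by simp
    then show ?thesis by (simp flip: ennreal_plus)
  qed
  then have "(\<Sum>E\<in>P. ennreal \<bar>\<mu> E\<bar>) \<le> (\<Sum>E\<in>P. ennreal \<bar>\<mu> (E \<inter> B)\<bar>) + (\<Sum>E\<in>P. ennreal \<bar>\<mu> (E \<inter> C)\<bar>)"
    unfolding sum.distrib[symmetric] by (rule sum_mono)
  also have "\<dots> \<le> total_variation \<mu> B + total_variation \<mu> C"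
    using B by (intro add_mono part) auto
  finally show "(\<Sum>E\<in>P. ennreal \<bar>\<mu> E\<bar>) \<le> total_variation \<mu> B + total_variation \<mu> C" .
qed

lemma total_variation_Un:
  assumes \<mu>: "signed_radon_measure \<mu>"
    and B: "B \<in> sets borel" "C \<in> sets borel" "bounded B" "bounded C"
  shows "total_variation \<mu> (B \<union> C) \<le> total_variation \<mu> B + total_variation \<mu> C"
proof -
  have "total_variation \<mu> (B \<union> (C - B)) \<le> total_variation \<mu> B + total_variation \<mu> (C - B)"
    using B by (intro total_variation_disjoint_Un[OF \<mu>]) (auto intro: bounded_subset)
  also have "\<dots> \<le> total_variation \<mu> B + total_variation \<mu> C"
    using B by (intro add_left_mono total_variation_mono) auto
  finally show ?thesis by simp
qed

lemma total_variation_UN: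
  assumes \<mu>: "signed_radon_measure \<mu>" and "finite I"
    and "\<And>i. i \<in> I \<Longrightarrow> B i \<in> sets borel" "\<And>i. i \<in> I \<Longrightarrow> bounded (B i)"
  shows "total_variation \<mu> (\<Union>i\<in>I. B i) \<le> (\<Sum>i\<in>I. total_variation \<mu> (B i))"
  using assms(2-)
proof (induction I rule: finite_induct)
  case empty
  then show ?case using total_variation_eq_0[of "{}" \<mu>] signed_radon_empty[OF \<mu>] by simp
next
  case (insert i I)
  have "total_variation \<mu> (B i \<union> (\<Union>i\<in>I. B i)) \<le> total_variation \<mu> (B i) + total_variation \<mu> (\<Union>i\<in>I. B i)"
    using insert by (intro total_variation_Un[OF \<mu>]) (auto intro: sets.finite_UN)
  also have "\<dots> \<le> total_variation \<mu> (B i) + (\<Sum>i\<in>I. total_variation \<mu> (B i))"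
    using insert by (intro add_left_mono) auto
  finally show ?case using insert by simp
qed

section \<open>Parallel sets, locality and scaling\<close>

lemma closed_parallel_set: "closed (parallel_set \<epsilon> K)"
  unfolding parallel_set_def by (intro closed_Collect_le continuous_intros)

lemma parallel_set_iff:
  assumes "compact K" "K \<noteq> {}"
  shows "x \<in> parallel_set \<epsilon> K \<longleftrightarrow> (\<exists>p\<in>K. dist x p \<le> \<epsilon>)"
proof
  assume "x \<in> parallel_set \<epsilon> K"
  then show "\<exists>p\<in>K. dist x p \<le> \<epsilon>"
    using closest_point_infdist[OF compact_imp_closed[OF assms(1)] assms(2), of x]
    by (intro bexI[of _ "closest_point K x"]) (simp_all add: parallel_set_def)
qed (auto simp: parallel_set_def intro: infdist_le2)

lemma parallel_set_mono:
  assumes "K \<subseteq> L" "K \<noteq> {}"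
  shows "parallel_set \<epsilon> K \<subseteq> parallel_set \<epsilon> L"
  using infdist_mono[OF assms] unfolding parallel_set_def by (auto intro: order_trans)

lemma parallel_set_subset_cball:
  assumes "compact K" "p \<in> K"
  shows "parallel_set \<epsilon> K \<subseteq> cball p (\<epsilon> + diameter K)"
proof
  fix x assume "x \<in> parallel_set \<epsilon> K"
  then obtain q where q: "q \<in> K" "dist x q \<le> \<epsilon>" using parallel_set_iff[OF assms(1)] assms(2) by blast
  have "dist p q \<le> diameter K"
    using diameter_bounded_bound[OF compact_imp_bounded[OF assms(1)] assms(2) q(1)] .
  then show "x \<in> cball p (\<epsilon> + diameter K)"
    using dist_triangle[of p x q] q(2) by (simp add: dist_commute)
qed

lemma bounded_parallel_set: "compact K \<Longrightarrow> K \<noteq> {} \<Longrightarrow> bounded (parallel_set \<epsilon> K)"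
  using parallel_set_subset_cball bounded_subset[OF bounded_cball] by (metis ex_in_conv)

section \<open>Closed complements and their reach\<close>

lemma closed_closed_complement: "closed (closed_complement X)"
  unfolding closed_complement_def by simp

lemma closed_complement_nonempty:
  fixes X :: "'a::euclidean_space set"
  assumes "bounded X"
  shows "closed_complement X \<noteq> {}"
proof -
  have "X \<noteq> UNIV" using assms not_bounded_UNIV by blast
  then show ?thesis using closure_subset[of "- X"] unfolding closed_complement_def by auto
qed

lemma closed_complement_Int_interior: "interior X \<inter> closed_complement X = {}"
  unfolding closed_complement_def closure_complement by blast

lemma closed_complement_parallel_le:
  assumes "a \<in> closed_complement (parallel_set \<epsilon> K)"
  shows "\<epsilon> \<le> infdist a K"
proof -
  have "closed {x. \<epsilon> \<le> infdist x K}" by (intro closed_Collect_le continuous_intros)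
  then have "closed_complement (parallel_set \<epsilon> K) \<subseteq> {x. \<epsilon> \<le> infdist x K}"
    unfolding closed_complement_def by (intro closure_minimal) (auto simp: parallel_set_def)
  then show ?thesis using assms by blast
qed

text \<open>If \<open>a\<close>, \<open>b\<close> were two nearest points of \<open>x\<close>, then pushing their midpoint away from \<open>K\<close> by
  \<open>\<delta>\<^sup>2 / (4 \<epsilon>)\<close>, where \<open>\<delta>\<close> is their distance, would give a point closer to \<open>x\<close>.\<close>

lemma Unp_closed_complement_parallel:
  fixes K :: "'a::euclidean_space set"
  assumes K: "compact K" "K \<noteq> {}" and "0 < \<epsilon>" and diam: "sqrt 2 * diameter K \<le> \<epsilon>"
    and x: "infdist x (closed_complement (parallel_set \<epsilon> K)) < \<epsilon> / 2"
  shows "x \<in> Unp (closed_complement (parallel_set \<epsilon> K))"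
proof -
  define A where "A = closed_complement (parallel_set \<epsilon> K)"
  have A: "closed A" "A \<noteq> {}"
    unfolding A_def by (rule closed_closed_complement, rule closed_complement_nonempty[OF bounded_parallel_set[OF K]])
  define t where "t = infdist x A"
  have "a = b" if a: "a \<in> A" "dist x a = t" and b: "b \<in> A" "dist x b = t" for a b
  proof (rule ccontr)
    assume "a \<noteq> b"
    define \<delta> where "\<delta> = norm (a - b)"
    have \<delta>: "0 < \<delta>" using \<open>a \<noteq> b\<close> by (simp add: \<delta>_def)
    have "\<delta> \<le> norm (a - x) + norm (x - b)"
      using norm_triangle_ineq[of "a - x" "x - b"] by (simp add: \<delta>_def)
    then have \<delta>t: "\<delta> \<le> 2 * t" using a b by (simp add: dist_norm norm_minus_commute)
    then have t: "0 < t" "2 * t < \<epsilon>" using \<delta> x by (auto simp: t_def A_def)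
    define m where "m = (a + b) /\<^sub>R 2"
    \<comment> \<open>The median formula for the triangle a, b, y, used for y = x and for y in
      K.\<close>
    have half: "(norm (m - y))\<^sup>2 = ((norm (a - y))\<^sup>2 + (norm (b - y))\<^sup>2) / 2 - \<delta>\<^sup>2 / 4" for y
      unfolding m_def \<delta>_def power2_norm_eq_inner
      by (simp add: inner_diff_left inner_diff_right inner_add_left inner_add_right inner_commute field_simps)
    have "(norm (m - x))\<^sup>2 = t\<^sup>2 - \<delta>\<^sup>2 / 4"
      unfolding half using a b by (simp add: dist_norm norm_minus_commute)
    \<comment> \<open>Completing the square bounds sqrt (t^2 - \<delta>^2/4) by t - \<delta>^2/(8
      t), which is how much closer than a and b the midpoint is to x.\<close>
    also have "\<dots> \<le> t\<^sup>2 - \<delta>\<^sup>2 / 4 + (\<delta>\<^sup>2 / (8 * t))\<^sup>2" by simp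
    also have "\<dots> = (t - \<delta>\<^sup>2 / (8 * t))\<^sup>2"
      unfolding power2_diff using t by simp
    finally have "norm (m - x) \<le> \<bar>t - \<delta>\<^sup>2 / (8 * t)\<bar>" by (metis abs_ge_zero power2_abs power2_le_imp_le)
    moreover have "\<delta>\<^sup>2 / (8 * t) \<le> t"
    proof -
      have "\<delta>\<^sup>2 \<le> (2 * t)\<^sup>2" using \<delta> \<delta>t by (intro power_mono) auto
      also have "\<dots> \<le> t * (8 * t)" by (simp add: power2_eq_square)
      finally show ?thesis using t by (simp add: field_simps)
    qed
    ultimately have xm: "norm (m - x) \<le> t - \<delta>\<^sup>2 / (8 * t)" by simp
    have mp: "\<epsilon>\<^sup>2 - \<delta>\<^sup>2 / 4 \<le> (norm (m - p))\<^sup>2" if "p \<in> K" for p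
    proof -
      have "\<epsilon> \<le> norm (a - p)" "\<epsilon> \<le> norm (b - p)"
        using closed_complement_parallel_le[of a \<epsilon> K] closed_complement_parallel_le[of b \<epsilon> K]
          infdist_le[OF that, of a] infdist_le[OF that, of b] a(1) b(1)
        by (simp_all add: A_def dist_norm)
      then have "\<epsilon>\<^sup>2 \<le> (norm (a - p))\<^sup>2" "\<epsilon>\<^sup>2 \<le> (norm (b - p))\<^sup>2"
        using \<open>0 < \<epsilon>\<close> by (auto intro!: power_mono)
      then show ?thesis unfolding half by simp
    qed
    have \<delta>\<epsilon>: "\<delta>\<^sup>2 / 4 \<le> \<epsilon>\<^sup>2 / 4" using \<delta> \<delta>t t by (simp add: power_mono)
    obtain p0 where p0: "p0 \<in> K" using K by blast
    define l where "l = norm (m - p0)"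
    have "0 < \<epsilon>\<^sup>2" using \<open>0 < \<epsilon>\<close> by simp
    then have "0 < l\<^sup>2" using mp[OF p0] \<delta>\<epsilon> unfolding l_def by linarith
    then have l: "0 < l" by (simp add: l_def)
    define u where "u = (m - p0) /\<^sub>R l"
    have nu: "norm u = 1" using l by (simp add: u_def l_def)
    \<comment> \<open>Here sqrt 2 enters: |p - p0|^2 \<le> \<epsilon>^2/2 while |m - p|^2 \<ge> 3
      \<epsilon>^2/4, so the law of cosines at m leaves at least l^2 + \<epsilon>^2/4 \<ge> l
      \<epsilon>.\<close>
    have up: "\<epsilon> / 2 \<le> u \<bullet> (m - p)" if p: "p \<in> K" for p
    proof -
      have "norm (p - p0) \<le> diameter K"
        using diameter_bounded_bound[OF compact_imp_bounded[OF K(1)] p p0] by (simp add: dist_norm)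
      then have "sqrt 2 * norm (p - p0) \<le> \<epsilon>" using diam by (smt (verit) mult_left_mono real_sqrt_ge_zero)
      then have "(sqrt 2 * norm (p - p0))\<^sup>2 \<le> \<epsilon>\<^sup>2" by (intro power_mono) auto
      then have pp: "(norm (p - p0))\<^sup>2 \<le> \<epsilon>\<^sup>2 / 2" by (simp add: power_mult_distrib)
      have "2 * ((m - p0) \<bullet> (m - p)) = l\<^sup>2 + (norm (m - p))\<^sup>2 - (norm (p - p0))\<^sup>2"
        unfolding l_def power2_norm_eq_inner
        by (simp add: inner_diff_left inner_diff_right inner_commute)
      also have "\<dots> \<ge> l\<^sup>2 + \<epsilon>\<^sup>2 / 4" using mp[OF p] \<delta>\<epsilon> pp by simp
      finally have "2 * ((m - p0) \<bullet> (m - p)) \<ge> l * \<epsilon>"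
        using zero_le_power2[of "l - \<epsilon> / 2"] by (simp add: power2_diff power_divide)
      moreover have "u \<bullet> (m - p) = ((m - p0) \<bullet> (m - p)) / l"
        by (simp only: u_def inner_scaleR_left divide_inverse mult.commute)
      ultimately have "l * \<epsilon> \<le> l * (2 * (u \<bullet> (m - p)))" using l by simp
      then have "\<epsilon> \<le> 2 * (u \<bullet> (m - p))" using l by (rule mult_left_le_imp_le)
      then show ?thesis by simp
    qed
    \<comment> \<open>Moving m by s along u raises the squared distance from each p by more than s
      \<epsilon> = \<delta>^2/4, which makes up for the deficit of m. The move is shorter than the
      \<delta>^2/(8 t) saved towards x exactly because 2 t < \<epsilon>; this is the origin of the
      bound \<epsilon>/2.\<close>
    define s where "s = \<delta>\<^sup>2 / (4 * \<epsilon>)"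
    have s: "0 < s" "s * \<epsilon> = \<delta>\<^sup>2 / 4" using \<delta> \<open>0 < \<epsilon>\<close> by (simp_all add: s_def)
    define w where "w = m + s *\<^sub>R u"
    have wp: "\<epsilon> < norm (w - p)" if p: "p \<in> K" for p
    proof -
      have "(norm ((m - p) + s *\<^sub>R u))\<^sup>2 = (norm (m - p))\<^sup>2 + 2 * s * (u \<bullet> (m - p)) + s\<^sup>2 * (norm u)\<^sup>2"
        unfolding power2_norm_eq_inner inner_add_left inner_add_right
        by (simp add: inner_commute power2_eq_square)
      moreover have "w - p = (m - p) + s *\<^sub>R u" by (simp add: w_def)
      ultimately have "(norm (w - p))\<^sup>2 = (norm (m - p))\<^sup>2 + 2 * s * (u \<bullet> (m - p)) + s\<^sup>2"
        by (simp only: nu power_one mult_1_right)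
      moreover have "s * \<epsilon> \<le> 2 * s * (u \<bullet> (m - p))"
        using mult_left_mono[OF up[OF p], of "2 * s"] s(1) by simp
      moreover have "0 < s\<^sup>2" using s(1) by simp
      ultimately have "\<epsilon>\<^sup>2 < (norm (w - p))\<^sup>2" using mp[OF p] s(2) by linarith
      then show ?thesis by (rule power_less_imp_less_base) simp
    qed
    have "w \<notin> parallel_set \<epsilon> K"
      using parallel_set_iff[OF K] wp by (auto simp: dist_norm not_le)
    then have "w \<in> A" unfolding A_def closed_complement_def using closure_subset by blast
    then have "t \<le> norm (x - w)" unfolding t_def using infdist_le[of w A x] by (simp add: dist_norm)
    also have "norm (x - w) = norm ((m - x) + s *\<^sub>R u)"
      by (subst norm_minus_commute) (simp add: w_def algebra_simps)
    also have "\<dots> \<le> norm (m - x) + s"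
      using norm_triangle_ineq[of "m - x" "s *\<^sub>R u"] s nu by simp
    also have "\<dots> < t"
    proof -
      have "s < \<delta>\<^sup>2 / (8 * t)"
        unfolding s_def using \<delta> t by (intro divide_strict_left_mono) auto
      then show ?thesis using xm by linarith
    qed
    finally show False by simp
  qed
  then show ?thesis
    using closest_point_infdist[OF A, of x] unfolding Unp_def A_def[symmetric] t_def by blast
qed

lemma reach_ge:
  assumes "\<And>x. infdist x A < R \<Longrightarrow> x \<in> Unp A"
  shows "ereal R \<le> reach A"
  unfolding reach_def
proof (rule INF_greatest)
  fix a assume "a \<in> A"
  then have "ball a R \<subseteq> Unp A"
    using assms le_less_trans[OF infdist_le[of a A]] by (auto simp: dist_commute)
  then show "ereal R \<le> reach_at A a" unfolding reach_at_def by (intro SUP_upper) auto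
qed

lemma reach_closed_complement_parallel:
  fixes K :: "'a::euclidean_space set"
  assumes "compact K" "K \<noteq> {}" "0 < \<epsilon>" "sqrt 2 * diameter K \<le> \<epsilon>"
  shows "ereal (\<epsilon> / 2) \<le> reach (closed_complement (parallel_set \<epsilon> K))"
  by (intro reach_ge Unp_closed_complement_parallel assms)

text \<open>Over a set whose points have room 1/(n+1) inside \<open>W\<close>, tubes of radius r
  with 2 r < 1/(n+1) coincide: the feet of a point in the two sets are within 2 r of each other, so
  both lie in \<open>W\<close>, where the sets agree.\<close>

lemma curvature_measure_local:
  fixes A\<^sub>1 A\<^sub>2 :: "'a::euclidean_space set"
  assumes A1: "closed A\<^sub>1" "A\<^sub>1 \<noteq> {}" "0 < reach A\<^sub>1" and A2: "closed A\<^sub>2" "A\<^sub>2 \<noteq> {}" "0 < reach A\<^sub>2"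
    and W: "open W" "A\<^sub>1 \<inter> W = A\<^sub>2 \<inter> W" and B: "B \<in> sets borel" "bounded B" "B \<subseteq> W"
    and m: "m \<le> DIM('a)"
  shows "curvature_measure m A\<^sub>1 B = curvature_measure m A\<^sub>2 B"
proof -
  obtain R where R: "0 < R" "ereal R < reach A\<^sub>1" "ereal R < reach A\<^sub>2"
    using ereal_dense2[of 0 "min (reach A\<^sub>1) (reach A\<^sub>2)"] A1(3) A2(3) by (auto simp: zero_ereal_def)
  define D where "D n = {x. ball x (1 / real (Suc n)) \<subseteq> W}" for n
  define C where "C n = B \<inter> D n" for n
  have D: "closed (D n)" for n
  proof -
    have "D n = (\<Inter>y\<in>- W. {x. 1 / real (Suc n) \<le> dist x y})" by (force simp: D_def)
    moreover have "closed {x. 1 / real (Suc n) \<le> dist x y}" for y :: 'a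
      by (intro closed_Collect_le continuous_intros)
    ultimately show ?thesis by (auto intro: closed_INT)
  qed
  have Un: "(\<Union>n. C n) = B"
  proof -
    have "\<exists>n. x \<in> D n" if "x \<in> B" for x
    proof -
      have "x \<in> W" using that B(3) by blast
      then obtain e where e: "0 < e" "ball x e \<subseteq> W" by (rule openE[OF W(1)])
      obtain n where "1 / real (Suc n) < e" using nat_approx_posE[OF e(1)] .
      then have "ball x (1 / real (Suc n)) \<subseteq> W" using e(2) subset_ball[of "1 / real (Suc n)" e x] by auto
      then show ?thesis by (auto simp: D_def)
    qed
    then show ?thesis by (auto simp: C_def)
  qed
  have same: "tube A E r \<subseteq> tube A' E r"
    if A: "closed A" "A \<noteq> {}" and A': "closed A'" "A' \<noteq> {}" "ereal R < reach A'" and AW: "A \<inter> W = A' \<inter> W"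
      and E: "E \<subseteq> C n" and r: "r < R" "2 * r < 1 / real (Suc n)" for A A' E r n
  proof clarify
    fix x assume x: "infdist x A \<le> r" and a: "closest_point A x \<in> E"
    interpret unique_foot A' R by (rule unique_foot_reach[OF A'])
    have aW: "closest_point A x \<in> W" using a E B(3) by (auto simp: C_def)
    then have aA': "closest_point A x \<in> A'" using closest_point_infdist(1)[OF A, of x] AW by blast
    have da: "dist x (closest_point A x) = infdist x A" by (rule closest_point_infdist[OF A])
    then have le: "infdist x A' \<le> infdist x A" using infdist_le[OF aA', of x] by simp
    have "dist (closest_point A x) (foot x) \<le> dist x (closest_point A x) + dist x (foot x)"
      by (metis dist_commute dist_triangle)
    also have "\<dots> \<le> 2 * r" using da dist_foot[of x] le x by simp
    finally have "foot x \<in> ball (closest_point A x) (1 / real (Suc n))" using r by simp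
    moreover have "ball (closest_point A x) (1 / real (Suc n)) \<subseteq> W" using a E by (auto simp only: C_def D_def)
    ultimately have "foot x \<in> W" by blast
    then have "foot x \<in> A" using foot_in[of x] AW by blast
    then have "infdist x A \<le> infdist x A'" using infdist_le[of "foot x" A x] dist_foot by simp
    then have "foot x = closest_point A x"
      using le x r aA' da by (intro foot_unique) auto
    then show "infdist x A' \<le> r \<and> foot x \<in> E" using le x a by simp
  qed
  have "curvature_measure m A\<^sub>1 (\<Union>n. C n) = curvature_measure m A\<^sub>2 (\<Union>n. C n)"
  proof (rule signed_radon_cong_exhaust[OF signed_radon_curvature_measure[OF A1 m] signed_radon_curvature_measure[OF A2 m]])
    show "C n \<in> sets borel" for n unfolding C_def using B(1) D by auto
    show "incseq C"
    proof (rule incseq_SucI)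
      fix n
      have "1 / real (Suc (Suc n)) \<le> 1 / real (Suc n)" by (simp add: field_simps)
      then have "D n \<subseteq> D (Suc n)" unfolding D_def using subset_ball by blast
      then show "C n \<subseteq> C (Suc n)" by (auto simp: C_def)
    qed
    show "bounded (\<Union>n. C n)" unfolding Un by (rule B)
    fix n and E :: "'a set" assume E: "E \<in> sets borel" "E \<subseteq> C n"
    have bE: "bounded E" using E(2) B(2) by (auto simp: C_def intro: bounded_subset)
    define \<rho> where "\<rho> = min R (1 / real (Suc n) / 2)"
    show "curvature_measure m A\<^sub>1 E = curvature_measure m A\<^sub>2 E"
    proof (rule curvature_measure_eqI[OF A1 E(1) bE _ _ m])
      show "0 < \<rho>" using R by (simp add: \<rho>_def)
      fix r assume r: "0 < r" "r < \<rho>"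
      then have "r < R" "r < 1 / real (Suc n) / 2" by (simp_all only: \<rho>_def min_less_iff_conj)
      moreover have "2 * r < e" if "r < e / 2" for e using that by simp
      ultimately have r': "r < R" "2 * r < 1 / real (Suc n)" by blast+
      have "tube A\<^sub>1 E r = tube A\<^sub>2 E r"
        using same[OF A1(1,2) A2(1,2) R(3) W(2) E(2) r'] same[OF A2(1,2) A1(1,2) R(2) W(2)[symmetric] E(2) r']
        by (rule equalityI)
      moreover have "ereal r < reach A\<^sub>2" using r'(1) less_trans[OF _ R(3), of "ereal r"] by simp
      ultimately show "measure lebesgue (tube A\<^sub>1 E r) =
          steiner_poly DIM('a) (\<lambda>m. curvature_measure m A\<^sub>2 E) r"
        using steiner_system_curvature_measure[OF A2] E(1) bE r(1) unfolding steiner_system_def by simp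
    qed
  qed
  then show ?thesis by (simp add: Un)
qed

text \<open>The interpolation nodes are below 1/2, so \<epsilon> times a node stays below a reach of
  \<epsilon>/2. The factor \<open>unit_ball_vol (real d) * 3 ^ d\<close> is the volume of a ball of
  radius 3: tubes of radius below \<epsilon>/2 over a subset of a ball of radius 2 \<epsilon> lie in
  one of radius 3 \<epsilon>. Only d and m enter, which makes the bound uniform over sets and
  distances.\<close>

definition steiner_constant :: "nat \<Rightarrow> nat \<Rightarrow> real" where
  "steiner_constant d m =
    (\<Sum>i\<le>d. \<bar>coeff (lagrange_basis (\<lambda>i. real (Suc i) / real (2 * (d + 2))) d i) (d - m)\<bar>) *
    (unit_ball_vol (real d) * 3 ^ d) / unit_ball_vol (real (d - m))"

lemma steiner_constant_nonneg: "0 \<le> steiner_constant d m"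
  unfolding steiner_constant_def
  by (intro divide_nonneg_nonneg mult_nonneg_nonneg sum_nonneg) auto

text \<open>Interpolating the volumes of the tubes of radii \<open>\<epsilon> (i + 1) / (2 (d + 2))\<close> bounds the
  curvature measures by the volume of a ball.\<close>

lemma total_variation_curvature_le:
  fixes p :: "'a::euclidean_space"
  assumes A: "closed A" "A \<noteq> {}" and \<epsilon>: "0 < \<epsilon>" "ereal (\<epsilon> / 2) \<le> reach A"
    and B: "B \<in> sets borel" "B \<subseteq> cball p (2 * \<epsilon>)" and m: "m \<le> DIM('a)"
  shows "total_variation (curvature_measure m A) B \<le> ennreal (steiner_constant DIM('a) m * \<epsilon> ^ m)"
proof -
  let ?d = "DIM('a)"
  define t where "t i = real (Suc i) / real (2 * (?d + 2))" for i
  have t: "0 < t i" "t i < 1 / 2" if "i \<le> ?d" for i using that by (auto simp: t_def field_simps)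
  have inj: "inj_on t {..?d}" by (auto simp: inj_on_def t_def)
  define w where "w = unit_ball_vol (real (?d - m))"
  have w: "0 < w" unfolding w_def by (rule unit_ball_vol_pos) simp
  define \<kappa> where "\<kappa> i = \<bar>coeff (lagrange_basis t ?d i) (?d - m)\<bar>" for i
  define c where "c = steiner_constant ?d m"
  have c: "c = (\<Sum>i\<le>?d. \<kappa> i) * (unit_ball_vol (real ?d) * 3 ^ ?d) / w"
    unfolding c_def steiner_constant_def \<kappa>_def w_def t_def[abs_def] ..
  have reach: "0 < reach A" using \<epsilon> by (intro less_le_trans[OF _ \<epsilon>(2)]) simp
  define r where "r i = \<epsilon> * t i" for i
  have r: "0 < r i" "r i < \<epsilon> / 2" if "i \<le> ?d" for i
    using t[OF that] \<epsilon>(1) by (auto simp: r_def)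
  have rr: "ereal (r i) < reach A" if "i \<le> ?d" for i
    using r[OF that] by (intro less_le_trans[OF _ \<epsilon>(2)]) simp
  define V where "V i E = measure lebesgue (tube A E (r i))" for i E
  have meas: "tube A E (r i) \<in> lmeasurable"
    if iE: "i \<le> ?d" "E \<in> sets borel" "bounded E" for i E
  proof -
    obtain R where R: "ereal (r i) < ereal R" "ereal R < reach A"
      using ereal_dense2[OF rr[OF iE(1)]] by blast
    interpret unique_foot A R by (rule unique_foot_reach[OF A R(2)])
    show ?thesis using tube_lmeasurable[of "r i" E] iE R(1) by simp
  qed
  \<comment> \<open>The right-hand side is additive in E, so its sum over a partition of B is its
    value at B; this is what turns a bound on values into one on the total variation.\<close>
  have le: "\<epsilon> ^ (?d - m) * \<bar>curvature_measure m A E\<bar> \<le> (\<Sum>i\<le>?d. \<kappa> i * V i E) / w"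
    if E: "E \<in> sets borel" "bounded E" for E
  proof -
    \<comment> \<open>The Steiner polynomial with the radius measured in units of \<epsilon>, so
      that nodes and weights do not depend on \<epsilon>.\<close>
    define q where "q = (\<Sum>l\<le>?d. monom (\<epsilon> ^ (?d - l) * unit_ball_vol (real (?d - l)) * curvature_measure l A E) (?d - l))"
    have "degree q \<le> ?d"
      unfolding q_def by (intro degree_sum_le order_trans[OF degree_monom_le]) auto
    have "coeff q (?d - m) = (\<Sum>l\<le>?d. if l = m then \<epsilon> ^ (?d - l) * unit_ball_vol (real (?d - l)) * curvature_measure l A E else 0)"
      unfolding q_def coeff_sum using m by (intro sum.cong) (auto simp: coeff_monom)
    then have cq: "coeff q (?d - m) = \<epsilon> ^ (?d - m) * w * curvature_measure m A E"
      using m by (simp add: w_def)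
    have "poly q (t i) = V i E" if i: "i \<le> ?d" for i
    proof -
      have "V i E = (\<Sum>l\<le>?d. r i ^ (?d - l) * unit_ball_vol (real (?d - l)) * curvature_measure l A E)"
        using steiner_system_curvature_measure[OF A reach] E r[OF i] rr[OF i]
        unfolding steiner_system_def V_def by auto
      then show ?thesis
        by (simp add: q_def poly_sum poly_monom r_def power_mult_distrib mult_ac)
    qed
    then have "\<epsilon> ^ (?d - m) * w * curvature_measure m A E
        = (\<Sum>i\<le>?d. V i E * coeff (lagrange_basis t ?d i) (?d - m))"
      using coeff_lagrange_interpolation[OF inj \<open>degree q \<le> ?d\<close>, of "?d - m"] cq by simp
    then have "\<bar>\<epsilon> ^ (?d - m) * w * curvature_measure m A E\<bar>
        = \<bar>\<Sum>i\<le>?d. V i E * coeff (lagrange_basis t ?d i) (?d - m)\<bar>" by simp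
    also have "\<dots> \<le> (\<Sum>i\<le>?d. \<kappa> i * V i E)"
      by (rule order_trans[OF sum_abs]) (simp add: abs_mult \<kappa>_def V_def mult.commute)
    finally show ?thesis using w \<epsilon>(1) by (simp add: abs_mult field_simps)
  qed
  have vol: "V i B \<le> unit_ball_vol (real ?d) * 3 ^ ?d * \<epsilon> ^ ?d" if i: "i \<le> ?d" for i
  proof -
    have "tube A B (r i) \<subseteq> cball p (3 * \<epsilon>)"
    proof clarify
      fix x assume x: "infdist x A \<le> r i" "closest_point A x \<in> B"
      have "dist p x \<le> dist p (closest_point A x) + dist x (closest_point A x)"
        by (metis dist_commute dist_triangle)
      also have "\<dots> \<le> 2 * \<epsilon> + \<epsilon> / 2"
        using x B(2) closest_point_infdist(2)[OF A, of x] r[OF i] by (intro add_mono) auto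
      finally show "x \<in> cball p (3 * \<epsilon>)" using \<epsilon>(1) by simp
    qed
    then have "V i B \<le> measure lebesgue (cball p (3 * \<epsilon>))"
      unfolding V_def using meas[OF i B(1) bounded_subset[OF bounded_cball B(2)]]
      by (intro measure_mono_fmeasurable) (auto dest: fmeasurableD)
    also have "\<dots> = unit_ball_vol (real ?d) * (3 * \<epsilon>) ^ ?d"
      using content_cball[of "3 * \<epsilon>" p] \<epsilon>(1) by simp
    finally show ?thesis by (simp add: power_mult_distrib mult_ac)
  qed
  show ?thesis
    unfolding total_variation_def c_def[symmetric]
  proof (rule SUP_least)
    fix P assume "P \<in> {P. finite P \<and> partition_on B P \<and> P \<subseteq> sets borel}"
    then have fin: "finite P" and U: "\<Union>P = B" and dis: "disjoint P" and bor: "P \<subseteq> sets borel"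
      by (auto simp: partition_on_def)
    have bdd: "bounded E" if "E \<in> P" for E
      using that U B(2) by (intro bounded_subset[OF bounded_cball]) blast
    \<comment> \<open>Every point has one foot, so tubes over disjoint sets are disjoint.\<close>
    have add: "(\<Sum>E\<in>P. V i E) = V i B" if i: "i \<le> ?d" for i
    proof -
      have "tube A B (r i) = (\<Union>E\<in>P. tube A E (r i))" using U by auto
      moreover have "pairwise (\<lambda>E E'. disjnt (tube A E (r i))
          (tube A E' (r i))) P"
        using dis unfolding pairwise_def disjnt_def disjoint_def by blast
      ultimately show ?thesis
        unfolding V_def using fin bor bdd meas[OF i] by (simp only:) (subst measure_UNION'; auto)
    qed
    have "\<epsilon> ^ (?d - m) * (\<Sum>E\<in>P. \<bar>curvature_measure m A E\<bar>) \<le> (\<Sum>E\<in>P. (\<Sum>i\<le>?d. \<kappa> i * V i E) / w)"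
      unfolding sum_distrib_left using bor bdd by (intro sum_mono le) auto
    also have "\<dots> = (\<Sum>i\<le>?d. \<kappa> i * V i B) / w"
      unfolding sum_divide_distrib[symmetric]
      by (subst sum.swap) (simp add: sum_distrib_left[symmetric] add)
    also have "\<dots> \<le> (\<Sum>i\<le>?d. \<kappa> i * (unit_ball_vol (real ?d) * 3 ^ ?d * \<epsilon> ^ ?d)) / w"
      using w by (intro divide_right_mono sum_mono mult_left_mono vol) (auto simp: \<kappa>_def)
    also have "\<dots> = c * \<epsilon> ^ ?d"
      by (simp add: c sum_distrib_right[symmetric] field_simps)
    also have "\<dots> = \<epsilon> ^ (?d - m) * (c * \<epsilon> ^ m)"
      using m by (simp add: power_add[symmetric])
    finally have "(\<Sum>E\<in>P. \<bar>curvature_measure m A E\<bar>) \<le> c * \<epsilon> ^ m"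
      using \<epsilon>(1) by simp
    then show "(\<Sum>E\<in>P. ennreal \<bar>curvature_measure m A E\<bar>) \<le> ennreal (c * \<epsilon> ^ m)"
      by (simp add: sum_ennreal ennreal_leI)
  qed
qed

section \<open>Behaviour under similarities\<close>

locale similarity =
  fixes S :: "'a::euclidean_space \<Rightarrow> 'a" and \<rho> :: real
  assumes ratio_pos: "0 < \<rho>" and dist_S: "\<And>x y. dist (S x) (S y) = \<rho> * dist x y"
begin

lemma inj_S: "inj S"
  using dist_S ratio_pos by (metis dist_eq_0_iff injI mult_eq_0_iff less_irrefl)

text \<open>Rescaled and translated so as to fix the origin, a similarity becomes an isometry and
  hence linear.\<close>

lemma orthogonal_part:
  "\<exists>f. orthogonal_transformation f \<and> (\<forall>x. S x = \<rho> *\<^sub>R f x + S 0)"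
proof (intro exI conjI allI)
  define f where "f x = (S x - S 0) /\<^sub>R \<rho>" for x
  have "dist (f x) (f y) = dist x y" for x y
  proof -
    have "f x - f y = (S x - S y) /\<^sub>R \<rho>" by (simp add: f_def scaleR_diff_right)
    then show ?thesis using dist_S[of x y] ratio_pos by (simp add: dist_norm)
  qed
  then show "orthogonal_transformation f"
    unfolding orthogonal_transformation_isometry by (simp add: f_def)
  show "S x = \<rho> *\<^sub>R f x + S 0" for x using ratio_pos by (simp add: f_def)
qed

lemma surj_S: "surj S"
proof -
  obtain f where f: "orthogonal_transformation f" "\<And>x. S x = \<rho> *\<^sub>R f x + S 0"
    using orthogonal_part by blast
  have "\<exists>x. y = S x" for y
  proof -
    obtain x where "f x = (y - S 0) /\<^sub>R \<rho>" using orthogonal_transformation_surj[OF f(1)] by (metis surjD)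
    then have "y = S x" using ratio_pos f(2)[of x] by simp
    then show ?thesis ..
  qed
  then show ?thesis unfolding surj_def by (rule allI)
qed

lemma S_inv: "S (inv S y) = y" by (rule surj_f_inv_f[OF surj_S])

lemma inv_S: "inv S (S x) = x" by (rule inv_f_f[OF inj_S])

lemma image_eq_vimage: "S ` X = inv S -` X"
  using S_inv inv_S by (auto intro: rev_image_eqI simp: image_iff)

lemma mem_image_iff: "y \<in> S ` X \<longleftrightarrow> inv S y \<in> X"
  by (simp add: image_eq_vimage)

lemma continuous_on_S: "continuous_on X S"
  by (rule lipschitz_on_continuous_on[of \<rho>], rule lipschitz_onI) (use dist_S ratio_pos in auto)

lemma continuous_on_inv: "continuous_on X (inv S)"
proof (rule lipschitz_on_continuous_on[of "1 / \<rho>"], rule lipschitz_onI)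
  fix x y
  show "dist (inv S x) (inv S y) \<le> 1 / \<rho> * dist x y"
    using dist_S[of "inv S x" "inv S y"] ratio_pos by (simp add: S_inv)
qed (use ratio_pos in auto)

lemma closed_image: "closed X \<Longrightarrow> closed (S ` X)"
  unfolding image_eq_vimage by (rule continuous_closed_vimage) (use continuous_on_inv[of UNIV] in \<open>auto simp: continuous_on_eq_continuous_at\<close>)

lemma borel_image: "X \<in> sets borel \<Longrightarrow> S ` X \<in> sets borel"
  unfolding image_eq_vimage
  using measurable_sets[OF borel_measurable_continuous_onI[OF continuous_on_inv[of UNIV]], of X] by simp

lemma bounded_S_image: "bounded X \<Longrightarrow> bounded (S ` X)"
proof -
  assume "bounded X"
  then obtain b where "\<And>x. x \<in> X \<Longrightarrow> dist 0 x \<le> b" using bounded_any_center[of X 0] by blast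
  then have "\<And>y. y \<in> S ` X \<Longrightarrow> dist (S 0) y \<le> \<rho> * b"
    using ratio_pos by (auto simp: dist_S simp del: dist_0_norm)
  then show ?thesis unfolding bounded_def by blast
qed

lemma closure_image: "closure (S ` X) = S ` closure X"
proof
  show "closure (S ` X) \<subseteq> S ` closure X"
    by (intro closure_minimal image_mono closure_subset closed_image closed_closure)
  show "S ` closure X \<subseteq> closure (S ` X)"
    by (rule image_closure_subset[OF continuous_on_S closed_closure closure_subset])
qed

lemma infdist_image:
  assumes "X \<noteq> {}"
  shows "infdist (S x) (S ` X) = \<rho> * infdist x X"
proof (rule antisym)
  have "infdist (S x) (S ` X) / \<rho> \<le> infdist x X"
  proof (rule le_infdist[OF assms])
    fix a assume "a \<in> X"
    then have "infdist (S x) (S ` X) \<le> dist (S x) (S a)" by (intro infdist_le) simp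
    then show "infdist (S x) (S ` X) / \<rho> \<le> dist x a" using ratio_pos by (simp add: dist_S field_simps)
  qed
  then show "infdist (S x) (S ` X) \<le> \<rho> * infdist x X" using ratio_pos by (simp add: field_simps)
  show "\<rho> * infdist x X \<le> infdist (S x) (S ` X)"
    by (rule le_infdist) (use assms ratio_pos in \<open>auto simp: dist_S intro: infdist_le\<close>)
qed

lemma parallel_set_image: "X \<noteq> {} \<Longrightarrow> parallel_set (\<rho> * \<epsilon>) (S ` X) = S ` parallel_set \<epsilon> X"
proof -
  assume X: "X \<noteq> {}"
  have "S x \<in> parallel_set (\<rho> * \<epsilon>) (S ` X) \<longleftrightarrow> x \<in> parallel_set \<epsilon> X" for x
    using ratio_pos by (simp add: parallel_set_def infdist_image[OF X])
  note eq = this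
  show ?thesis
  proof (intro set_eqI iffI)
    fix y
    show "y \<in> S ` parallel_set \<epsilon> X" if "y \<in> parallel_set (\<rho> * \<epsilon>) (S ` X)"
      using that eq[of "inv S y"] by (simp add: S_inv mem_image_iff)
    show "y \<in> parallel_set (\<rho> * \<epsilon>) (S ` X)" if "y \<in> S ` parallel_set \<epsilon> X"
      using that eq[of "inv S y"] by (simp add: S_inv mem_image_iff)
  qed
qed

lemma closed_complement_image: "closed_complement (S ` X) = S ` closed_complement X"
proof -
  have "bij S" by (rule bijI[OF inj_S surj_S])
  then show ?thesis
    unfolding closed_complement_def by (simp only: bij_image_Compl_eq[symmetric] closure_image)
qed

lemma Unp_image:
  assumes "X \<noteq> {}" "x \<in> Unp X"
  shows "S x \<in> Unp (S ` X)"
proof -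
  have "\<exists>!a. a \<in> X \<and> dist x a = infdist x X"
    using assms(2) unfolding Unp_def by (rule CollectD)
  then obtain a where a: "a \<in> X \<and> dist x a = infdist x X"
    and uniq: "\<forall>b. b \<in> X \<and> dist x b = infdist x X \<longrightarrow> b = a"
    by (rule ex1E)
  show ?thesis
    unfolding Unp_def
  proof (intro CollectI ex1I[of _ "S a"] conjI)
    show "S a \<in> S ` X" "dist (S x) (S a) = infdist (S x) (S ` X)"
      using a by (simp_all add: dist_S infdist_image[OF assms(1)])
    show "b = S a" if "b \<in> S ` X \<and> dist (S x) b = infdist (S x) (S ` X)" for b
      using that uniq ratio_pos by (auto simp: dist_S infdist_image[OF assms(1)])
  qed
qed

lemma reach_image_pos:
  assumes X: "closed X" "X \<noteq> {}" and "0 < reach X"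
  shows "0 < reach (S ` X)"
proof -
  obtain R where R: "0 < R" "ereal R < reach X"
    using ereal_dense2[of 0 "reach X"] assms(3) by (auto simp: zero_ereal_def)
  interpret unique_foot X R by (rule unique_foot_reach[OF X R(2)])
  have "ereal (\<rho> * R) \<le> reach (S ` X)"
  proof (rule reach_ge)
    fix y assume y: "infdist y (S ` X) < \<rho> * R"
    have "infdist (inv S y) X < R"
      using y ratio_pos infdist_image[OF X(2), of "inv S y"] by (simp add: S_inv)
    then show "y \<in> Unp (S ` X)" using Unp_image[OF X(2) Unp] S_inv by metis
  qed
  moreover have "0 < ereal (\<rho> * R)" using R(1) ratio_pos by simp
  ultimately show ?thesis by (rule less_le_trans[rotated])
qed

lemma measure_image:
  assumes "E \<in> sets borel" "bounded E"
  shows "measure lebesgue (S ` E) = \<rho> ^ DIM('a) * measure lebesgue E"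
proof -
  obtain f where f: "orthogonal_transformation f" "\<And>x. S x = \<rho> *\<^sub>R f x + S 0"
    using orthogonal_part by blast
  have "S ` E = (\<lambda>x. \<rho> *\<^sub>R x + S 0) ` f ` E" by (simp add: image_image f(2)[symmetric])
  then have "measure lebesgue (S ` E) = \<rho> ^ DIM('a) * measure lebesgue (f ` E)"
    using ratio_pos by (simp add: measure_lebesgue_affine)
  then show ?thesis using measure_orthogonal_image_borel[OF f(1) assms] by simp
qed

text \<open>The tube of radius r about the image is the image of the tube of radius r / \<rho>, so
  the m-th term of its volume carries \<rho>^d (r / \<rho>)^(d - m) = \<rho>^m r^(d - m).\<close>

lemma curvature_measure_image:
  assumes X: "closed X" "X \<noteq> {}" "0 < reach X" and B: "B \<in> sets borel" "bounded B" and m: "m \<le> DIM('a)"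
  shows "curvature_measure m (S ` X) (S ` B) = \<rho> ^ m * curvature_measure m X B"
proof -
  let ?d = "DIM('a)"
  obtain R where R: "0 < R" "ereal R < reach X"
    using ereal_dense2[of 0 "reach X"] assms(3) by (auto simp: zero_ereal_def)
  have reach': "0 < reach (S ` X)" by (rule reach_image_pos[OF X])
  obtain R' where R': "0 < R'" "ereal R' < reach (S ` X)"
    using ereal_dense2[of 0 "reach (S ` X)"] reach' by (auto simp: zero_ereal_def)
  interpret unique_foot X R by (rule unique_foot_reach[OF X(1,2) R(2)])
  interpret S: unique_foot "S ` X" R'
    by (rule unique_foot_reach[OF closed_image[OF X(1)] _ R'(2)]) (use X in simp)
  show ?thesis
  proof (rule curvature_measure_eqI[OF closed_image[OF X(1)] _ reach' borel_image[OF B(1)] bounded_S_image[OF B(2)] _ _ m])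
    show "S ` X \<noteq> {}" using X by simp
    show "0 < min R' (\<rho> * R)" using R R' ratio_pos by simp
    fix r assume r: "0 < r" "r < min R' (\<rho> * R)"
    have foot': "S.foot (S x) = S (foot x)" if "infdist x X \<le> r / \<rho>" for x
    proof (rule S.foot_unique)
      show "infdist (S x) (S ` X) < R'"
        using that r ratio_pos by (simp add: infdist_image[OF X(2)] field_simps)
      show "S (foot x) \<in> S ` X" by (simp add: foot_in)
      show "dist (S x) (S (foot x)) \<le> infdist (S x) (S ` X)"
        by (simp add: infdist_image[OF X(2)] dist_S dist_foot)
    qed
    have "{y. infdist y (S ` X) \<le> r \<and> S.foot y \<in> S ` B} = S ` tube X B (r / \<rho>)"
    proof -
      have eq: "infdist (S x) (S ` X) \<le> r \<and> S.foot (S x) \<in> S ` B \<longleftrightarrow> x \<in> tube X B (r / \<rho>)" for x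
      proof -
        have "infdist (S x) (S ` X) \<le> r \<longleftrightarrow> infdist x X \<le> r / \<rho>"
          using ratio_pos by (simp add: infdist_image[OF X(2)] field_simps)
        then show ?thesis
          using foot'[of x] inj_image_mem_iff[OF inj_S, of "foot x" B]
          by (simp cong: conj_cong)
      qed
      show ?thesis
      proof (intro set_eqI iffI)
        fix y assume "y \<in> {y. infdist y (S ` X) \<le> r \<and> S.foot y \<in> S ` B}"
        then show "y \<in> S ` tube X B (r / \<rho>)" using eq[of "inv S y"] by (simp add: S_inv mem_image_iff)
      next
        fix y assume "y \<in> S ` tube X B (r / \<rho>)"
        then show "y \<in> {y. infdist y (S ` X) \<le> r \<and> S.foot y \<in> S ` B}"
          using eq[of "inv S y"] by (simp add: S_inv mem_image_iff)
      qed
    qed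
    moreover have rR: "r / \<rho> < R" using r ratio_pos by (simp add: field_simps)
    then have "measure lebesgue (S ` tube X B (r / \<rho>)) = \<rho> ^ ?d * measure lebesgue (tube X B (r / \<rho>))"
      by (intro measure_image tube_borel bounded_tube B)
    moreover have "measure lebesgue (tube X B (r / \<rho>))
        = (\<Sum>m\<le>?d. (r / \<rho>) ^ (?d - m) * unit_ball_vol (real (?d - m)) * curvature_measure m X B)"
    proof -
      have "ereal (r / \<rho>) < reach X" using rR less_trans[OF _ R(2), of "ereal (r / \<rho>)"] by simp
      then show ?thesis
        using steiner_system_curvature_measure[OF X] B r ratio_pos
        unfolding steiner_system_def by simp
    qed
    moreover have "\<rho> ^ ?d * (r / \<rho>) ^ (?d - m) = r ^ (?d - m) * \<rho> ^ m" if "m \<le> ?d" for m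
    proof -
      have "\<rho> ^ ?d = \<rho> ^ (?d - m) * \<rho> ^ m" using that by (simp flip: power_add)
      then show ?thesis using ratio_pos by (simp add: power_divide)
    qed
    ultimately show "measure lebesgue {y. infdist y (S ` X) \<le> r \<and> S.foot y \<in> S ` B}
        = steiner_poly ?d (\<lambda>m. \<rho> ^ m * curvature_measure m X B) r"
      by (simp add: sum_distrib_left mult.assoc[symmetric]) (simp add: mult_ac)
  qed
qed

lemma total_variation_image:
  assumes X: "closed X" "X \<noteq> {}" "0 < reach X" and B: "B \<in> sets borel" "bounded B" and m: "m \<le> DIM('a)"
  shows "total_variation (curvature_measure m (S ` X)) (S ` B)
    \<le> ennreal (\<rho> ^ m) * total_variation (curvature_measure m X) B"
  unfolding total_variation_def[of _ "S ` B"]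
proof (rule SUP_least)
  fix P assume "P \<in> {P. finite P \<and> partition_on (S ` B) P \<and> P \<subseteq> sets borel}"
  then have P: "finite P" "\<Union>P = S ` B" "disjoint P" "{} \<notin> P" "P \<subseteq> sets borel"
    by (auto simp: partition_on_def)
  define Q where "Q = (\<lambda>E. S -` E) ` P"
  have SV: "S ` (S -` E) = E" for E using surj_S by (rule surj_image_vimage_eq)
  have inj: "inj_on (\<lambda>E. S -` E) P" by (rule inj_onI) (metis SV)
  have Q: "finite Q" "partition_on B Q" "Q \<subseteq> sets borel"
  proof -
    show "finite Q" using P by (simp add: Q_def)
    show "Q \<subseteq> sets borel"
      using P(5) measurable_sets[OF borel_measurable_continuous_onI[OF continuous_on_S[of UNIV]]]
      unfolding Q_def by auto
    show "partition_on B Q"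
    proof (rule partition_onI)
      have "\<Union>Q = S -` (\<Union>P)" by (auto simp: Q_def)
      then show "\<Union>Q = B" using P(2) inj_S by (simp add: inj_vimage_image_eq)
      show "{} \<notin> Q" using P(4) SV unfolding Q_def by (metis image_empty imageE)
      show "disjnt X Y" if "X \<in> Q" "Y \<in> Q" "X \<noteq> Y" for X Y
        using that P(3) unfolding Q_def disjnt_def disjoint_def by blast
    qed
  qed
  have "(\<Sum>E\<in>P. ennreal \<bar>curvature_measure m (S ` X) E\<bar>) = (\<Sum>E\<in>P. ennreal (\<rho> ^ m) * ennreal \<bar>curvature_measure m X (S -` E)\<bar>)"
  proof (intro sum.cong refl)
    fix E assume "E \<in> P"
    then have E: "S -` E \<in> sets borel" "bounded (S -` E)"
      using Q B(2) partition_onD1[OF Q(2)] by (auto simp: Q_def intro: bounded_subset)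
    have "curvature_measure m (S ` X) E = \<rho> ^ m * curvature_measure m X (S -` E)"
      using curvature_measure_image[OF X E m] unfolding SV .
    then show "ennreal \<bar>curvature_measure m (S ` X) E\<bar> = ennreal (\<rho> ^ m) * ennreal \<bar>curvature_measure m X (S -` E)\<bar>"
      using ratio_pos by (simp add: abs_mult ennreal_mult')
  qed
  also have "\<dots> = ennreal (\<rho> ^ m) * (\<Sum>E\<in>Q. ennreal \<bar>curvature_measure m X E\<bar>)"
    unfolding Q_def by (simp add: sum_distrib_left sum.reindex[OF inj] del: sum_ennreal)
  also have "\<dots> \<le> ennreal (\<rho> ^ m) * total_variation (curvature_measure m X) B"
    unfolding total_variation_def using Q by (intro mult_left_mono SUP_upper) auto
  finally show "(\<Sum>E\<in>P. ennreal \<bar>curvature_measure m (S ` X) E\<bar>) \<le> \<dots>" .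
qed

end

section \<open>Self-similar sets and words\<close>

lemma AE_lebesgue_scale:
  fixes P :: "real \<Rightarrow> bool"
  assumes "AE x in lebesgue. P x" "c \<noteq> 0"
  shows "AE x in lebesgue. P (x * c)"
proof -
  have "(\<lambda>x. x * c) = (*\<^sub>R) c" by (simp add: fun_eq_iff)
  then have meas: "(\<lambda>x. x * c) \<in> lebesgue \<rightarrow>\<^sub>M lebesgue"
    by (simp only: lebesgue_measurable_scaling)
  have "(\<lambda>x. 0 + c * x) = (\<lambda>x. x * c)" by (simp add: fun_eq_iff)
  then have "lebesgue = density (distr lebesgue lebesgue (\<lambda>x. x * c)) (\<lambda>_. ennreal \<bar>c\<bar>)"
    using lebesgue_real_affine[OF assms(2), of 0] by (simp only:)
  then have "AE x in density (distr lebesgue lebesgue (\<lambda>x. x * c)) (\<lambda>_. ennreal \<bar>c\<bar>). P x"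
    using assms(1) by (simp only:)
  then have "AE x in distr lebesgue lebesgue (\<lambda>x. x * c). 0 < ennreal \<bar>c\<bar> \<longrightarrow> P x"
    by (rule AE_density[THEN iffD1, rotated]) simp
  then have "AE x in distr lebesgue lebesgue (\<lambda>x. x * c). P x"
    by (rule eventually_mono) (use assms(2) in simp)
  then show ?thesis by (rule AE_distrD[OF meas])
qed

lemma closed_complement_local:
  assumes "open W" "X \<inter> W = Y \<inter> W"
  shows "closed_complement X \<inter> W = closed_complement Y \<inter> W"
proof -
  have *: "closed_complement X \<inter> W \<subseteq> closed_complement Y" if "X \<inter> W = Y \<inter> W" for X Y
  proof -
    have "W \<inter> closure (- X) \<subseteq> closure (W \<inter> - X)" by (rule open_Int_closure_subset[OF assms(1)])
    also have "\<dots> \<subseteq> closure (- Y)" using that by (intro closure_mono) blast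
    finally show ?thesis unfolding closed_complement_def by blast
  qed
  show ?thesis using *[OF assms(2)] *[OF assms(2)[symmetric]] by blast
qed

lemma total_variation_local:
  fixes X Y :: "'a::euclidean_space set"
  assumes X: "bounded X" "0 < reach (closed_complement X)" and Y: "bounded Y" "0 < reach (closed_complement Y)"
    and W: "open W" "X \<inter> W = Y \<inter> W" and B: "B \<in> sets borel" "bounded B" "B \<subseteq> W" and m: "m \<le> DIM('a)"
  shows "total_variation (curvature_measure m (closed_complement X)) B
    \<le> total_variation (curvature_measure m (closed_complement Y)) B"
proof (rule total_variation_cong_le)
  fix E assume "E \<in> sets borel" "E \<subseteq> B"
  then have "curvature_measure m (closed_complement X) E = curvature_measure m (closed_complement Y) E"
    using B by (intro curvature_measure_local[OF closed_closed_complement closed_complement_nonempty[OF X(1)] X(2)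
          closed_closed_complement closed_complement_nonempty[OF Y(1)] Y(2) W(1) closed_complement_local[OF W] _ _ _ m])
      (auto intro: bounded_subset)
  then show "\<bar>curvature_measure m (closed_complement X) E\<bar> \<le> \<bar>curvature_measure m (closed_complement Y) E\<bar>"
    by simp
qed

lemma total_variation_parallel_curvature:
  "total_variation (parallel_curvature k K \<epsilon>) B
    = total_variation (curvature_measure k (closed_complement (parallel_set \<epsilon> K))) B"
  by (rule antisym; rule total_variation_cong_le) (simp_all add: parallel_curvature_def abs_mult power_abs)

lemma total_variation_interior:
  fixes X :: "'a::euclidean_space set"
  assumes X: "bounded X" "0 < reach (closed_complement X)" and "B \<subseteq> interior X" "m \<le> DIM('a)"
  shows "total_variation (curvature_measure m (closed_complement X)) B = 0"
proof (rule total_variation_eq_0)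
  fix E assume E: "E \<in> sets borel" "E \<subseteq> B"
  have "E \<subseteq> interior X" using E(2) assms(3) by blast
  then have "E \<inter> closed_complement X = {}" "bounded E"
    using closed_complement_Int_interior[of X] interior_subset[of X] X(1)
    by (blast, meson bounded_subset order_trans)
  then show "curvature_measure m (closed_complement X) E = 0"
    by (intro curvature_measure_outside[OF closed_closed_complement closed_complement_nonempty[OF X(1)] X(2) E(1)] assms(4))
qed

section \<open>Words, pieces and cut words\<close>

lemma word_map_simps [simp]:
  "word_map S [] = id" "word_map S (i # w) = S i \<circ> word_map S w"
  by (simp_all add: word_map_def)

lemma word_map_append: "word_map S (v @ w) = word_map S v \<circ> word_map S w"
  by (induction v) auto

lemma word_ratio_simps [simp]:
  "word_ratio r [] = 1" "word_ratio r (i # w) = r i * word_ratio r w"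
  by (simp_all add: word_ratio_def)

lemma word_ratio_append: "word_ratio r (v @ w) = word_ratio r v * word_ratio r w"
  by (induction v) auto

locale self_similar_system =
  fixes N :: nat and S :: "nat \<Rightarrow> 'a::euclidean_space \<Rightarrow> 'a" and r :: "nat \<Rightarrow> real" and F :: "'a set"
  assumes contracting: "contracting_similarities N S r" and self_similar: "self_similar_set N S F"
begin

abbreviation words :: "nat list set" where "words \<equiv> lists {1..N}"
abbreviation piece :: "nat list \<Rightarrow> 'a set" where "piece w \<equiv> word_map S w ` F"

lemma ratio: "i \<in> {1..N} \<Longrightarrow> 0 < r i" "i \<in> {1..N} \<Longrightarrow> r i < 1"
  using contracting unfolding contracting_similarities_def by blast+

lemma similarity_S: "i \<in> {1..N} \<Longrightarrow> similarity (S i) (r i)"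
  using contracting unfolding contracting_similarities_def by unfold_locales blast+

lemma F: "F \<noteq> {}" "compact F" "F = (\<Union>i\<in>{1..N}. S i ` F)"
  using self_similar unfolding self_similar_set_def hutchinson_def by auto

lemma word_ratio_pos: "w \<in> words \<Longrightarrow> 0 < word_ratio r w"
  by (induction w) (auto simp: ratio)

lemma similarity_word: "w \<in> words \<Longrightarrow> similarity (word_map S w) (word_ratio r w)"
proof (induction w)
  case Nil
  then show ?case by unfold_locales auto
next
  case (Cons i w)
  then have "similarity (S i) (r i)" "similarity (word_map S w) (word_ratio r w)"
    using similarity_S by auto
  then show ?case unfolding similarity_def by (simp add: mult.assoc)
qed

lemma max_ratio:
  obtains q where "0 < q" "q < 1" "\<And>i. i \<in> {1..N} \<Longrightarrow> r i \<le> q"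
proof
  have "{1..N} \<noteq> {}" using F(1,3) by blast
  then have fin: "finite (r ` {1..N})" "r ` {1..N} \<noteq> {}" by auto
  show "0 < Max (r ` {1..N})" "Max (r ` {1..N}) < 1"
    using Max_in[OF fin] ratio by auto
  show "r i \<le> Max (r ` {1..N})" if "i \<in> {1..N}" for i
    using that fin(1) by (intro Max_ge) auto
qed

lemma word_ratio_le_power:
  assumes "\<And>i. i \<in> {1..N} \<Longrightarrow> r i \<le> q" "w \<in> words"
  shows "word_ratio r w \<le> q ^ length w"
  using assms(2)
proof (induction w)
  case (Cons i w)
  then have "0 \<le> q" using assms(1)[of i] ratio(1)[of i] by simp
  then show ?case
    using Cons assms(1)[of i] ratio(1)[of i] word_ratio_pos[of w]
    by (auto intro!: mult_mono simp: less_imp_le)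
qed simp

lemma piece: "w \<in> words \<Longrightarrow> compact (piece w)" "w \<in> words \<Longrightarrow> piece w \<noteq> {}"
  using F(1,2) similarity.continuous_on_S[OF similarity_word]
  by (auto intro: compact_continuous_image)

lemma piece_subset: "w \<in> words \<Longrightarrow> piece w \<subseteq> F"
proof (induction w)
  case (Cons i w)
  then have "S i ` piece w \<subseteq> S i ` F" by (intro image_mono) auto
  also have "\<dots> \<subseteq> F" using Cons.prems by (subst (2) F(3)) auto
  finally show ?case by (simp add: image_comp)
qed simp

lemma piece_append: "piece (v @ w) = word_map S v ` piece w"
  by (simp add: word_map_append image_comp)

lemma piece_append_subset: "w \<in> words \<Longrightarrow> piece (v @ w) \<subseteq> piece v"
  unfolding piece_append by (intro image_mono piece_subset)

lemma diameter_piece: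
  assumes "w \<in> words"
  shows "diameter (piece w) \<le> word_ratio r w * diameter F"
proof (rule diameter_le)
  fix x y assume "x \<in> piece w" "y \<in> piece w"
  then obtain a b where "a \<in> F" "b \<in> F" "x = word_map S w a" "y = word_map S w b" by blast
  then show "norm (x - y) \<le> word_ratio r w * diameter F"
    using diameter_bounded_bound[OF compact_imp_bounded[OF F(2)], of a b] word_ratio_pos[OF assms]
      similarity.dist_S[OF similarity_word[OF assms], of a b]
    by (simp flip: dist_norm)
qed (use piece[OF assms] in auto)

lemma cut_wordsD:
  assumes "w \<in> cut_words N r R \<epsilon>"
  shows "w \<in> words" "w \<noteq> []" "R * word_ratio r w < \<epsilon>" "\<epsilon> \<le> R * word_ratio r (butlast w)"
  using assms by (auto simp: cut_words_def)

lemma bounded_extensions: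
  assumes "0 < b"
  obtains L where "\<And>v. v \<in> words \<Longrightarrow> b \<le> word_ratio r (butlast v) \<Longrightarrow> length v \<le> L"
proof -
  obtain q where q: "0 < q" "q < 1" "\<And>i. i \<in> {1..N} \<Longrightarrow> r i \<le> q" using max_ratio by blast
  obtain L where L: "q ^ L < b" using real_arch_pow_inv[OF assms q(2)] by blast
  show ?thesis
  proof (rule that[of L])
    fix v assume v: "v \<in> words" "b \<le> word_ratio r (butlast v)"
    show "length v \<le> L"
    proof (rule ccontr)
      assume "\<not> length v \<le> L"
      then have "L \<le> length (butlast v)" by simp
      have "butlast v \<in> words" using v(1) by (auto dest: in_set_butlastD)
      then have "word_ratio r (butlast v) \<le> q ^ length (butlast v)" using q(3) by (intro word_ratio_le_power)
      also have "\<dots> \<le> q ^ L" using \<open>L \<le> _\<close> q by (intro power_decreasing) auto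
      finally show False using L v(2) by simp
    qed
  qed
qed

lemma finite_words_length_le: "finite {v \<in> words. length v \<le> L}"
proof -
  have "{v \<in> words. length v \<le> L} = {v. set v \<subseteq> {1..N} \<and> length v \<le> L}"
    by (simp only: lists_eq_set mem_Collect_eq)
  then show ?thesis by (simp only: finite_lists_length_le finite_atLeastAtMost)
qed

lemma finite_cut_words:
  assumes "0 < R" "0 < \<epsilon>"
  shows "finite (cut_words N r R \<epsilon>)"
proof -
  obtain L where L: "\<And>v. v \<in> words \<Longrightarrow> \<epsilon> / R \<le> word_ratio r (butlast v) \<Longrightarrow> length v \<le> L"
    using bounded_extensions[of "\<epsilon> / R"] assms by auto
  have "cut_words N r R \<epsilon> \<subseteq> {v \<in> words. length v \<le> L}"
  proof (intro subsetI CollectI conjI)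
    fix v assume "v \<in> cut_words N r R \<epsilon>"
    note v = cut_wordsD[OF this]
    show "v \<in> words" by (rule v(1))
    have "\<epsilon> / R \<le> word_ratio r (butlast v)" using v(4) assms(1) by (simp add: field_simps)
    then show "length v \<le> L" by (rule L[OF v(1)])
  qed
  then show ?thesis by (rule finite_subset) (rule finite_words_length_le)
qed

lemma piece_extensions:
  assumes "0 < R" "0 < \<epsilon>" "w \<in> words" "\<epsilon> \<le> R * word_ratio r w" "x \<in> piece w"
  obtains v where "w @ v \<in> cut_words N r R \<epsilon>" "x \<in> piece (w @ v)"
proof -
  obtain q where q: "0 < q" "q < 1" "\<And>i. i \<in> {1..N} \<Longrightarrow> r i \<le> q" using max_ratio by blast
  \<comment> \<open>Letters of an address of x are appended until the ratio drops below \<epsilon> /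
    R. The number n bounds how many are needed; at n = 0 the assumptions contradict each
    other.\<close>
  have "\<exists>v. w @ v \<in> cut_words N r R \<epsilon> \<and> x \<in> piece (w @ v)"
    if "R * word_ratio r w * q ^ n < \<epsilon>" "w \<in> words" "\<epsilon> \<le> R * word_ratio r w" "x \<in> piece w" for n w
    using that
  proof (induction n arbitrary: w)
    case (Suc n)
    obtain y where y: "y \<in> F" "x = word_map S w y" using Suc.prems by blast
    then obtain i where i: "i \<in> {1..N}" "y \<in> S i ` F" using F(3) by blast
    have w': "w @ [i] \<in> words" using Suc.prems i by simp
    have x: "x \<in> piece (w @ [i])" using y i by (auto simp: word_map_append)
    have rw: "word_ratio r (w @ [i]) = word_ratio r w * r i" by (simp add: word_ratio_append)
    show ?case
    proof (cases "R * word_ratio r (w @ [i]) < \<epsilon>")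
      case True
      then show ?thesis
        using w' x Suc.prems by (intro exI[of _ "[i]"]) (simp add: cut_words_def)
    next
      case False
      have "R * word_ratio r (w @ [i]) * q ^ n = (R * word_ratio r w * q ^ n) * r i" by (simp add: rw)
      also have "\<dots> \<le> (R * word_ratio r w * q ^ n) * q"
        using q i assms(1) word_ratio_pos[OF Suc.prems(2)] by (intro mult_left_mono) auto
      also have "\<dots> < \<epsilon>" using Suc.prems(1) by (simp add: mult_ac)
      finally obtain v where "(w @ [i]) @ v \<in> cut_words N r R \<epsilon> \<and> x \<in> piece ((w @ [i]) @ v)"
        using Suc.IH[OF _ w' _ x] False by auto
      then show ?thesis by (intro exI[of _ "i # v"]) simp
    qed
  qed simp
  moreover obtain n where "q ^ n < \<epsilon> / (R * word_ratio r w)"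
    using real_arch_pow_inv[OF _ q(2)] assms word_ratio_pos[OF assms(3)] by (metis divide_pos_pos mult_pos_pos)
  then have "R * word_ratio r w * q ^ n < \<epsilon>"
    using assms word_ratio_pos[OF assms(3)] by (simp add: field_simps)
  ultimately show ?thesis using assms that by blast
qed

lemma cut_words_cover:
  assumes "0 < R" "0 < \<epsilon>" "\<epsilon> \<le> R"
  shows "F = (\<Union>w\<in>cut_words N r R \<epsilon>. piece w)"
proof (intro equalityI subsetI)
  fix x assume "x \<in> F"
  then obtain v where "[] @ v \<in> cut_words N r R \<epsilon>" "x \<in> piece ([] @ v)"
    using piece_extensions[OF assms(1,2), of "[]" x] assms(3) by auto
  then show "x \<in> (\<Union>w\<in>cut_words N r R \<epsilon>. piece w)" by auto
qed (use piece_subset cut_wordsD(1) in blast)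

text \<open>The shortest prefix whose ratio is below \<epsilon> / R; the condition \<epsilon> \<le>
  R keeps it nonempty.\<close>

lemma cut_prefix:
  assumes "\<epsilon> \<le> R" "w \<in> words" "R * word_ratio r w < \<epsilon>"
  shows "\<exists>u v. w = u @ v \<and> u \<in> cut_words N r R \<epsilon>"
  using assms(2,3)
proof (induction w rule: rev_induct)
  case (snoc i w)
  show ?case
  proof (cases "\<epsilon> \<le> R * word_ratio r w")
    case True
    then show ?thesis using snoc.prems
      by (intro exI[of _ "w @ [i]"] exI[of _ "[]"]) (simp add: cut_words_def)
  next
    case False
    then obtain u v where "w = u @ v" "u \<in> cut_words N r R \<epsilon>" using snoc by auto
    then show ?thesis by (intro exI[of _ u] exI[of _ "v @ [i]"]) simp
  qed
qed (use assms(1) in simp)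

text \<open>A word cut with respect to \<open>R2\<close> either has a prefix cut with respect to \<open>R1\<close>, or its
  extensions cut with respect to \<open>R1\<close> are longer by a bounded number of letters only.\<close>

lemma cut_words_compare:
  assumes "0 < R1" "0 < R2"
  obtains M :: nat where "\<And>\<epsilon> w. 0 < \<epsilon> \<Longrightarrow> \<epsilon> \<le> R1 \<Longrightarrow> w \<in> cut_words N r R2 \<epsilon> \<Longrightarrow>
    \<exists>T \<subseteq> cut_words N r R1 \<epsilon>. finite T \<and> card T \<le> M \<and> piece w \<subseteq> (\<Union>u\<in>T. piece u)"
proof -
  \<comment> \<open>If w @ v is cut for R1 with v nonempty, then \<epsilon> \<le> R1 times the
    ratios of w and \<open>butlast v\<close>, while R2 times the ratio of w is below \<epsilon>.
    Hence \<open>butlast v\<close> has ratio at least R2 / R1, whatever \<epsilon> is.\<close>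
  obtain L where L: "\<And>v. v \<in> words \<Longrightarrow> R2 / R1 \<le> word_ratio r (butlast v) \<Longrightarrow> length v \<le> L"
    using bounded_extensions[of "R2 / R1"] assms by auto
  define E where "E = {v \<in> words. length v \<le> L}"
  have E: "finite E" unfolding E_def by (rule finite_words_length_le)
  show ?thesis
  \<comment> \<open>The prefix case uses one word, the extension case at most
    \<open>card E\<close>.\<close>
  proof (rule that[of "max 1 (card E)"])
    fix \<epsilon> w assume \<epsilon>: "0 < \<epsilon>" "\<epsilon> \<le> R1" and w: "w \<in> cut_words N r R2 \<epsilon>"
    note w = cut_wordsD[OF w]
    show "\<exists>T \<subseteq> cut_words N r R1 \<epsilon>. finite T \<and> card T \<le> max 1 (card E) \<and> piece w \<subseteq> (\<Union>u\<in>T. piece u)"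
    proof (cases "R1 * word_ratio r w < \<epsilon>")
      case True
      then obtain u v where uv: "w = u @ v" "u \<in> cut_words N r R1 \<epsilon>"
        using cut_prefix[OF \<epsilon>(2) w(1)] by blast
      then have "piece w \<subseteq> piece u" using w(1) piece_append_subset[of v u] by simp
      then show ?thesis using uv(2) by (intro exI[of _ "{u}"]) auto
    next
      case False
      define T where "T = cut_words N r R1 \<epsilon> \<inter> (\<lambda>v. w @ v) ` E"
      have "piece w \<subseteq> (\<Union>u\<in>T. piece u)"
      proof
        fix x assume "x \<in> piece w"
        then obtain v where v: "w @ v \<in> cut_words N r R1 \<epsilon>" "x \<in> piece (w @ v)"
          using piece_extensions[OF assms(1) \<epsilon>(1) w(1)] False by (metis not_less)
        note wv = cut_wordsD[OF v(1)]
        have "v \<noteq> []" using wv(3) False by auto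
        have vw: "v \<in> words" using wv(1) by simp
        then have bv: "butlast v \<in> words" by (auto dest: in_set_butlastD)
        have "\<epsilon> \<le> R1 * (word_ratio r w * word_ratio r (butlast v))"
          using wv(4) \<open>v \<noteq> []\<close> by (simp add: butlast_append word_ratio_append)
        then have "R2 * \<epsilon> \<le> R2 * (R1 * (word_ratio r w * word_ratio r (butlast v)))"
          using assms(2) by (intro mult_left_mono) auto
        also have "\<dots> = (R2 * word_ratio r w) * (R1 * word_ratio r (butlast v))" by (simp add: mult_ac)
        also have "\<dots> \<le> \<epsilon> * (R1 * word_ratio r (butlast v))"
          using w(3) assms(1) word_ratio_pos[OF bv] by (intro mult_right_mono) auto
        finally have "R2 \<le> R1 * word_ratio r (butlast v)" using \<epsilon>(1) by (simp add: mult.commute)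
        then have "length v \<le> L" using assms(1) by (intro L vw) (simp add: field_simps)
        then have "w @ v \<in> T" using v(1) vw by (simp add: T_def E_def)
        then show "x \<in> (\<Union>u\<in>T. piece u)" using v(2) by blast
      qed
      moreover have "finite T" unfolding T_def using E by simp
      moreover have "card T \<le> card E"
        unfolding T_def using card_mono[OF finite_imageI[OF E], of _ "\<lambda>v. w @ v"] card_image_le[OF E, of "\<lambda>v. w @ v"]
        by (meson Int_lower2 order_trans)
      ultimately show ?thesis by (intro exI[of _ T]) (auto simp: T_def)
    qed
  qed
qed

end

section \<open>Independence of the constant\<close>

text \<open>The condition on \<epsilon> has two effects: the reach is at least \<epsilon>/2, and the
  parallel set lies in one ball of radius 2 \<epsilon>. Tube volumes then bound the curvature
  without recourse to CBC.\<close>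

lemma total_variation_large:
  fixes K :: "'a::euclidean_space set"
  assumes k: "k \<le> DIM('a)" and K: "compact K" "K \<noteq> {}" and \<epsilon>: "0 < \<epsilon>" "sqrt 2 * diameter K \<le> \<epsilon>"
    and B: "B \<in> sets borel" "B \<subseteq> parallel_set \<epsilon> K"
  shows "total_variation (curvature_measure k (closed_complement (parallel_set \<epsilon> K))) B
    \<le> ennreal (steiner_constant DIM('a) k * \<epsilon> ^ k)"
proof -
  obtain p where p: "p \<in> K" using K(2) by blast
  have "0 \<le> diameter K" by (rule diameter_ge_0[OF compact_imp_bounded[OF K(1)]])
  then have "1 * diameter K \<le> sqrt 2 * diameter K" by (intro mult_right_mono) auto
  then have "cball p (\<epsilon> + diameter K) \<subseteq> cball p (2 * \<epsilon>)" using \<epsilon>(2) by (intro subset_cball) simp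
  then have "B \<subseteq> cball p (2 * \<epsilon>)" using B(2) parallel_set_subset_cball[OF K(1) p] by blast
  then show ?thesis
    by (intro total_variation_curvature_le[OF closed_closed_complement closed_complement_nonempty[OF bounded_parallel_set[OF K]]
          \<epsilon>(1) reach_closed_complement_parallel[OF K \<epsilon>] B(1) _ k])
qed

text \<open>Otherwise the midpoint of a shortest connection between \<open>K\<close> and
  \<open>V\<close> would lie in both parallel sets.\<close>

lemma parallel_sets_apart:
  fixes K V :: "'a::euclidean_space set"
  assumes K: "compact K" "K \<noteq> {}" and V: "closed V" "V \<noteq> {}" and "0 \<le> \<epsilon>"
    and disj: "parallel_set \<epsilon> K \<inter> parallel_set \<epsilon> V = {}"
  shows "2 * \<epsilon> < setdist K V"
proof (rule ccontr)
  assume "\<not> ?thesis"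
  moreover obtain p q where pq: "p \<in> K" "q \<in> V" "dist p q = setdist K V"
    using setdist_compact_closed[OF K(1) V(1) K(2) V(2)] by blast
  ultimately have "dist p q / 2 \<le> \<epsilon>" by simp
  then have "dist (midpoint p q) p \<le> \<epsilon>" "dist (midpoint p q) q \<le> \<epsilon>"
    by (simp_all add: dist_midpoint)
  then have "midpoint p q \<in> parallel_set \<epsilon> K \<inter> parallel_set \<epsilon> V"
    using pq(1,2) by (auto simp: parallel_set_def intro: infdist_le2)
  then show False using disj by blast
qed

section \<open>The bound on boundary parts\<close>

context self_similar_system
begin

abbreviation TV :: "nat \<Rightarrow> real \<Rightarrow> 'a set \<Rightarrow> ennreal" where
  "TV k \<epsilon> \<equiv> total_variation (curvature_measure k (closed_complement (parallel_set \<epsilon> F)))"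

abbreviation overlap :: "real \<Rightarrow> real \<Rightarrow> nat list \<Rightarrow> 'a set" where
  "overlap R \<epsilon> \<sigma> \<equiv> frontier (parallel_set \<epsilon> (piece \<sigma>)) \<inter>
    frontier (\<Union>\<sigma>'\<in>cut_words N r R \<epsilon> - {\<sigma>}. parallel_set \<epsilon> (piece \<sigma>'))"

abbreviation boundary_part :: "real \<Rightarrow> nat list \<Rightarrow> 'a set" where
  "boundary_part \<epsilon> \<sigma> \<equiv> frontier (parallel_set \<epsilon> F) \<inter> parallel_set \<epsilon> (piece \<sigma>)"

definition piece_bound :: "nat \<Rightarrow> real \<Rightarrow> bool" where
  "piece_bound k R \<longleftrightarrow> (\<exists>c\<ge>0. AE \<epsilon> in lebesgue. 0 < \<epsilon> \<and> \<epsilon> < R \<longrightarrow>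
    (\<forall>\<sigma>\<in>cut_words N r R \<epsilon>. TV k \<epsilon> (boundary_part \<epsilon> \<sigma>) \<le> ennreal (c * \<epsilon> ^ k)))"

lemma diameter_F: "0 \<le> diameter F"
  by (rule diameter_ge_0[OF compact_imp_bounded[OF F(2)]])

lemma parallel_piece_subset: "w \<in> words \<Longrightarrow> parallel_set \<epsilon> (piece w) \<subseteq> parallel_set \<epsilon> F"
  by (rule parallel_set_mono[OF piece_subset piece(2)])

lemmas bounded_parallel_F = bounded_parallel_set[OF F(2,1)]

lemma reach_parallel_AE:
  assumes "RC F"
  shows "AE \<epsilon> in lebesgue. 0 < \<epsilon> \<longrightarrow> 0 < reach (closed_complement (parallel_set \<epsilon> F))"
  using assms unfolding RC_def
proof eventually_elim
  case (elim \<epsilon>)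
  show ?case
  proof
    assume "0 < \<epsilon>"
    show "0 < reach (closed_complement (parallel_set \<epsilon> F))"
    proof (cases "\<epsilon> < sqrt 2 * diameter F")
      case True
      then show ?thesis using elim \<open>0 < \<epsilon>\<close> unfolding regular_distance_def by blast
    next
      case False
      then have "ereal (\<epsilon> / 2) \<le> reach (closed_complement (parallel_set \<epsilon> F))"
        using \<open>0 < \<epsilon>\<close> by (intro reach_closed_complement_parallel F) auto
      moreover have "0 < ereal (\<epsilon> / 2)" using \<open>0 < \<epsilon>\<close> by simp
      ultimately show ?thesis by (rule less_le_trans[rotated])
    qed
  qed
qed

text \<open>There are countably many words, and scaling preserves null sets.\<close>

lemma AE_all_scales:
  assumes "AE \<epsilon> in lebesgue. P \<epsilon>"
  shows "AE \<epsilon> in lebesgue. \<forall>w\<in>words. P (\<epsilon> / word_ratio r w)"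
proof (rule AE_ball_countable'[OF _ countableI_type])
  fix w assume "w \<in> words"
  then have "1 / word_ratio r w \<noteq> 0" using word_ratio_pos[of w] by simp
  from AE_lebesgue_scale[OF assms this] show "AE \<epsilon> in lebesgue. P (\<epsilon> / word_ratio r w)" by simp
qed

lemma piece_bound_change:
  assumes k: "k \<le> DIM('a)" and "RC F"
    and R: "sqrt 2 * diameter F < R1" "sqrt 2 * diameter F < R2"
    and bound: "piece_bound k R1"
  shows "piece_bound k R2"
proof -
  have D: "0 \<le> sqrt 2 * diameter F" using diameter_F by simp
  then have pos: "0 < R1" "0 < R2" using R by simp_all
  obtain c1 where c1: "0 \<le> c1" and AE1: "AE \<epsilon> in lebesgue. 0 < \<epsilon> \<and> \<epsilon> < R1 \<longrightarrow>
    (\<forall>\<sigma>\<in>cut_words N r R1 \<epsilon>. TV k \<epsilon> (boundary_part \<epsilon> \<sigma>) \<le> ennreal (c1 * \<epsilon> ^ k))"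
    using bound unfolding piece_bound_def by blast
  define c2 where "c2 = steiner_constant DIM('a) k"
  have c2: "0 \<le> c2" unfolding c2_def by (rule steiner_constant_nonneg)
  note large = total_variation_large[OF k, folded c2_def]
  obtain M where M: "\<And>\<epsilon> w. 0 < \<epsilon> \<Longrightarrow> \<epsilon> \<le> R1 \<Longrightarrow> w \<in> cut_words N r R2 \<epsilon> \<Longrightarrow>
    \<exists>T \<subseteq> cut_words N r R1 \<epsilon>. finite T \<and> card T \<le> M \<and> piece w \<subseteq> (\<Union>u\<in>T. piece u)"
    using cut_words_compare[OF pos] by blast
  \<comment> \<open>M * c1 serves \<epsilon> < R1, where a piece is covered by at most M pieces cut
    for R1; c2 serves R1 \<le> \<epsilon> < R2, where \<epsilon> exceeds sqrt 2 * diam F and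
    \<open>total_variation_large\<close> applies to F itself.\<close>
  define c where "c = real M * c1 + c2"
  have "0 \<le> c" using c1 c2 by (simp add: c_def)
  moreover have "AE \<epsilon> in lebesgue. 0 < \<epsilon> \<and> \<epsilon> < R2 \<longrightarrow>
    (\<forall>\<sigma>\<in>cut_words N r R2 \<epsilon>. TV k \<epsilon> (boundary_part \<epsilon> \<sigma>) \<le> ennreal (c * \<epsilon> ^ k))"
    using AE1 reach_parallel_AE[OF \<open>RC F\<close>]
  proof eventually_elim
    case (elim \<epsilon>)
    show ?case
    proof (intro impI ballI)
      assume \<epsilon>: "0 < \<epsilon> \<and> \<epsilon> < R2"
      fix \<sigma> assume \<sigma>: "\<sigma> \<in> cut_words N r R2 \<epsilon>"
      let ?Fr = "frontier (parallel_set \<epsilon> F)"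
      let ?B = "\<lambda>w. ?Fr \<inter> parallel_set \<epsilon> (piece w)"
      have B: "?B w \<in> sets borel" "bounded (?B w)" "?B w \<subseteq> parallel_set \<epsilon> F" if "w \<in> words" for w
        using parallel_piece_subset[OF that, of \<epsilon>] bounded_subset[OF bounded_parallel_F]
        by (auto intro!: borel_closed closed_Int frontier_closed closed_parallel_set)
      note sw = cut_wordsD(1)[OF \<sigma>]
      show "TV k \<epsilon> (?B \<sigma>) \<le> ennreal (c * \<epsilon> ^ k)"
      proof (cases "\<epsilon> < R1")
        case True
        obtain T where T: "T \<subseteq> cut_words N r R1 \<epsilon>" "finite T" "card T \<le> M" "piece \<sigma> \<subseteq> (\<Union>u\<in>T. piece u)"
          using M[OF _ _ \<sigma>] \<epsilon> True by auto
        have Tw: "u \<in> words" if "u \<in> T" for u using T(1) that cut_wordsD(1) by blast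
        have "parallel_set \<epsilon> (piece \<sigma>) \<subseteq> (\<Union>u\<in>T. parallel_set \<epsilon> (piece u))"
        proof
          fix x assume "x \<in> parallel_set \<epsilon> (piece \<sigma>)"
          then obtain p where p: "p \<in> piece \<sigma>" "dist x p \<le> \<epsilon>"
            using parallel_set_iff[OF piece[OF sw]] by blast
          then obtain u where "u \<in> T" "p \<in> piece u" using T(4) by blast
          then show "x \<in> (\<Union>u\<in>T. parallel_set \<epsilon> (piece u))"
            using p(2) by (auto simp: parallel_set_def intro: infdist_le2)
        qed
        then have "?B \<sigma> \<subseteq> (\<Union>u\<in>T. ?B u)" by blast
        then have "TV k \<epsilon> (?B \<sigma>) \<le> TV k \<epsilon> (\<Union>u\<in>T. ?B u)"
          using B(1)[OF sw] B(1)[OF Tw] T(2) by (intro total_variation_mono sets.finite_UN)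
        also have "\<dots> \<le> (\<Sum>u\<in>T. TV k \<epsilon> (?B u))"
          using elim(2) \<epsilon> B[OF Tw] T(2)
          by (intro total_variation_UN signed_radon_curvature_measure[OF closed_closed_complement
                closed_complement_nonempty[OF bounded_parallel_F] _ k]) auto
        also have "\<dots> \<le> (\<Sum>u\<in>T. ennreal (c1 * \<epsilon> ^ k))"
          using elim(1) \<epsilon> True T(1) by (intro sum_mono) auto
        also have "\<dots> = ennreal (real (card T) * (c1 * \<epsilon> ^ k))"
          using c1 \<epsilon> by (simp add: ennreal_mult ennreal_of_nat_eq_real_of_nat)
        also have "\<dots> \<le> ennreal (c * \<epsilon> ^ k)"
        proof (rule ennreal_leI)
          have "real (card T) * (c1 * \<epsilon> ^ k) \<le> real M * (c1 * \<epsilon> ^ k)"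
            using T(3) c1 \<epsilon> by (intro mult_right_mono) auto
          also have "\<dots> \<le> real M * (c1 * \<epsilon> ^ k) + c2 * \<epsilon> ^ k" using c2 \<epsilon> by simp
          finally show "real (card T) * (c1 * \<epsilon> ^ k) \<le> c * \<epsilon> ^ k" by (simp add: c_def algebra_simps)
        qed
        finally show ?thesis .
      next
        case False
        have "TV k \<epsilon> (?B \<sigma>) \<le> ennreal (c2 * \<epsilon> ^ k)"
          using \<epsilon> False R(1) B[OF sw] by (intro large F) auto
        also have "\<dots> \<le> ennreal (c * \<epsilon> ^ k)"
          using c1 \<epsilon> by (intro ennreal_leI mult_right_mono) (auto simp: c_def)
        finally show ?thesis .
      qed
    qed
  qed
  ultimately show ?thesis unfolding piece_bound_def by blast
qed

text \<open>An overlap may run through the interior of F_\<epsilon>, where the curvature measure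
  vanishes; the rest of it lies in the boundary part of the same word.\<close>

lemma piece_bound_imp_CBC:
  assumes k: "k \<le> DIM('a)" and "RC F" and bound: "piece_bound k R"
  shows "CBC k N S r F U R"
proof -
  obtain c where c: "0 \<le> c" and AEc: "AE \<epsilon> in lebesgue. 0 < \<epsilon> \<and> \<epsilon> < R \<longrightarrow>
    (\<forall>\<sigma>\<in>cut_words N r R \<epsilon>. TV k \<epsilon> (boundary_part \<epsilon> \<sigma>) \<le> ennreal (c * \<epsilon> ^ k))"
    using bound unfolding piece_bound_def by blast
  show ?thesis
    unfolding CBC_def total_variation_parallel_curvature
  proof (intro exI[of _ c])
    show "AE \<epsilon> in lebesgue. 0 < \<epsilon> \<and> \<epsilon> < R \<longrightarrow> (\<forall>\<sigma>\<in>boundary_words N S r F U R \<epsilon>.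
        TV k \<epsilon> (overlap R \<epsilon> \<sigma>) \<le> ennreal (c * \<epsilon> ^ k))"
      using AEc reach_parallel_AE[OF \<open>RC F\<close>]
    proof eventually_elim
      case (elim \<epsilon>)
      show ?case
      proof (intro impI ballI)
        assume \<epsilon>: "0 < \<epsilon> \<and> \<epsilon> < R"
        fix \<sigma> assume "\<sigma> \<in> boundary_words N S r F U R \<epsilon>"
        then have \<sigma>: "\<sigma> \<in> cut_words N r R \<epsilon>" by (simp add: boundary_words_def)
        have reach: "0 < reach (closed_complement (parallel_set \<epsilon> F))" using elim(2) \<epsilon> by simp
        define P where "P = parallel_set \<epsilon> F"
        define Q where "Q = parallel_set \<epsilon> (piece \<sigma>)"
        define G where "G = frontier Q \<inter> frontier (\<Union>\<sigma>'\<in>cut_words N r R \<epsilon> - {\<sigma>}. parallel_set \<epsilon> (piece \<sigma>'))"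
        have cl: "closed P" "closed Q" unfolding P_def Q_def by (rule closed_parallel_set)+
        have QP: "Q \<subseteq> P" unfolding P_def Q_def by (rule parallel_piece_subset[OF cut_wordsD(1)[OF \<sigma>]])
        have "G \<subseteq> Q" using frontier_subset_closed[OF cl(2)] by (auto simp: G_def)
        have G: "G \<in> sets borel" unfolding G_def by (intro borel_closed closed_Int frontier_closed)
        have bP: "bounded P" unfolding P_def by (rule bounded_parallel_F)
        have "P = frontier P \<union> interior P"
          using cl(1) interior_subset[of P] by (auto simp: frontier_def)
        then have sub: "G \<subseteq> (frontier P \<inter> Q) \<union> interior P" using \<open>G \<subseteq> Q\<close> QP by blast
        have fQ: "frontier P \<inter> Q \<in> sets borel" "bounded (frontier P \<inter> Q)"
          using cl QP bounded_subset[OF bP] by (auto intro!: borel_closed closed_Int frontier_closed)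
        have "TV k \<epsilon> G \<le> TV k \<epsilon> ((frontier P \<inter> Q) \<union> interior P)"
          using G fQ(1) by (intro total_variation_mono[OF sub]) auto
        also have "\<dots> \<le> TV k \<epsilon> (frontier P \<inter> Q) + TV k \<epsilon> (interior P)"
          using fQ bounded_interior[OF bP]
          by (intro total_variation_Un signed_radon_curvature_measure[OF closed_closed_complement
                closed_complement_nonempty[OF bounded_parallel_F] reach k]) auto
        also have "TV k \<epsilon> (interior P) = 0"
          unfolding P_def by (rule total_variation_interior[OF bounded_parallel_F reach order_refl k])
        also have "TV k \<epsilon> (frontier P \<inter> Q) \<le> ennreal (c * \<epsilon> ^ k)"
          using elim(1) \<epsilon> \<sigma> by (simp add: P_def Q_def)
        finally show "TV k \<epsilon> (overlap R \<epsilon> \<sigma>) \<le> ennreal (c * \<epsilon> ^ k)"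
          by (simp add: G_def Q_def)
      qed
    qed
  qed
qed

end

lemma (in similarity) open_image: "open X \<Longrightarrow> open (S ` X)"
  unfolding image_eq_vimage
  by (rule open_vimage[OF _ continuous_on_inv[of UNIV]])

section \<open>Consequences of the open set condition\<close>

locale open_set_system = self_similar_system +
  fixes U :: "'a set"
  assumes osc: "osc_set N S U"
begin

lemma U: "U \<noteq> {}" "bounded U" "open U" "i \<in> {1..N} \<Longrightarrow> S i ` U \<subseteq> U"
  "i \<in> {1..N} \<Longrightarrow> j \<in> {1..N} \<Longrightarrow> i \<noteq> j \<Longrightarrow> S i ` U \<inter> S j ` U = {}"
  using osc unfolding osc_set_def hutchinson_def by blast+

lemma open_S_U: "i \<in> {1..N} \<Longrightarrow> open (S i ` U)"
  by (rule similarity.open_image[OF similarity_S U(3)])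

text \<open>Let x = S i y be a point of F farthest from U. Its distance from U is at most r i times
  that of y, so the largest distance is 0.\<close>

lemma F_subset_closure: "F \<subseteq> closure U"
proof -
  have "continuous_on F (\<lambda>x. infdist x U)" by (intro continuous_intros)
  then obtain x where x: "x \<in> F" "\<And>y. y \<in> F \<Longrightarrow> infdist y U \<le> infdist x U"
    using continuous_attains_sup[OF F(2,1)] by blast
  obtain i y where i: "i \<in> {1..N}" "y \<in> F" "x = S i y" using x(1) F(3) by blast
  have "infdist x U \<le> infdist (S i y) (S i ` U)"
    unfolding i(3) using U(1,4) i(1) by (intro infdist_mono) auto
  also have "\<dots> = r i * infdist y U" by (rule similarity.infdist_image[OF similarity_S[OF i(1)] U(1)])
  also have "\<dots> \<le> r i * infdist x U" using x(2)[OF i(2)] ratio(1)[OF i(1)] by (intro mult_left_mono) auto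
  finally have "infdist x U * (1 - r i) \<le> 0" by (simp add: algebra_simps)
  then have "infdist x U \<le> 0" using ratio(2)[OF i(1)] by (simp add: mult_le_0_iff)
  then have "infdist y U = 0" if "y \<in> F" for y
    using x(2)[OF that] infdist_nonneg[of y U] by simp
  then show ?thesis using in_closure_iff_infdist_zero[OF U(1)] by blast
qed

text \<open>F lies in the closure of U, and an open set disjoint from S i U is disjoint from its
  closure.\<close>

lemma F_Int_S_U:
  assumes "i \<in> {1..N}" "j \<in> {1..N}" "x \<in> S i ` F" "x \<in> S j ` U"
  shows "i = j"
proof (rule ccontr)
  assume "i \<noteq> j"
  have "x \<in> S i ` closure U" using assms(3) F_subset_closure by blast
  then have "x \<in> closure (S i ` U)" by (simp add: similarity.closure_image[OF similarity_S[OF assms(1)]])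
  moreover have "S j ` U \<inter> closure (S i ` U) = {}"
    using open_Int_closure_eq_empty[OF open_S_U[OF assms(2)]] U(5)[OF assms(2,1)] \<open>i \<noteq> j\<close> by blast
  ultimately show False using assms(4) by blast
qed

text \<open>Near an interior piece only the first-level copy containing it is visible, since a ball
  inside \<open>\<Union>\<^sub>i S\<^sub>i U\<close> lies in a single \<open>S\<^sub>i U\<close>.\<close>

lemma interior_piece_local:
  assumes \<sigma>: "i # w \<in> words" and "0 < \<epsilon>"
    and disj: "parallel_set \<epsilon> (piece (i # w)) \<inter> parallel_set \<epsilon> (- hutchinson N S U) = {}"
  obtains W where "open W" "parallel_set \<epsilon> (piece (i # w)) \<subseteq> W"
    "parallel_set \<epsilon> F \<inter> W = parallel_set \<epsilon> (S i ` F) \<inter> W"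
proof -
  have i: "i \<in> {1..N}" and w: "w \<in> words" using \<sigma> by auto
  define V where "V = - hutchinson N S U"
  have "closed V"
    unfolding V_def hutchinson_def using open_S_U by (auto intro!: open_UN simp: closed_def)
  have "hutchinson N S U \<subseteq> U" using osc by (simp add: osc_set_def)
  then have "hutchinson N S U \<noteq> UNIV" using U(2) bounded_subset not_bounded_UNIV by metis
  then have "V \<noteq> {}" by (auto simp: V_def)
  define K where "K = piece (i # w)"
  have K: "compact K" "K \<noteq> {}" unfolding K_def using piece[OF \<sigma>] by auto
  have d: "2 * \<epsilon> < setdist K V"
    using parallel_sets_apart[OF K \<open>closed V\<close> \<open>V \<noteq> {}\<close>] assms(2) disj by (simp add: K_def V_def)
  \<comment> \<open>A point of F within \<epsilon> of some x in W is within
    \<open>setdist K V\<close> of the point of K nearest to x, hence in a ball that misses V. W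
    contains the \<epsilon>-parallel set of K because 2 \<epsilon> <
    \<open>setdist K V\<close>.\<close>
  define W where "W = {x. infdist x K < setdist K V - \<epsilon>}"
  have KF: "K \<subseteq> S i ` F" unfolding K_def using piece_subset[OF w] by (auto simp: image_comp[symmetric])
  have "open W" unfolding W_def by (intro open_Collect_less continuous_intros)
  moreover have "parallel_set \<epsilon> K \<subseteq> W" using d by (auto simp: parallel_set_def W_def)
  moreover have "parallel_set \<epsilon> F \<inter> W = parallel_set \<epsilon> (S i ` F) \<inter> W"
  proof (intro equalityI subsetI IntI)
    fix x assume x: "x \<in> parallel_set \<epsilon> F \<inter> W"
    then show "x \<in> W" by blast
    obtain p where p: "p \<in> F" "dist x p \<le> \<epsilon>" using x parallel_set_iff[OF F(2,1)] by blast
    define p0 where "p0 = closest_point K x"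
    have p0: "p0 \<in> K" "dist x p0 < setdist K V - \<epsilon>"
      using x closest_point_infdist[OF compact_imp_closed[OF K(1)] K(2), of x] by (auto simp: p0_def W_def)
    define B where "B = ball p0 (setdist K V)"
    have pB: "p \<in> B" using dist_triangle[of p0 p x] p p0 by (simp add: B_def dist_commute)
    have "p0 \<in> B" using d \<open>0 < \<epsilon>\<close> by (simp add: B_def)
    have "B \<inter> V = {}"
      using setdist_le_dist[OF p0(1)] by (force simp: B_def)
    then have "B \<subseteq> hutchinson N S U" unfolding V_def by blast
    then have BU: "B \<subseteq> (\<Union>j\<in>{1..N}. S j ` U)" by (simp only: hutchinson_def)
    have "p0 \<in> S i ` F" using p0(1) KF by blast
    have p0i: "p0 \<in> S i ` U"
    proof -
      obtain l where "l \<in> {1..N}" "p0 \<in> S l ` U" using BU \<open>p0 \<in> B\<close> by blast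
      then show ?thesis using F_Int_S_U[OF i _ \<open>p0 \<in> S i ` F\<close>] by blast
    qed
    have "S i ` U \<inter> B = {} \<or> (\<Union>j\<in>{1..N} - {i}. S j ` U) \<inter> B = {}"
    proof (rule connectedD)
      show "connected B" unfolding B_def by (rule connected_ball)
      show "open (S i ` U)" "open (\<Union>j\<in>{1..N} - {i}. S j ` U)" using open_S_U i by auto
      show "S i ` U \<inter> (\<Union>j\<in>{1..N} - {i}. S j ` U) \<inter> B = {}" using U(5) i by blast
      show "B \<subseteq> S i ` U \<union> (\<Union>j\<in>{1..N} - {i}. S j ` U)" using BU by blast
    qed
    then have "p \<in> S i ` U" using p0i \<open>p0 \<in> B\<close> pB BU by blast
    moreover obtain m where m: "m \<in> {1..N}" "p \<in> S m ` F" using p(1) F(3) by blast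
    ultimately have "p \<in> S i ` F" using F_Int_S_U[OF m(1) i m(2)] by blast
    then show "x \<in> parallel_set \<epsilon> (S i ` F)"
      using p(2) by (auto simp: parallel_set_def intro: infdist_le2)
  next
    fix x assume x: "x \<in> parallel_set \<epsilon> (S i ` F) \<inter> W"
    then show "x \<in> W" by blast
    have "S i ` F \<subseteq> F" using F(3) i by blast
    then show "x \<in> parallel_set \<epsilon> F" using x parallel_set_mono[of "S i ` F" F \<epsilon>] F(1) by auto
  qed
  ultimately show ?thesis using that[of W] by (simp add: K_def)
qed

text \<open>Undoing the outermost map S i drops the first letter and turns \<epsilon> into
  \<epsilon> / r i, which keeps the cut condition for the same R. So the induction removes letters
  from the front and runs over all \<epsilon> at once.\<close>

lemma CBC_imp_piece_bound:
  assumes k: "k \<le> DIM('a)" and "RC F" and R: "sqrt 2 * diameter F < R" and CBC: "CBC k N S r F U R"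
  shows "piece_bound k R"
proof -
  have "0 \<le> sqrt 2 * diameter F" using diameter_F by simp
  then have "0 < R" using R by simp
  obtain c1 where AE1: "AE \<epsilon> in lebesgue. 0 < \<epsilon> \<and> \<epsilon> < R \<longrightarrow> (\<forall>\<sigma>\<in>boundary_words N S r F U R \<epsilon>.
        TV k \<epsilon> (overlap R \<epsilon> \<sigma>) \<le> ennreal (c1 * \<epsilon> ^ k))"
    using CBC unfolding CBC_def total_variation_parallel_curvature by blast
  define c2 where "c2 = steiner_constant DIM('a) k"
  have c2: "0 \<le> c2" unfolding c2_def by (rule steiner_constant_nonneg)
  note large = total_variation_large[OF k, folded c2_def]
  \<comment> \<open>CBC puts no sign on c1, hence the maximum. The overlap and the rest of a
    boundary part add up to c, and c2 \<le> c covers large distances.\<close>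
  define c where "c = max c1 0 + c2"
  have c: "0 \<le> c" "c2 \<le> c" using c2 by (auto simp: c_def)
  \<comment> \<open>What is needed at a single distance. The induction uses it at \<epsilon> divided
    by the ratio of any word, hence the quantifier over words in \<open>claim\<close>.\<close>
  define good where "good \<epsilon> \<longleftrightarrow> (0 < \<epsilon> \<longrightarrow> 0 < reach (closed_complement (parallel_set \<epsilon> F))) \<and>
    (0 < \<epsilon> \<and> \<epsilon> < R \<longrightarrow> (\<forall>\<sigma>\<in>boundary_words N S r F U R \<epsilon>.
        TV k \<epsilon> (overlap R \<epsilon> \<sigma>) \<le> ennreal (c1 * \<epsilon> ^ k)))" for \<epsilon>
  have claim: "TV k \<epsilon> (boundary_part \<epsilon> \<sigma>) \<le> ennreal (c * \<epsilon> ^ k)"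
    if "\<forall>w\<in>words. good (\<epsilon> / word_ratio r w)" "0 < \<epsilon>" "\<epsilon> < R" "\<sigma> \<in> cut_words N r R \<epsilon>" for \<epsilon> \<sigma>
    using that
  proof (induction \<sigma> arbitrary: \<epsilon>)
    case Nil
    then show ?case using cut_wordsD(2) by blast
  next
    case (Cons i w)
    note cut = cut_wordsD[OF Cons.prems(4)]
    note \<epsilon> = Cons.prems(2,3)
    have "[] \<in> words" by simp
    then have "good (\<epsilon> / word_ratio r [])" using Cons.prems(1) by blast
    then have good: "good \<epsilon>" by simp
    have i: "i \<in> {1..N}" and w: "w \<in> words" using cut(1) by auto
    interpret Si: similarity "S i" "r i" by (rule similarity_S[OF i])
    define P where "P = parallel_set \<epsilon> F"
    define Q where "Q = parallel_set \<epsilon> (piece (i # w))"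
    define E where "E = frontier P \<inter> Q"
    have cl: "closed P" "closed Q" unfolding P_def Q_def by (rule closed_parallel_set)+
    have QP: "Q \<subseteq> P" unfolding P_def Q_def by (rule parallel_piece_subset[OF cut(1)])
    have reach: "0 < reach (closed_complement P)" using good \<epsilon> by (simp add: good_def P_def)
    have bP: "bounded P" unfolding P_def by (rule bounded_parallel_F)
    have bQ: "bounded Q" by (rule bounded_subset[OF bP QP])
    have E: "E \<in> sets borel" "bounded E" "E \<subseteq> Q"
      using cl bounded_subset[OF bQ, of E] by (auto simp: E_def intro!: borel_closed closed_Int frontier_closed)
    have "TV k \<epsilon> E \<le> ennreal (c * \<epsilon> ^ k)"
    proof (cases "i # w \<in> boundary_words N S r F U R \<epsilon>")
      case True
      define Y where "Y = (\<Union>\<sigma>'\<in>cut_words N r R \<epsilon> - {i # w}. parallel_set \<epsilon> (piece \<sigma>'))"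
      have "closed Y"
        unfolding Y_def using finite_cut_words[OF \<open>0 < R\<close> \<epsilon>(1)]
        by (intro closed_UN finite_Diff ballI closed_parallel_set)
      have YP: "Y \<subseteq> P" unfolding Y_def P_def using parallel_piece_subset cut_wordsD(1) by blast
      have PQY: "P = Q \<union> Y"
      proof
        show "P \<subseteq> Q \<union> Y"
        proof
          fix x assume "x \<in> P"
          then obtain p where p: "p \<in> F" "dist x p \<le> \<epsilon>" unfolding P_def using parallel_set_iff[OF F(2,1)] by blast
          have "p \<in> (\<Union>v\<in>cut_words N r R \<epsilon>. piece v)"
            using p(1) cut_words_cover[OF \<open>0 < R\<close> \<epsilon>(1) less_imp_le[OF \<epsilon>(2)]] by blast
          then obtain v where "v \<in> cut_words N r R \<epsilon>" and pv: "p \<in> piece v" by blast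
          moreover have "x \<in> parallel_set \<epsilon> (piece v)"
            unfolding parallel_set_def using infdist_le2[OF pv p(2)] by simp
          ultimately show "x \<in> Q \<union> Y" by (cases "v = i # w") (auto simp: Q_def Y_def)
        qed
      qed (use QP YP in blast)
      have sY: "Y \<in> sets borel" using \<open>closed Y\<close> by (rule borel_closed)
      have 1: "TV k \<epsilon> (E \<inter> Y) \<le> ennreal (max c1 0 * \<epsilon> ^ k)"
      proof -
        \<comment> \<open>A point interior to Q or to Y is interior to P, so a frontier point of P
          that belongs to both sets lies on both frontiers.\<close>
        have "E \<inter> Y \<subseteq> frontier Q \<inter> frontier Y"
          using interior_mono[OF QP] interior_mono[OF YP] closure_subset[of Q] closure_subset[of Y]
          unfolding E_def frontier_def by blast
        then have "TV k \<epsilon> (E \<inter> Y) \<le> TV k \<epsilon> (frontier Q \<inter> frontier Y)"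
          using E(1) sY by (intro total_variation_mono) (auto intro!: borel_closed closed_Int frontier_closed)
        also have "\<dots> \<le> ennreal (c1 * \<epsilon> ^ k)"
          using good True \<epsilon> unfolding good_def Q_def Y_def by blast
        also have "\<dots> \<le> ennreal (max c1 0 * \<epsilon> ^ k)" using \<epsilon> by (intro ennreal_leI mult_right_mono) auto
        finally show ?thesis .
      qed
      have diam: "sqrt 2 * diameter (piece (i # w)) \<le> \<epsilon>"
      proof -
        have "sqrt 2 * diameter (piece (i # w)) \<le> sqrt 2 * (word_ratio r (i # w) * diameter F)"
          by (intro mult_left_mono diameter_piece cut(1)) simp
        also have "\<dots> = (sqrt 2 * diameter F) * word_ratio r (i # w)" by (simp add: mult_ac)
        also have "\<dots> \<le> R * word_ratio r (i # w)"
          using R word_ratio_pos[OF cut(1)] by (intro mult_right_mono) auto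
        finally show ?thesis using cut(3) by simp
      qed
      \<comment> \<open>Finitely many words are cut, so Y is closed and locality applies on its
        complement, where P and Q agree.\<close>
      have 2: "TV k \<epsilon> (E - Y) \<le> ennreal (c2 * \<epsilon> ^ k)"
      proof -
        have "ereal (\<epsilon> / 2) \<le> reach (closed_complement Q)"
          unfolding Q_def by (rule reach_closed_complement_parallel[OF piece[OF cut(1)] \<epsilon>(1) diam])
        moreover have "0 < ereal (\<epsilon> / 2)" using \<epsilon> by simp
        ultimately have reachQ: "0 < reach (closed_complement Q)" by (rule less_le_trans[rotated])
        have "TV k \<epsilon> (E - Y) \<le> total_variation (curvature_measure k (closed_complement Q)) (E - Y)"
          unfolding P_def[symmetric]
        proof (rule total_variation_local[OF bP reach bQ reachQ, of "- Y"])
          show "open (- Y)" using \<open>closed Y\<close> by (simp add: open_Compl)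
          show "P \<inter> - Y = Q \<inter> - Y" using PQY by blast
        qed (use E sY k in \<open>auto intro: bounded_subset\<close>)
        also have "\<dots> \<le> ennreal (c2 * \<epsilon> ^ k)"
          unfolding Q_def using E sY
          by (intro large piece[OF cut(1)] \<epsilon>(1) diam) (auto simp: Q_def)
        finally show ?thesis .
      qed
      have "TV k \<epsilon> ((E \<inter> Y) \<union> (E - Y)) \<le> TV k \<epsilon> (E \<inter> Y) + TV k \<epsilon> (E - Y)"
        unfolding P_def[symmetric] using E sY
        by (intro total_variation_Un signed_radon_curvature_measure[OF closed_closed_complement
              closed_complement_nonempty[OF bP] reach k]) (auto intro: bounded_subset)
      also have "\<dots> \<le> ennreal (max c1 0 * \<epsilon> ^ k) + ennreal (c2 * \<epsilon> ^ k)" by (intro add_mono 1 2)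
      also have "\<dots> = ennreal (c * \<epsilon> ^ k)"
        using \<epsilon> c2 by (simp add: c_def distrib_right flip: ennreal_plus)
      finally show ?thesis by (simp add: Int_Diff_Un)
    next
      case False
      then have disj: "parallel_set \<epsilon> (piece (i # w)) \<inter> parallel_set \<epsilon> (- hutchinson N S U) = {}"
        using Cons.prems(4) by (simp add: boundary_words_def)
      obtain W where W: "open W" "Q \<subseteq> W" "P \<inter> W = parallel_set \<epsilon> (S i ` F) \<inter> W"
        using interior_piece_local[OF cut(1) \<epsilon>(1) disj] unfolding P_def Q_def by blast
      define e where "e = \<epsilon> / r i"
      have ri: "0 < r i" "r i < 1" using ratio[OF i] by auto
      have e: "0 < e" "r i * e = \<epsilon>" using \<epsilon> ri by (auto simp: e_def)
      have goods: "\<forall>v\<in>words. good (e / word_ratio r v)"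
      proof
        fix v assume "v \<in> words"
        then have "i # v \<in> words" using i by simp
        then have "good (\<epsilon> / word_ratio r (i # v))" using Cons.prems(1) by blast
        then show "good (e / word_ratio r v)" by (simp add: e_def)
      qed
      have "[] \<in> words" by simp
      then have "good (e / word_ratio r [])" using goods by blast
      then have reach_e: "0 < reach (closed_complement (parallel_set e F))" using e(1) by (simp add: good_def)
      have SF: "parallel_set \<epsilon> (S i ` F) = S i ` parallel_set e F"
        using Si.parallel_set_image[OF F(1), of e] e(2) by simp
      have SQ: "Q = S i ` parallel_set e (piece w)"
        using Si.parallel_set_image[OF piece(2)[OF w], of e] e(2) by (simp add: Q_def image_comp)
      define E' where "E' = S i -` E"
      have EE': "S i ` E' = E" unfolding E'_def by (rule surj_image_vimage_eq[OF Si.surj_S])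
      define B where "B = frontier (parallel_set e F) \<inter> parallel_set e (piece w)"
      have B: "B \<in> sets borel" "bounded B" "B \<subseteq> parallel_set e F"
        using parallel_piece_subset[OF w, of e] bounded_subset[OF bounded_parallel_F]
        by (auto simp: B_def intro!: borel_closed closed_Int frontier_closed closed_parallel_set)
      have E'B: "E' \<subseteq> B"
      proof
        fix y assume "y \<in> E'"
        then have y: "S i y \<in> frontier P" "S i y \<in> Q" by (auto simp: E'_def E_def)
        have yw: "y \<in> parallel_set e (piece w)"
          using y(2) inj_image_mem_iff[OF Si.inj_S] by (simp add: SQ)
        \<comment> \<open>An interior point of F_e is mapped to an interior point of P, since S i
          maps F_e onto the \<epsilon>-parallel set of S i F, a subset of P.\<close>
        have "y \<notin> interior (parallel_set e F)"
        proof
          assume "y \<in> interior (parallel_set e F)"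
          then have "S i y \<in> S i ` interior (parallel_set e F)" by simp
          moreover have "S i ` interior (parallel_set e F) \<subseteq> P"
          proof -
            have "S i ` F \<subseteq> F" using F(3) i by blast
            then have "parallel_set \<epsilon> (S i ` F) \<subseteq> P"
              unfolding P_def using F(1) by (intro parallel_set_mono) auto
            then show ?thesis unfolding SF using interior_subset[of "parallel_set e F"] by blast
          qed
          moreover have "open (S i ` interior (parallel_set e F))" by (rule Si.open_image[OF open_interior])
          ultimately have "S i y \<in> interior P" by (meson interiorI)
          then show False using y(1) by (simp add: frontier_def)
        qed
        moreover have "y \<in> closure (parallel_set e F)"
          using yw parallel_piece_subset[OF w, of e] closure_subset by blast
        ultimately show "y \<in> B" using yw by (simp add: B_def frontier_def)
      qed
      have E': "E' \<in> sets borel" "bounded E'"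
      proof -
        show "E' \<in> sets borel"
          unfolding E'_def
          using measurable_sets[OF borel_measurable_continuous_onI[OF Si.continuous_on_S[of UNIV]] E(1)] by simp
        show "bounded E'" by (rule bounded_subset[OF B(2) E'B])
      qed
      \<comment> \<open>For e < R the word w is nonempty and cut at e: an empty w would mean R * r i
        < \<epsilon>, that is R < e. For e \<ge> R, which exceeds sqrt 2 * diam F, the absolute
        bound ends the recursion.\<close>
      have step: "TV k e B \<le> ennreal (c * e ^ k)"
      proof (cases "e < R")
        case True
        have "w \<noteq> []"
        proof
          assume "w = []"
          then have "R * r i < \<epsilon>" using cut(3) by simp
          then show False using True ri by (simp add: e_def field_simps)
        qed
        have "w \<in> cut_words N r R e"
          using cut(3,4) w \<open>w \<noteq> []\<close> ri by (auto simp: cut_words_def e_def field_simps)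
        then show ?thesis unfolding B_def by (rule Cons.IH[OF goods e(1) True])
      next
        case False
        then have "TV k e B \<le> ennreal (c2 * e ^ k)"
          using R B by (intro large F e(1)) auto
        also have "\<dots> \<le> ennreal (c * e ^ k)" using c e(1) by (intro ennreal_leI mult_right_mono) auto
        finally show ?thesis .
      qed
      define A where "A = closed_complement (parallel_set e F)"
      have A: "closed A" "A \<noteq> {}" "0 < reach A"
        unfolding A_def using closed_closed_complement closed_complement_nonempty[OF bounded_parallel_F] reach_e by auto
      have CA: "closed_complement (parallel_set \<epsilon> (S i ` F)) = S i ` A"
        unfolding SF A_def by (rule Si.closed_complement_image)
      have "TV k \<epsilon> E \<le> total_variation (curvature_measure k (closed_complement (parallel_set \<epsilon> (S i ` F)))) E"
        unfolding P_def[symmetric]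
      proof (rule total_variation_local[OF bP reach _ _ W(1,3) E(1,2) _ k])
        show "bounded (parallel_set \<epsilon> (S i ` F))"
          unfolding SF by (rule Si.bounded_S_image[OF bounded_parallel_F])
        show "0 < reach (closed_complement (parallel_set \<epsilon> (S i ` F)))"
          unfolding CA by (rule Si.reach_image_pos[OF A])
        show "E \<subseteq> W" using E(3) W(2) by blast
      qed
      also have "\<dots> \<le> ennreal (r i ^ k) * total_variation (curvature_measure k A) E'"
        using Si.total_variation_image[OF A E' k] unfolding CA EE' .
      also have "\<dots> \<le> ennreal (r i ^ k) * TV k e B"
        unfolding A_def using E'(1) B(1) by (intro mult_left_mono total_variation_mono[OF E'B]) auto
      also have "\<dots> \<le> ennreal (r i ^ k) * ennreal (c * e ^ k)" by (intro mult_left_mono step) auto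
      \<comment> \<open>Since r i * e = \<epsilon>, the factor r i ^ k is absorbed exactly, and the
        constant does not grow along the word.\<close>
      also have "\<dots> = ennreal (c * \<epsilon> ^ k)"
        using ri c(1) e(1) by (simp add: ennreal_mult[symmetric] e(2)[symmetric] power_mult_distrib mult_ac)
      finally show ?thesis .
    qed
    then show ?case by (simp add: E_def P_def Q_def)
  qed
  have "AE \<epsilon> in lebesgue. good \<epsilon>"
    using reach_parallel_AE[OF \<open>RC F\<close>] AE1 unfolding good_def by eventually_elim blast
  then have "AE \<epsilon> in lebesgue. \<forall>w\<in>words. good (\<epsilon> / word_ratio r w)" by (rule AE_all_scales)
  then have "AE \<epsilon> in lebesgue. 0 < \<epsilon> \<and> \<epsilon> < R \<longrightarrow>
    (\<forall>\<sigma>\<in>cut_words N r R \<epsilon>. TV k \<epsilon> (boundary_part \<epsilon> \<sigma>) \<le> ennreal (c * \<epsilon> ^ k))"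
    by (rule eventually_mono) (use claim in blast)
  then show ?thesis using c(1) unfolding piece_bound_def by blast
qed

end

theorem corollary4p5:
  fixes S :: "nat \<Rightarrow> 'a::euclidean_space \<Rightarrow> 'a"
    and r :: "nat \<Rightarrow> real"
    and F U :: "'a set"
    and N k :: nat
    and R1 R2 :: real
  assumes "2 \<le> DIM('a)"
    and "k \<le> DIM('a) - 2"
    and "contracting_similarities N S r"
    and "self_similar_set N S F"
    and "OSC N S"
    and "sosc_set N S F U"
    and "RC F"
    and "R1 > sqrt 2 * diameter F"
    and "R2 > sqrt 2 * diameter F"
  shows "CBC k N S r F U R1 \<longleftrightarrow> CBC k N S r F U R2"
proof -
  interpret open_set_system N S r F U
    using assms(3,4,6) by unfold_locales (simp_all add: sosc_set_def)
  have k: "k \<le> DIM('a)" using assms(2) by simp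
  have "CBC k N S r F U R \<longleftrightarrow> piece_bound k R" if "sqrt 2 * diameter F < R" for R
    using CBC_imp_piece_bound[OF k assms(7) that] piece_bound_imp_CBC[OF k assms(7)] by blast
  moreover have "piece_bound k R1 \<longleftrightarrow> piece_bound k R2"
    using piece_bound_change[OF k assms(7)] assms(8,9) by blast
  ultimately show ?thesis using assms(8,9) by blast
qed

end
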